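(* Let $(Z,z)$ be a germ of complex analytic normal surface, let $\pi=(f,g):(Z,z)\to(\mathbb{C}^2,0)$ be a finite complex analytic morphism germ, and let $\Lambda=\langle f,g\rangle$ be the associated pencil. Let $\rho$ be the minimal good resolution of $\Lambda$, let $\Delta\in SZ(\Lambda)$ be a special zone, and let $e\in\mathbb{C}\mathbb{P}^1$. Then the strict transform of $\Phi_e$ by $\rho$ intersects $\Delta$ if and only if $\Phi_e$ is a special fibre and $\widehat h(\Delta)=e$.
   Context: Pencil. For $w=(w_1:w_2)\in\mathbb{C}\mathbb{P}^1$ put $\phi_w=w_2f-w_1g$ (defined up to a nonzero scalar); $\Lambda=\{w_2f-w_1g\}$. The fibre $\Phi_w$ is the (not necessarily reduced) zero locus of $\phi_w$. Let $h=f/g$, seen as the map $h(x)=(f(x):g(x))\in\mathbb{C}\mathbb{P}^1$ on a punctured neighbourhood of $z$ in $Z$. Resolutions. A good resolution $\rho:(X,E)\to(Z,z)$ is a resolution of the singularity $(Z,z)$ whose exceptional divisor $E=\rho^{-1}(z)$ is a union of smooth projective curves with normal crossings (in particular no three components meet at a point). The strict transform by $\rho$ of a curve $C$ is $\overline{\rho^{-1}(C\setminus\{z\})}$. A good resolution of the pencil $\Lambda$ is a good resolution of $(Z,z)$ such that $\widehat h=h\circ\rho$ extends to a morphism to $\mathbb{C}\mathbb{P}^1$ on a neighbourhood of $E$. It is minimal if contracting any rational component of $E$ of self-intersection $-1$ never gives a good resolution of $\Lambda$. There is a unique minimal good resolution of $\Lambda$. An irreducible component of $E$ is dicritical if the restriction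 of $\widehat h$ to it is not constant. Special zones, values and fibres. Let $\rho:(Y,E)\to(Z,z)$ be the minimal good resolution of $\Lambda$, $\widehat h=h\circ\rho$, and let $\mathcal{D}$ be the union of the dicritical components of $E$. The finite set $SZ(\Lambda)$ of special zones consists of: the connected components of $\overline{E\setminus\mathcal{D}}$; the critical points of the restriction of $\widehat h$ to $\mathcal{D}$ that do not lie on $\overline{E\setminus\mathcal{D}}$; and the intersection points between two dicritical components. The map $\widehat h$ is constant on each special zone $\Delta$. The special values of $\Lambda$ are the values $\widehat h(\Delta)$, $\Delta\in SZ(\Lambda)$, and $\Phi_e$ is a special fibre if $e$ is a special value. *)

theory Defs
  imports "HOL-Complex_Analysis.Complex_Analysis"
begin

section \<open>Holomorphic functions of several variables; germs of analytic sets\<close>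

definition cholomorphic_on :: "(complex^'m \<Rightarrow> complex) \<Rightarrow> (complex^'m) set \<Rightarrow> bool" where
  "cholomorphic_on F S \<longleftrightarrow> open S \<and>
     (\<forall>x\<in>S. \<exists>D. (F has_derivative D) (at x) \<and> (\<forall>c v. D (c *s v) = c * D v))"

text \<open>Holomorphic functions on a reduced analytic set: local restrictions of ambient holomorphic
  functions.\<close>

definition hol_on_set :: "(complex^'n) set \<Rightarrow> (complex^'n \<Rightarrow> complex) \<Rightarrow> bool" where
  "hol_on_set A F \<longleftrightarrow>
     (\<forall>p\<in>A. \<exists>W G. p \<in> W \<and> cholomorphic_on G W \<and> (\<forall>q\<in>A \<inter> W. F q = G q))"

definition hol_germ :: "(complex^'n) set \<Rightarrow> complex^'n \<Rightarrow> (complex^'n \<Rightarrow> complex) \<Rightarrow> bool" where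
  "hol_germ Z z F \<longleftrightarrow> (\<exists>U. open U \<and> z \<in> U \<and> hol_on_set (Z \<inter> U) F)"

definition zero_germ :: "(complex^'n) set \<Rightarrow> complex^'n \<Rightarrow> (complex^'n \<Rightarrow> complex) \<Rightarrow> bool" where
  "zero_germ Z z F \<longleftrightarrow> (\<forall>\<^sub>F x in nhds z. x \<in> Z \<longrightarrow> F x = 0)"

definition analytic_germ :: "(complex^'n) set \<Rightarrow> complex^'n \<Rightarrow> bool" where
  "analytic_germ Z z \<longleftrightarrow> z \<in> Z \<and>
     (\<exists>U S. open U \<and> z \<in> U \<and> finite S \<and> (\<forall>F\<in>S. cholomorphic_on F U) \<and>
        Z \<inter> U = {x \<in> U. \<forall>F\<in>S. F x = 0})"

text \<open>The points near which \<open>Z\<close> is biholomorphic to an open subset of the complex plane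
  of dimension two.\<close>

definition regular_points2 :: "(complex^'n) set \<Rightarrow> (complex^'n) set" where
  "regular_points2 Z = {p \<in> Z. \<exists>W B (\<psi> :: complex^2 \<Rightarrow> complex^'n) (\<sigma> :: complex^'n \<Rightarrow> complex^2).
     open W \<and> p \<in> W \<and> open B \<and>
     (\<forall>i. cholomorphic_on (\<lambda>b. \<psi> b $ i) B) \<and> (\<forall>i. hol_on_set (Z \<inter> W) (\<lambda>q. \<sigma> q $ i)) \<and>
     \<psi> ` B = Z \<inter> W \<and> (\<forall>b\<in>B. \<sigma> (\<psi> b) = b)}"

definition pure_dim2_germ :: "(complex^'n) set \<Rightarrow> complex^'n \<Rightarrow> bool" where
  "pure_dim2_germ Z z \<longleftrightarrow>
     (\<exists>U. open U \<and> z \<in> U \<and> Z \<inter> U \<subseteq> closure (regular_points2 Z))"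

text \<open>The local ring of holomorphic germs on \<open>Z\<close> at \<open>z\<close> is an integral domain which is integrally
  closed in its field of fractions: if \<open>P/Q\<close> is a root of a monic polynomial of degree \<open>d\<close> with
  coefficients \<open>a i\<close> in the ring (the equation is multiplied by \<open>Q ^ d\<close>), then \<open>P/Q\<close> is in
  the ring.\<close>

definition normal_germ :: "(complex^'n) set \<Rightarrow> complex^'n \<Rightarrow> bool" where
  "normal_germ Z z \<longleftrightarrow>
     (\<forall>F G. hol_germ Z z F \<and> hol_germ Z z G \<and> zero_germ Z z (\<lambda>x. F x * G x) \<longrightarrow>
        zero_germ Z z F \<or> zero_germ Z z G) \<and>
     (\<forall>P Q (d::nat) a. hol_germ Z z P \<and> hol_germ Z z Q \<and> \<not> zero_germ Z z Q \<and>
        (\<forall>i<d. hol_germ Z z (a i)) \<and>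
        zero_germ Z z (\<lambda>x. P x ^ d + (\<Sum>i<d. a i x * P x ^ i * Q x ^ (d - i))) \<longrightarrow>
        (\<exists>R. hol_germ Z z R \<and> zero_germ Z z (\<lambda>x. P x - R x * Q x)))"

text \<open>Every germ of a reduced complex space is isomorphic to the germ of an analytic subset of some
  complex number space; normal germs are reduced.\<close>

definition normal_surface_germ :: "(complex^'n) set \<Rightarrow> complex^'n \<Rightarrow> bool" where
  "normal_surface_germ Z z \<longleftrightarrow> analytic_germ Z z \<and> pure_dim2_germ Z z \<and> normal_germ Z z"

text \<open>A germ is finite if it has a finite representative, i.e. a closed map with finite fibres.
  (In the library, \<open>proper_map\<close> means closed with compact fibres.)\<close>

definition finite_morphism_germ ::
  "(complex^'n) set \<Rightarrow> complex^'n \<Rightarrow> (complex^'n \<Rightarrow> complex) \<Rightarrow> (complex^'n \<Rightarrow> complex) \<Rightarrow> bool" where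
  "finite_morphism_germ Z z f g \<longleftrightarrow> f z = 0 \<and> g z = 0 \<and>
     (\<exists>U V. open U \<and> z \<in> U \<and> open V \<and> (0, 0) \<in> V \<and>
        hol_on_set (Z \<inter> U) f \<and> hol_on_set (Z \<inter> U) g \<and>
        (\<lambda>x. (f x, g x)) ` (Z \<inter> U) \<subseteq> V \<and>
        proper_map (top_of_set (Z \<inter> U)) (top_of_set V) (\<lambda>x. (f x, g x)) \<and>
        (\<forall>w\<in>V. finite {x \<in> Z \<inter> U. (f x, g x) = w}))"


section \<open>The complex projective line\<close>

typedef cp1 = "{L :: (complex \<times> complex) set.
    \<exists>a b. (a, b) \<noteq> (0, 0) \<and> L = range (\<lambda>c. (c * a, c * b))}"
  morphisms line_of cp1_of_line
proof -
  have "range (\<lambda>c. (c * 1, c * 0)) \<in> {L :: (complex \<times> complex) set.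
      \<exists>a b. (a, b) \<noteq> (0, 0) \<and> L = range (\<lambda>c. (c * a, c * b))}"
    by (intro CollectI exI[of _ 1] exI[of _ 0]) simp
  then show ?thesis by blast
qed

text \<open>The point \<open>(a : b)\<close>; unspecified for \<open>a = b = 0\<close>.\<close>

definition hom_point :: "complex \<Rightarrow> complex \<Rightarrow> cp1" where
  "hom_point a b = cp1_of_line (range (\<lambda>c. (c * a, c * b)))"

lemma hom_point_eq_iff:
  assumes "(a, b) \<noteq> (0, 0)" and "(c, d) \<noteq> (0, 0)"
  shows "hom_point a b = hom_point c d \<longleftrightarrow> a * d = b * c"
proof -
  let ?L = "\<lambda>a b. range (\<lambda>t::complex. (t * a, t * b))"
  have "hom_point a b = hom_point c d \<longleftrightarrow> ?L a b = ?L c d"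
    unfolding hom_point_def using assms by (intro cp1_of_line_inject CollectI) blast+
  also have "\<dots> \<longleftrightarrow> a * d = b * c"
  proof
    assume "?L a b = ?L c d"
    moreover have "(a, b) \<in> ?L a b" by (rule range_eqI[of _ _ 1]) simp
    ultimately obtain t where "a = t * c" "b = t * d" by auto
    then show "a * d = b * c" by simp
  next
    assume eq: "a * d = b * c"
    have sub: "?L a b \<subseteq> ?L c d" if "(c, d) \<noteq> (0, 0)" "a * d = b * c" for a b c d :: complex
    proof -
      have "\<exists>s. a = s * c \<and> b = s * d"
      proof (cases "c = 0")
        case True
        then have "d \<noteq> 0" "a = 0" using that by auto
        then show ?thesis using True by (intro exI[of _ "b / d"]) auto
      next
        case False
        then show ?thesis using that by (intro exI[of _ "a / c"]) (auto simp: field_simps)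
      qed
      then obtain s where s: "a = s * c" "b = s * d" by blast
      show ?thesis
      proof clarify
        fix t show "(t * a, t * b) \<in> ?L c d"
          by (rule range_eqI[of _ _ "t * s"]) (simp add: s)
      qed
    qed
    show "?L a b = ?L c d"
      using sub[OF assms(2) eq] sub[of a b c d] sub[OF assms(1), of c d] eq
      by (simp add: mult.commute subset_antisym)
  qed
  finally show ?thesis .
qed

text \<open>Affine coordinates off \<open>(1 : 0)\<close> and off \<open>(0 : 1)\<close>.\<close>

definition affine_coord :: "cp1 \<Rightarrow> complex" where
  "affine_coord w = (THE c. w = hom_point c 1)"

definition affine_coord_inf :: "cp1 \<Rightarrow> complex" where
  "affine_coord_inf w = (THE c. w = hom_point 1 c)"


section \<open>Complex surfaces, i.e. two-dimensional complex manifolds\<close>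

text \<open>Surfaces are carried by an abstract topology rather than by a type, so that all contractions
  of a surface can be found over the same type.\<close>

record 'x csurface =
  Top :: "'x topology"
  Atlas :: "('x set \<times> ('x \<Rightarrow> complex^2)) set"

definition top_chart :: "'x topology \<Rightarrow> 'x set \<Rightarrow> ('x \<Rightarrow> complex^2) \<Rightarrow> bool" where
  "top_chart T V \<phi> \<longleftrightarrow> openin T V \<and> open (\<phi> ` V) \<and>
     homeomorphic_map (subtopology T V) (top_of_set (\<phi> ` V)) \<phi>"

definition transition_hol ::
  "'x set \<Rightarrow> ('x \<Rightarrow> complex^2) \<Rightarrow> 'x set \<Rightarrow> ('x \<Rightarrow> complex^2) \<Rightarrow> bool" where
  "transition_hol V \<phi> W \<psi> \<longleftrightarrow>
     (\<forall>i. cholomorphic_on (\<lambda>y. \<psi> (inv_into V \<phi> y) $ i) (\<phi> ` (V \<inter> W)))"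

definition complex_surface :: "'x csurface \<Rightarrow> bool" where
  "complex_surface X \<longleftrightarrow> Hausdorff_space (Top X) \<and> second_countable (Top X) \<and>
     (\<Union>(V, \<phi>)\<in>Atlas X. V) = topspace (Top X) \<and>
     (\<forall>(V, \<phi>)\<in>Atlas X. top_chart (Top X) V \<phi>) \<and>
     (\<forall>(V, \<phi>)\<in>Atlas X. \<forall>(W, \<psi>)\<in>Atlas X. transition_hol V \<phi> W \<psi>)"

text \<open>Charts of the maximal atlas.\<close>

definition chart :: "'x csurface \<Rightarrow> 'x set \<Rightarrow> ('x \<Rightarrow> complex^2) \<Rightarrow> bool" where
  "chart X V \<phi> \<longleftrightarrow> top_chart (Top X) V \<phi> \<and>
     (\<forall>(W, \<psi>)\<in>Atlas X. transition_hol V \<phi> W \<psi> \<and> transition_hol W \<psi> V \<phi>)"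

definition hol_fun :: "'x csurface \<Rightarrow> 'x set \<Rightarrow> ('x \<Rightarrow> complex) \<Rightarrow> bool" where
  "hol_fun X W F \<longleftrightarrow> openin (Top X) W \<and>
     (\<forall>(V, \<phi>)\<in>Atlas X. cholomorphic_on (\<lambda>y. F (inv_into V \<phi> y)) (\<phi> ` (V \<inter> W)))"

text \<open>Continuity is implied, since \<open>hol_fun\<close> requires its domain to be open.\<close>

definition hol_map :: "'x csurface \<Rightarrow> 'x set \<Rightarrow> ('x \<Rightarrow> 'x) \<Rightarrow> 'x csurface \<Rightarrow> bool" where
  "hol_map X W c Y \<longleftrightarrow> openin (Top X) W \<and> c ` W \<subseteq> topspace (Top Y) \<and>
     (\<forall>(V, \<psi>)\<in>Atlas Y. \<forall>i. hol_fun X {x \<in> W. c x \<in> V} (\<lambda>x. \<psi> (c x) $ i))"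

definition hol_to_cp1 :: "'x csurface \<Rightarrow> 'x set \<Rightarrow> ('x \<Rightarrow> cp1) \<Rightarrow> bool" where
  "hol_to_cp1 X W H \<longleftrightarrow> openin (Top X) W \<and>
     (\<forall>p\<in>W. \<exists>N a b. p \<in> N \<and> N \<subseteq> W \<and> hol_fun X N a \<and> hol_fun X N b \<and>
        (\<forall>x\<in>N. (a x, b x) \<noteq> (0, 0) \<and> H x = hom_point (a x) (b x)))"

definition entire_curve :: "'x csurface \<Rightarrow> (complex \<Rightarrow> 'x) \<Rightarrow> bool" where
  "entire_curve X \<gamma> \<longleftrightarrow> range \<gamma> \<subseteq> topspace (Top X) \<and>
     (\<forall>(V, \<phi>)\<in>Atlas X. open {t. \<gamma> t \<in> V} \<and> (\<forall>i. (\<lambda>t. \<phi> (\<gamma> t) $ i) holomorphic_on {t. \<gamma> t \<in> V}))"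


section \<open>Curves on a surface\<close>

definition adapted_chart :: "'x csurface \<Rightarrow> 'x set \<Rightarrow> 'x set \<Rightarrow> ('x \<Rightarrow> complex^2) \<Rightarrow> bool" where
  "adapted_chart X C V \<phi> \<longleftrightarrow> chart X V \<phi> \<and> C \<inter> V = {x \<in> V. \<phi> x $ 2 = 0}"

text \<open>In an adapted chart, the first coordinate is a local parameter on the curve. The
  parametrisation below is centred at \<open>p\<close> and only its germ at \<open>0\<close> is meaningful.\<close>

definition curve_param :: "'x set \<Rightarrow> ('x \<Rightarrow> complex^2) \<Rightarrow> 'x \<Rightarrow> complex \<Rightarrow> 'x" where
  "curve_param V \<phi> p t = inv_into V \<phi> (\<phi> p + axis 1 t)"

definition curve_regular_points :: "'x csurface \<Rightarrow> 'x set \<Rightarrow> 'x set" where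
  "curve_regular_points X E = {p \<in> E. \<exists>V \<phi>. p \<in> V \<and> adapted_chart X E V \<phi>}"

definition irreducible_components :: "'x csurface \<Rightarrow> 'x set \<Rightarrow> 'x set set" where
  "irreducible_components X E =
     (\<lambda>K. Top X closure_of K) `
       connected_components_of (subtopology (Top X) (curve_regular_points X E))"

text \<open>Smooth projective curves embedded in \<open>X\<close> are the same as connected compact
  one-dimensional complex submanifolds.\<close>

definition smooth_projective_curve :: "'x csurface \<Rightarrow> 'x set \<Rightarrow> bool" where
  "smooth_projective_curve X C \<longleftrightarrow> C \<noteq> {} \<and> compactin (Top X) C \<and> connectedin (Top X) C \<and>
     curve_regular_points X C = C"

definition normal_crossings :: "'x csurface \<Rightarrow> 'x set \<Rightarrow> bool" where
  "normal_crossings X E \<longleftrightarrow> (\<forall>p\<in>E. \<exists>V \<phi>. p \<in> V \<and> chart X V \<phi> \<and> \<phi> p = 0 \<and>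
     (E \<inter> V = {x \<in> V. \<phi> x $ 2 = 0} \<or> E \<inter> V = {x \<in> V. \<phi> x $ 1 * \<phi> x $ 2 = 0}))"

text \<open>For smooth \<open>C\<close>, a holomorphic bijection from the projective line to \<open>C\<close> is biholomorphic.\<close>

definition rational_curve :: "'x csurface \<Rightarrow> 'x set \<Rightarrow> bool" where
  "rational_curve X C \<longleftrightarrow> (\<exists>\<sigma> :: cp1 \<Rightarrow> 'x. bij_betw \<sigma> UNIV C \<and>
     entire_curve X (\<lambda>t. \<sigma> (hom_point t 1)) \<and> entire_curve X (\<lambda>t. \<sigma> (hom_point 1 t)))"

text \<open>A nonzero meromorphic section of the normal bundle of a smooth curve \<open>C\<close>, by its components in
  the frames \<open>\<partial>/\<partial>y\<close> of the adapted charts \<open>(x, y)\<close>. The transition function is the partial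
  derivative of the new second coordinate with respect to the old one, on the curve. The value at a
  pole is irrelevant (it may be taken to be \<open>0\<close>).\<close>

definition normal_transition ::
  "'x set \<Rightarrow> ('x \<Rightarrow> complex^2) \<Rightarrow> ('x \<Rightarrow> complex^2) \<Rightarrow> 'x \<Rightarrow> complex" where
  "normal_transition V \<phi> \<psi> p = deriv (\<lambda>t. \<psi> (inv_into V \<phi> (\<phi> p + axis 2 t)) $ 2) 0"

definition normal_section ::
  "'x csurface \<Rightarrow> 'x set \<Rightarrow> ('x set \<Rightarrow> ('x \<Rightarrow> complex^2) \<Rightarrow> 'x \<Rightarrow> complex) \<Rightarrow> bool" where
  "normal_section X C s \<longleftrightarrow>
     (\<forall>V \<phi>. adapted_chart X C V \<phi> \<longrightarrow> (\<forall>p\<in>C \<inter> V.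
        (\<lambda>t. s V \<phi> (curve_param V \<phi> p t)) meromorphic_on {0} \<and>
        (\<exists>\<^sub>F t in at 0. s V \<phi> (curve_param V \<phi> p t) \<noteq> 0))) \<and>
     (\<forall>V \<phi> W \<psi>. adapted_chart X C V \<phi> \<and> adapted_chart X C W \<psi> \<longrightarrow>
        (\<forall>p\<in>C \<inter> V \<inter> W. s W \<psi> p = normal_transition V \<phi> \<psi> p * s V \<phi> p))"

definition section_order ::
  "'x csurface \<Rightarrow> 'x set \<Rightarrow> ('x set \<Rightarrow> ('x \<Rightarrow> complex^2) \<Rightarrow> 'x \<Rightarrow> complex) \<Rightarrow> 'x \<Rightarrow> int" where
  "section_order X C s p = (THE k. \<exists>V \<phi>. adapted_chart X C V \<phi> \<and> p \<in> V \<and>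
     k = zorder (\<lambda>t. s V \<phi> (curve_param V \<phi> p t)) 0)"

text \<open>The self-intersection number of a smooth compact curve is the degree of its normal bundle;
  the degree does not depend on the section, and the sum is over a finite set by compactness.\<close>

definition self_intersection :: "'x csurface \<Rightarrow> 'x set \<Rightarrow> int" where
  "self_intersection X C = (THE k. \<exists>s. normal_section X C s \<and>
     k = (\<Sum>p\<in>{p \<in> C. section_order X C s p \<noteq> 0}. section_order X C s p))"


section \<open>Resolutions\<close>

definition exceptional_divisor :: "complex^'n \<Rightarrow> 'x csurface \<Rightarrow> ('x \<Rightarrow> complex^'n) \<Rightarrow> 'x set" where
  "exceptional_divisor z X \<rho> = {x \<in> topspace (Top X). \<rho> x = z}"

text \<open>The target is a representative \<open>Z \<inter> U\<close> of the germ. The last condition says that the inverse of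
  \<open>\<rho>\<close>, read in charts, is holomorphic outside \<open>z\<close>.\<close>

definition resolution ::
  "(complex^'n) set \<Rightarrow> complex^'n \<Rightarrow> 'x csurface \<Rightarrow> ('x \<Rightarrow> complex^'n) \<Rightarrow> bool" where
  "resolution Z z X \<rho> \<longleftrightarrow> complex_surface X \<and>
     (\<exists>U. open U \<and> z \<in> U \<and> \<rho> ` topspace (Top X) = Z \<inter> U \<and>
        proper_map (Top X) (top_of_set (Z \<inter> U)) \<rho> \<and>
        (\<forall>i. hol_fun X (topspace (Top X)) (\<lambda>x. \<rho> x $ i)) \<and>
        bij_betw \<rho> (topspace (Top X) - exceptional_divisor z X \<rho>) (Z \<inter> U - {z}) \<and>
        (\<forall>(V, \<phi>)\<in>Atlas X. \<forall>i. hol_on_set (\<rho> ` (V - exceptional_divisor z X \<rho>))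
           (\<lambda>q. \<phi> (inv_into (topspace (Top X) - exceptional_divisor z X \<rho>) \<rho> q) $ i)))"

definition good_resolution ::
  "(complex^'n) set \<Rightarrow> complex^'n \<Rightarrow> 'x csurface \<Rightarrow> ('x \<Rightarrow> complex^'n) \<Rightarrow> bool" where
  "good_resolution Z z X \<rho> \<longleftrightarrow> resolution Z z X \<rho> \<and>
     normal_crossings X (exceptional_divisor z X \<rho>) \<and>
     (\<forall>C\<in>irreducible_components X (exceptional_divisor z X \<rho>). smooth_projective_curve X C)"

definition strict_transform ::
  "complex^'n \<Rightarrow> 'x csurface \<Rightarrow> ('x \<Rightarrow> complex^'n) \<Rightarrow> (complex^'n) set \<Rightarrow> 'x set" where
  "strict_transform z X \<rho> C = Top X closure_of {x \<in> topspace (Top X). \<rho> x \<in> C - {z}}"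


section \<open>The pencil generated by \<open>f\<close> and \<open>g\<close>\<close>

definition pencil_fibre ::
  "(complex^'n) set \<Rightarrow> (complex^'n \<Rightarrow> complex) \<Rightarrow> (complex^'n \<Rightarrow> complex) \<Rightarrow> cp1 \<Rightarrow> (complex^'n) set" where
  "pencil_fibre Z f g w = {x \<in> Z. \<exists>w1 w2. (w1, w2) \<noteq> (0, 0) \<and> w = hom_point w1 w2 \<and>
     w2 * f x - w1 * g x = 0}"

text \<open>\<open>H\<close> is the extension of \<open>(f : g) \<circ> \<rho>\<close> to a morphism on a neighbourhood of the exceptional
  divisor; only its germ along the exceptional divisor is determined.\<close>

definition pencil_extension ::
  "complex^'n \<Rightarrow> (complex^'n \<Rightarrow> complex) \<Rightarrow> (complex^'n \<Rightarrow> complex) \<Rightarrow>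
   'x csurface \<Rightarrow> ('x \<Rightarrow> complex^'n) \<Rightarrow> ('x \<Rightarrow> cp1) \<Rightarrow> bool" where
  "pencil_extension z f g X \<rho> H \<longleftrightarrow>
     (\<exists>N. exceptional_divisor z X \<rho> \<subseteq> N \<and> hol_to_cp1 X N H \<and>
        (\<forall>x\<in>N - exceptional_divisor z X \<rho>.
           (f (\<rho> x), g (\<rho> x)) \<noteq> (0, 0) \<and> H x = hom_point (f (\<rho> x)) (g (\<rho> x))))"

definition good_pencil_resolution ::
  "(complex^'n) set \<Rightarrow> complex^'n \<Rightarrow> (complex^'n \<Rightarrow> complex) \<Rightarrow> (complex^'n \<Rightarrow> complex) \<Rightarrow>
   'x csurface \<Rightarrow> ('x \<Rightarrow> complex^'n) \<Rightarrow> bool" where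
  "good_pencil_resolution Z z f g X \<rho> \<longleftrightarrow>
     good_resolution Z z X \<rho> \<and> (\<exists>H. pencil_extension z f g X \<rho> H)"

definition contraction :: "'x csurface \<Rightarrow> 'x set \<Rightarrow> 'x csurface \<Rightarrow> ('x \<Rightarrow> 'x) \<Rightarrow> bool" where
  "contraction X C Y c \<longleftrightarrow> hol_map X (topspace (Top X)) c Y \<and>
     (\<exists>q\<in>topspace (Top Y). c ` C = {q} \<and>
        bij_betw c (topspace (Top X) - C) (topspace (Top Y) - {q}) \<and>
        hol_map Y (topspace (Top Y) - {q}) (inv_into (topspace (Top X) - C) c) X)"

definition minimal_good_pencil_resolution ::
  "(complex^'n) set \<Rightarrow> complex^'n \<Rightarrow> (complex^'n \<Rightarrow> complex) \<Rightarrow> (complex^'n \<Rightarrow> complex) \<Rightarrow>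
   'x csurface \<Rightarrow> ('x \<Rightarrow> complex^'n) \<Rightarrow> bool" where
  "minimal_good_pencil_resolution Z z f g X \<rho> \<longleftrightarrow> good_pencil_resolution Z z f g X \<rho> \<and>
     (\<forall>C\<in>irreducible_components X (exceptional_divisor z X \<rho>).
        rational_curve X C \<and> self_intersection X C = -1 \<longrightarrow>
        \<not> (\<exists>(Y :: 'x csurface) \<rho>' c. contraction X C Y c \<and>
              (\<forall>x\<in>topspace (Top X). \<rho>' (c x) = \<rho> x) \<and>
              good_pencil_resolution Z z f g Y \<rho>'))"

definition dicritical_components :: "'x csurface \<Rightarrow> 'x set \<Rightarrow> ('x \<Rightarrow> cp1) \<Rightarrow> 'x set set" where
  "dicritical_components X E H = {C \<in> irreducible_components X E. \<not> H constant_on C}"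

definition nondicritical_part :: "'x csurface \<Rightarrow> 'x set \<Rightarrow> ('x \<Rightarrow> cp1) \<Rightarrow> 'x set" where
  "nondicritical_part X E H = Top X closure_of (E - \<Union>(dicritical_components X E H))"

definition critical_on_curve :: "'x csurface \<Rightarrow> 'x set \<Rightarrow> ('x \<Rightarrow> cp1) \<Rightarrow> 'x \<Rightarrow> bool" where
  "critical_on_curve X C H p \<longleftrightarrow> (\<exists>V \<phi>. adapted_chart X C V \<phi> \<and> p \<in> C \<inter> V \<and>
     (if H p = hom_point 1 0
      then deriv (\<lambda>t. affine_coord_inf (H (curve_param V \<phi> p t))) 0 = 0
      else deriv (\<lambda>t. affine_coord (H (curve_param V \<phi> p t))) 0 = 0))"

definition special_zones :: "'x csurface \<Rightarrow> 'x set \<Rightarrow> ('x \<Rightarrow> cp1) \<Rightarrow> 'x set set" where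
  "special_zones X E H =
     connected_components_of (subtopology (Top X) (nondicritical_part X E H)) \<union>
     {{p} |p C. C \<in> dicritical_components X E H \<and> critical_on_curve X C H p \<and>
        p \<notin> nondicritical_part X E H} \<union>
     {{p} |p C D. C \<in> dicritical_components X E H \<and> D \<in> dicritical_components X E H \<and>
        C \<noteq> D \<and> p \<in> C \<inter> D}"

definition special_values :: "'x csurface \<Rightarrow> 'x set \<Rightarrow> ('x \<Rightarrow> cp1) \<Rightarrow> cp1 set" where
  "special_values X E H = {w. \<exists>\<Delta>\<in>special_zones X E H. H ` \<Delta> = {w}}"

end

theory Submission
  imports Defs
begin

text \<open>The morphism \<open>H\<close> extending \<open>(f : g) \<circ> \<rho>\<close> is constant on every special zone. Near the exceptional
divisor \<open>E\<close>, but outside it, the fibre of \<open>H\<close> over \<open>e\<close> is the preimage of the fibre of the pencil. So a point of \<open>E\<close> is on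
the strict transform of that fibre iff it is a limit of points outside \<open>E\<close> at which \<open>H = e\<close>. By
continuity, a zone met by the strict transform has value \<open>e\<close>. The converse is the substance: a
special zone on which \<open>H = e\<close> is met by the closure of \<open>{x \<notin> E. H x = e}\<close>.

Everything rests on a maximum principle (\<open>surface_zero_with_larger_Re\<close>): on a level curve of a
holomorphic function of two variables, however singular, the real part of another holomorphic
function has no strict local maximum. In particular, such a level curve has no isolated points. It is
proved by pushing the function forward to a coordinate line: the sum of its values over the zeros
of \<open>t \<mapsto> F s t\<close>, counted with multiplicity, is holomorphic in \<open>s\<close> by the argument principle, and the
usual maximum principle applies to it.

Let \<open>p \<in> E\<close> be a point with \<open>H p = e\<close> which is not a limit of points outside \<open>E\<close> with \<open>H = e\<close>. The
fibre \<open>{H = e}\<close> has no isolated points, so near \<open>p\<close> it runs inside \<open>E\<close>, that is, along one of the at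
most two branches of \<open>E\<close> at \<open>p\<close>. By the identity theorem, \<open>H = e\<close> on an entire irreducible component
through \<open>p\<close> (\<open>stratum_in_fibre\<close>). Hence \<open>p\<close> lies on the non-dicritical part, and it is not an
intersection of two dicritical components, since at most two components pass through \<open>p\<close>. This
settles the zones that consist of one point.

Let the zone \<open>\<Delta>\<close> be a connected component of the non-dicritical part with \<open>H = e\<close>, and
suppose that the strict transform misses it. By the preceding paragraph, \<open>{H = e}\<close>
coincides with \<open>\<Delta>\<close> near \<open>\<Delta>\<close>. Since \<open>\<Delta>\<close> is compact, the fibres of \<open>H\<close> over values close to \<open>e\<close> have
compact nonempty parts near \<open>\<Delta>\<close>. Take a point \<open>x0\<close> of such a part at which the distance of \<open>\<rho> x\<close>
from \<open>z\<close> is maximal. If \<open>x0 \<notin> E\<close>, the maximum principle, applied to the linear form on \<open>\<complex>\<^sup>n\<close> that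
supports the ball around \<open>z\<close> at \<open>\<rho> x0\<close>, gives further points with the same image under \<open>\<rho>\<close>, although \<open>\<rho>\<close>
is injective outside \<open>E\<close>. If \<open>x0 \<in> E\<close>, the part lies in \<open>E\<close>, so \<open>x0\<close> belongs to
the non-dicritical part, hence to \<open>\<Delta>\<close>, where \<open>H\<close> has the other value \<open>e\<close>. The details are in
\<open>ND_component_meets_fibre_off\<close>.\<close>

section \<open>Parametrised integrals of holomorphic functions\<close>

text \<open>By Cauchy's formula, the derivative near \<open>t0\<close> is an integral of \<open>F s\<close> over a fixed circle around \<open>t0\<close>,
and the integrand depends continuously on all variables.\<close>

lemma continuous_on_deriv_param:
  fixes F :: "'a::t2_space \<Rightarrow> complex \<Rightarrow> complex"
  assumes cont: "continuous_on (S \<times> T) (\<lambda>(s, t). F s t)" and "open T"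
    and hol: "\<And>s. s \<in> S \<Longrightarrow> F s holomorphic_on T"
  shows "continuous_on (S \<times> T) (\<lambda>(s, t). deriv (F s) t)"
proof -
  have "continuous (at (s0, t0) within S \<times> T) (\<lambda>(s, t). deriv (F s) t)"
    if "s0 \<in> S" "t0 \<in> T" for s0 t0
  proof -
    obtain r where r: "r > 0" "cball t0 r \<subseteq> T"
      using \<open>open T\<close> \<open>t0 \<in> T\<close> open_contains_cball by blast
    define c where "c = circlepath t0 r"
    define K where "K = (\<lambda>(s, t) x. F s (c x) / (c x - t)\<^sup>2 * (2 * pi * \<i> * r * exp (2 * of_real pi * \<i> * x)))"
    have cx: "c x \<in> sphere t0 r" for x
      using r by (auto simp: c_def circlepath dist_norm norm_mult)
    have contc: "continuous_on UNIV c"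
      unfolding c_def circlepath by (intro continuous_intros)
    have "continuous_on ((S \<times> ball t0 r) \<times> cbox 0 1) (\<lambda>(p, x). K p x)"
    proof -
      have "continuous_on ((S \<times> ball t0 r) \<times> cbox 0 (1::real)) (\<lambda>q. F (fst (fst q)) (c (snd q)))"
      proof -
        have "continuous_on ((S \<times> ball t0 r) \<times> cbox 0 (1::real)) (\<lambda>q. (fst (fst q), c (snd q)))"
          by (intro continuous_intros continuous_on_compose2[OF contc]) auto
        moreover have "(\<lambda>q. (fst (fst q), c (snd q))) ` ((S \<times> ball t0 r) \<times> cbox 0 (1::real)) \<subseteq> S \<times> T"
        proof (rule image_subsetI)
          fix q assume "q \<in> (S \<times> ball t0 r) \<times> cbox 0 (1::real)"
          moreover have "c (snd q) \<in> T" using cx r(2) sphere_cball by (meson subsetD)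
          ultimately show "(fst (fst q), c (snd q)) \<in> S \<times> T" by auto
        qed
        ultimately have "continuous_on ((S \<times> ball t0 r) \<times> cbox 0 (1::real))
            (\<lambda>q. case (fst (fst q), c (snd q)) of (s, t) \<Rightarrow> F s t)"
          by (rule continuous_on_compose2[OF cont])
        then show ?thesis by simp
      qed
      moreover have "c x \<noteq> t" if "t \<in> ball t0 r" for x t
        using cx[of x] that by auto
      ultimately show ?thesis
        unfolding K_def case_prod_unfold
        by (intro continuous_intros continuous_on_compose2[OF contc]) auto
    qed
    then have "continuous_on (S \<times> ball t0 r) (\<lambda>p. integral (cbox 0 1) (K p))"
      by (rule integral_continuous_on_param)
    then have c1: "continuous_on (S \<times> ball t0 r) (\<lambda>p. integral (cbox 0 1) (K p) / (2 * pi * \<i>))"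
      by (intro continuous_intros) auto
    have eq: "integral (cbox 0 1) (K (s, t)) / (2 * pi * \<i>) = deriv (F s) t" if "s \<in> S" "t \<in> ball t0 r" for s t
    proof -
      have "continuous_on (cball t0 r) (F s)" "F s holomorphic_on ball t0 r"
        using hol[OF that(1)] r(2) holomorphic_on_subset holomorphic_on_imp_continuous_on
        by (metis continuous_on_subset, meson ball_subset_cball subset_trans)
      from Cauchy_contour_integral_circlepath_2[OF this that(2)]
      show ?thesis
        by (simp add: contour_integral_integral K_def c_def vector_derivative_circlepath mult_ac)
    qed
    have "continuous_on (S \<times> ball t0 r) (\<lambda>(s, t). deriv (F s) t)"
      by (rule continuous_on_eq[OF c1]) (use eq in \<open>simp add: split_paired_all\<close>)
    then have "continuous (at (s0, t0) within S \<times> ball t0 r) (\<lambda>(s, t). deriv (F s) t)"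
      using that r by (auto simp: continuous_on_eq_continuous_within)
    moreover have "at (s0, t0) within S \<times> T = at (s0, t0) within S \<times> ball t0 r"
      by (rule at_within_nhd[of _ "UNIV \<times> ball t0 r"]) (use r in \<open>auto simp: open_Times\<close>)
    ultimately show ?thesis by simp
  qed
  then show ?thesis by (auto simp: continuous_on_eq_continuous_within)
qed

text \<open>Differentiation under the integral sign; the joint continuity of the \<open>s\<close>-derivative that this calls
for is provided by the preceding lemma, with the roles of parameter and variable exchanged.\<close>

lemma holomorphic_on_integral_param:
  fixes K :: "complex \<Rightarrow> real \<Rightarrow> complex"
  assumes cont: "continuous_on (S \<times> {0..1}) (\<lambda>(s, x). K s x)" and "open S"
    and hol: "\<And>x. x \<in> {0..1} \<Longrightarrow> (\<lambda>s. K s x) holomorphic_on S"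
  shows "(\<lambda>s. integral {0..1} (K s)) holomorphic_on S"
proof -
  have "continuous_on ({0..1} \<times> S) (\<lambda>(x, s). K s x)"
    using continuous_on_swap_args[OF cont] by simp
  then have "continuous_on ({0..1} \<times> S) (\<lambda>(x, s). deriv (\<lambda>s. K s x) s)"
    by (rule continuous_on_deriv_param) (use assms in auto)
  then have cd: "continuous_on (S \<times> {0..1}) (\<lambda>(s, x). deriv (\<lambda>s. K s x) s)"
    using continuous_on_swap_args by blast
  have "(\<lambda>s. integral {0..1} (K s)) holomorphic_on ball s0 r" if "ball s0 r \<subseteq> S" for s0 r
  proof -
    have "(\<lambda>s. integral (cbox 0 1) (K s)) holomorphic_on ball s0 r"
    proof (rule leibniz_rule_holomorphic)
      show "((\<lambda>s. K s x) has_field_derivative deriv (\<lambda>s. K s x) s) (at s within ball s0 r)"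
        if "s \<in> ball s0 r" "x \<in> cbox 0 1" for s x
        by (rule has_field_derivative_at_within, rule holomorphic_derivI[OF hol \<open>open S\<close>])
          (use that \<open>ball s0 r \<subseteq> S\<close> in \<open>simp_all add: subset_iff\<close>)
      show "continuous_on (ball s0 r \<times> cbox 0 1) (\<lambda>(s, x). deriv (\<lambda>s. K s x) s)"
        by (rule continuous_on_subset[OF cd]) (use that in auto)
      show "K s integrable_on cbox 0 1" if "s \<in> ball s0 r" for s
      proof (rule integrable_continuous)
        have "s \<in> S" using that \<open>ball s0 r \<subseteq> S\<close> by blast
        then show "continuous_on (cbox 0 1) (K s)"
          using continuous_on_compose2[OF cont, of "cbox 0 1" "Pair s"]
          by (simp add: continuous_on_Pair image_subset_iff)
      qed
    qed simp
    then show ?thesis by simp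
  qed
  then show ?thesis
    using \<open>open S\<close> by (metis analytic_on_def analytic_imp_holomorphic openE)
qed

section \<open>A maximum principle on plane analytic curves\<close>

text \<open>As \<open>s\<close> moves, the zeros of \<open>F s\<close> may collide and need not be functions of \<open>s\<close>. Their weighted sum is
still holomorphic, since by the argument principle it is the integral of \<open>H s * deriv (F s) / F s\<close>
over the circle of radius \<open>\<rho>\<close>, divided by \<open>2 * pi * \<i>\<close>.\<close>

lemma weighted_zero_sum_holomorphic:
  fixes F H :: "complex \<Rightarrow> complex \<Rightarrow> complex"
  assumes \<rho>: "0 < \<rho>" "\<rho> < r"
    and contF: "continuous_on (S \<times> ball 0 r) (\<lambda>(s, t). F s t)"
    and contH: "continuous_on (S \<times> ball 0 r) (\<lambda>(s, t). H s t)"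
    and "open S"
    and holF1: "\<And>t. t \<in> ball 0 r \<Longrightarrow> (\<lambda>s. F s t) holomorphic_on S"
    and holF2: "\<And>s. s \<in> S \<Longrightarrow> F s holomorphic_on ball 0 r"
    and holH1: "\<And>t. t \<in> ball 0 r \<Longrightarrow> (\<lambda>s. H s t) holomorphic_on S"
    and holH2: "\<And>s. s \<in> S \<Longrightarrow> H s holomorphic_on ball 0 r"
    and nz: "\<And>s t. s \<in> S \<Longrightarrow> cmod t = \<rho> \<Longrightarrow> F s t \<noteq> 0"
  shows "(\<lambda>s. \<Sum>t | t \<in> ball 0 \<rho> \<and> F s t = 0. H s t * zorder (F s) t) holomorphic_on S"
proof -
  define c where "c = circlepath 0 \<rho>"
  have cx: "cmod (c x) = \<rho>" for x
    using \<rho> by (simp add: c_def circlepath norm_mult)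
  have contc: "continuous_on UNIV c"
    unfolding c_def circlepath by (intro continuous_intros)
  define K where "K = (\<lambda>s x. H s (c x) * deriv (F s) (c x) / F s (c x) * exp (2 * of_real pi * \<i> * x) * \<rho>)"
  have der1: "(\<lambda>s. deriv (F s) t) holomorphic_on S" if t: "cmod t = \<rho>" for t
  proof -
    obtain \<rho>' where \<rho>': "\<rho> < \<rho>'" "\<rho>' < r" using \<rho> dense by blast
    define d where "d = circlepath 0 \<rho>'"
    have dx: "cmod (d x) = \<rho>'" for x
      using \<rho>' \<rho> by (simp add: d_def circlepath norm_mult)
    have contd: "continuous_on UNIV d"
      unfolding d_def circlepath by (intro continuous_intros)
    have dt: "d x \<noteq> t" for x using dx[of x] t \<rho>' by auto
    define L where "L = (\<lambda>s x. F s (d x) / (d x - t)\<^sup>2 * exp (2 * of_real pi * \<i> * x) * \<rho>')"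
    have "continuous_on (S \<times> {0..1}) (\<lambda>p. (fst p, d (snd p)))"
      by (intro continuous_intros continuous_on_compose2[OF contd]) auto
    moreover have "(\<lambda>p. (fst p, d (snd p))) ` (S \<times> {0..1}) \<subseteq> S \<times> ball 0 r"
      using dx \<rho>' by auto
    ultimately have "continuous_on (S \<times> {0..1}) (\<lambda>p. case (fst p, d (snd p)) of (s, t) \<Rightarrow> F s t)"
      by (rule continuous_on_compose2[OF contF])
    then have "continuous_on (S \<times> {0..1}) (\<lambda>(s, x). L s x)"
      unfolding L_def case_prod_unfold using dt
      by (intro continuous_intros continuous_on_compose2[OF contd]) simp_all
    then have "(\<lambda>s. integral {0..1} (L s)) holomorphic_on S"
      using \<open>open S\<close>
    proof (rule holomorphic_on_integral_param)
      show "(\<lambda>s. L s x) holomorphic_on S" for x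
        unfolding L_def using dt dx \<rho>' by (intro holomorphic_intros holF1) auto
    qed
    moreover have "integral {0..1} (L s) = deriv (F s) t" if "s \<in> S" for s
    proof -
      have sub: "cball 0 \<rho>' \<subseteq> ball 0 r" "ball 0 \<rho>' \<subseteq> ball (0::complex) r" using \<rho>' by auto
      have "continuous_on (cball 0 \<rho>') (F s)"
        using holF2[OF that] sub(1) holomorphic_on_imp_continuous_on continuous_on_subset by blast
      moreover have "F s holomorphic_on ball 0 \<rho>'"
        using holF2[OF that] sub(2) holomorphic_on_subset by blast
      moreover have "t \<in> ball 0 \<rho>'" using t \<rho>' by simp
      ultimately have "contour_integral (circlepath 0 \<rho>') (\<lambda>u. F s u / (u - t)\<^sup>2) = 2 * pi * \<i> * deriv (F s) t"
        by (rule Cauchy_contour_integral_circlepath_2)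
      moreover have "contour_integral (circlepath 0 \<rho>') (\<lambda>u. F s u / (u - t)\<^sup>2) = integral {0..1} (\<lambda>x. (2 * pi * \<i>) * L s x)"
        by (simp add: contour_integral_integral L_def d_def vector_derivative_circlepath mult_ac)
      ultimately show ?thesis by (simp only: integral_mult_right) simp
    qed
    ultimately show ?thesis
      using holomorphic_transform by (metis (no_types, lifting))
  qed
  have hc: "continuous_on (S \<times> {0..1}) (\<lambda>p. (fst p, c (snd p)))"
    by (intro continuous_intros continuous_on_compose2[OF contc]) auto
  have ic: "(\<lambda>p. (fst p, c (snd p))) ` (S \<times> {0..1}) \<subseteq> S \<times> ball 0 r"
    using cx \<rho> by auto
  have "continuous_on (S \<times> {0..1}) (\<lambda>(s, x). K s x)"
    unfolding K_def case_prod_unfold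
    using continuous_on_compose2[OF contF hc ic] continuous_on_compose2[OF contH hc ic]
      continuous_on_compose2[OF continuous_on_deriv_param[OF contF open_ball holF2] hc ic]
    by (intro continuous_intros) (simp_all add: case_prod_unfold nz cx mem_Times_iff)
  then have "(\<lambda>s. integral {0..1} (K s)) holomorphic_on S"
    using \<open>open S\<close>
  proof (rule holomorphic_on_integral_param)
    show "(\<lambda>s. K s x) holomorphic_on S" for x
      unfolding K_def using cx \<rho> nz by (intro holomorphic_intros holF1 holH1 der1) auto
  qed
  moreover have "integral {0..1} (K s) = (\<Sum>t | t \<in> ball 0 \<rho> \<and> F s t = 0. H s t * zorder (F s) t)"
    if s: "s \<in> S" for s
  proof -
    (* the zeros of F s in the whole ball of radius r may accumulate at its boundary *)
    obtain \<rho>' where \<rho>': "\<rho> < \<rho>'" "\<rho>' < r" using \<rho> dense by blast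
    have nc: "\<not> F s constant_on ball 0 r \<or> (\<forall>t\<in>ball 0 r. F s t \<noteq> 0)"
      using nz[OF s, of "of_real \<rho>"] \<rho> unfolding constant_on_def by force
    have fin: "finite {t \<in> cball 0 \<rho>'. F s t = 0}"
    proof (cases "F s constant_on ball 0 r")
      case True
      then have "{t \<in> cball 0 \<rho>'. F s t = 0} = {}"
        using nc \<rho>' by auto
      then show ?thesis by (simp only: finite.emptyI)
    next
      case False
      show ?thesis
        by (rule holomorphic_compact_finite_zeros[OF holF2[OF s]]) (use \<rho>' False in auto)
    qed
    define P where "P = {w\<in>ball 0 \<rho>'. F s w = 0 \<or> w \<in> {}}"
    have "finite P" unfolding P_def by (rule finite_subset[OF _ fin]) auto
    have "contour_integral c (\<lambda>x. deriv (F s) x * H s x / F s x)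
        = 2 * pi * \<i> * (\<Sum>p\<in>P. winding_number c p * H s p * zorder (F s) p)"
      unfolding P_def
    proof (rule argument_principle)
      show "F s holomorphic_on ball 0 \<rho>' - {}" "H s holomorphic_on ball 0 \<rho>'"
        using holF2[OF s] holH2[OF s] \<rho>' by (auto elim: holomorphic_on_subset)
      show "path_image c \<subseteq> ball 0 \<rho>' - {w \<in> ball 0 \<rho>'. F s w = 0 \<or> w \<in> {}}"
        using \<rho> \<rho>' nz[OF s] by (auto simp: c_def)
      show "\<forall>z. z \<notin> ball 0 \<rho>' \<longrightarrow> winding_number c z = 0"
        unfolding c_def using \<rho> \<rho>'
        by (intro allI impI winding_number_zero_outside[of _ "ball 0 \<rho>'"]) auto
      show "finite {w \<in> ball 0 \<rho>'. F s w = 0 \<or> w \<in> {}}"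
        using \<open>finite P\<close> P_def by simp
    qed (auto simp: c_def)
    also have "(\<Sum>p\<in>P. winding_number c p * H s p * zorder (F s) p) =
        (\<Sum>t | t \<in> ball 0 \<rho> \<and> F s t = 0. H s t * zorder (F s) t)"
    proof (rule sum.mono_neutral_cong_right[OF \<open>finite P\<close>])
      show "{t. t \<in> ball 0 \<rho> \<and> F s t = 0} \<subseteq> P" using \<rho>' by (auto simp: P_def)
      show "\<forall>p\<in>P - {t. t \<in> ball 0 \<rho> \<and> F s t = 0}. winding_number c p * H s p * zorder (F s) p = 0"
      proof
        fix p assume p: "p \<in> P - {t. t \<in> ball 0 \<rho> \<and> F s t = 0}"
        then have "p \<notin> cball 0 \<rho>" using nz[OF s, of p] by (auto simp: P_def order.order_iff_strict)
        then have "winding_number c p = 0"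
          unfolding c_def using \<rho>
          by (intro winding_number_zero_outside[of _ "cball 0 \<rho>"]) auto
        then show "winding_number c p * H s p * zorder (F s) p = 0" by simp
      qed
      show "winding_number c p * H s p * zorder (F s) p = H s p * zorder (F s) p"
        if "p \<in> {t. t \<in> ball 0 \<rho> \<and> F s t = 0}" for p
        using that winding_number_circlepath[of p 0 \<rho>] by (simp add: c_def)
    qed
    finally have *: "contour_integral c (\<lambda>x. deriv (F s) x * H s x / F s x) =
        2 * pi * \<i> * (\<Sum>t | t \<in> ball 0 \<rho> \<and> F s t = 0. H s t * zorder (F s) t)" .
    have "contour_integral c (\<lambda>x. deriv (F s) x * H s x / F s x) = integral {0..1} (\<lambda>x. (2 * pi * \<i>) * K s x)"
      by (simp add: contour_integral_integral K_def c_def vector_derivative_circlepath mult_ac)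
    with * show ?thesis by (simp only: integral_mult_right) simp
  qed
  ultimately show ?thesis
    using holomorphic_transform by (metis (no_types, lifting))
qed

lemma Re_le_at_centre:
  fixes g :: "complex \<Rightarrow> complex"
  assumes "g holomorphic_on ball 0 R" "0 < r" "r < R"
    and "\<And>t. cmod t = r \<Longrightarrow> Re (g t) \<le> B"
  shows "Re (g 0) \<le> B"
proof (rule maximum_real_frontier[of g "cball 0 r"])
  show "g holomorphic_on interior (cball 0 r)"
    using assms by (intro holomorphic_on_subset[OF assms(1)]) auto
  show "continuous_on (closure (cball 0 r)) g"
    using assms
    by (intro continuous_on_subset[OF holomorphic_on_imp_continuous_on[OF assms(1)]]) auto
qed (use assms in \<open>auto simp: frontier_cball\<close>)

text \<open>The second alternative is phrased with a closed disc, so that its boundary circle can be used as a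
contour.\<close>

lemma holomorphic_zero_dichotomy:
  fixes g :: "complex \<Rightarrow> complex"
  assumes "g holomorphic_on ball 0 r" "0 < r"
  shows "(\<forall>t\<in>ball 0 r. g t = 0) \<or> (\<exists>\<epsilon>>0. \<epsilon> < r \<and> (\<forall>t. 0 < cmod t \<and> cmod t \<le> \<epsilon> \<longrightarrow> g t \<noteq> 0))"
proof (rule disjCI)
  assume neg: "\<not> (\<exists>\<epsilon>>0. \<epsilon> < r \<and> (\<forall>t. 0 < cmod t \<and> cmod t \<le> \<epsilon> \<longrightarrow> g t \<noteq> 0))"
  show "\<forall>t\<in>ball 0 r. g t = 0"
  proof (rule ccontr)
    assume "\<not> (\<forall>t\<in>ball 0 r. g t = 0)"
    then obtain \<beta> where "\<beta> \<in> ball 0 r" "g \<beta> \<noteq> 0" by blast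
    then have "\<forall>\<^sub>F w in at 0. g w \<noteq> 0 \<and> w \<in> ball 0 r"
      using assms by (intro non_zero_neighbour_alt) auto
    then obtain d where d: "d > 0" "\<And>w. w \<noteq> 0 \<Longrightarrow> cmod w < d \<Longrightarrow> g w \<noteq> 0"
      unfolding eventually_at by (auto simp: dist_norm)
    have "min (d / 2) (r / 2) > 0" "min (d / 2) (r / 2) < r" using d assms by auto
    moreover have "g t \<noteq> 0" if "0 < cmod t" "cmod t \<le> min (d / 2) (r / 2)" for t
      using d(2)[of t] that d(1) by auto
    ultimately show False using neg by blast
  qed
qed

text \<open>The real part of \<open>G\<close> has no strict local maximum at \<open>(0, 0)\<close> on the analytic curve \<open>F = 0\<close>. If the
curve contains the line \<open>s = 0\<close>, this is the maximum principle on that line. Otherwise, suppose that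
the maximum is strict. Then \<open>Re G\<close> drops by some \<open>\<eta> > 0\<close> on the part of the curve over a circle
\<open>cmod s = \<delta> / 2\<close>, so the sum of \<open>G - G 0 0 + \<eta>\<close> over the zeros of \<open>F s\<close> has real part at most \<open>0\<close> for \<open>s\<close>
on that circle. But its value at the centre is a positive multiple of \<open>\<eta>\<close>. For constant \<open>G\<close> the lemma
says that \<open>(0, 0)\<close> is not isolated on the curve.\<close>

lemma exists_zero_with_larger_Re:
  fixes F G :: "complex \<Rightarrow> complex \<Rightarrow> complex"
  assumes r: "0 < r"
    and contF: "continuous_on (ball 0 r \<times> ball 0 r) (\<lambda>(s, t). F s t)"
    and contG: "continuous_on (ball 0 r \<times> ball 0 r) (\<lambda>(s, t). G s t)"
    and holF1: "\<And>t. t \<in> ball 0 r \<Longrightarrow> (\<lambda>s. F s t) holomorphic_on ball 0 r"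
    and holF2: "\<And>s. s \<in> ball 0 r \<Longrightarrow> F s holomorphic_on ball 0 r"
    and holG1: "\<And>t. t \<in> ball 0 r \<Longrightarrow> (\<lambda>s. G s t) holomorphic_on ball 0 r"
    and holG2: "\<And>s. s \<in> ball 0 r \<Longrightarrow> G s holomorphic_on ball 0 r"
    and zero: "F 0 0 = 0"
  shows "\<exists>s\<in>ball 0 r. \<exists>t\<in>ball 0 r. (s, t) \<noteq> (0, 0) \<and> F s t = 0 \<and> Re (G 0 0) \<le> Re (G s t)"
proof (rule ccontr)
  assume neg: "\<not> ?thesis"
  have strict: "Re (G s t) < Re (G 0 0)"
    if "s \<in> ball 0 r" "t \<in> ball 0 r" "(s, t) \<noteq> (0, 0)" "F s t = 0" for s t
    using neg that by force
  have F0: "F 0 holomorphic_on ball 0 r" using holF2 r by simp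
  from holomorphic_zero_dichotomy[OF F0 r] show False
  proof
    assume F00: "\<forall>t\<in>ball 0 r. F 0 t = 0"
    define S where "S = sphere (0::complex) (r / 2)"
    have S: "compact S" "S \<noteq> {}" "S \<subseteq> ball 0 r"
      using r by (auto simp: S_def)
    have "continuous_on S (\<lambda>t. Re (G 0 t))"
      by (intro continuous_intros holomorphic_on_imp_continuous_on holomorphic_on_subset[OF holG2 S(3)])
        (simp add: r)
    from continuous_attains_sup[OF S(1,2) this]
    obtain t0 where t0: "t0 \<in> S" "\<And>t. t \<in> S \<Longrightarrow> Re (G 0 t) \<le> Re (G 0 t0)" by blast
    have "Re (G 0 0) \<le> Re (G 0 t0)"
    proof (rule Re_le_at_centre[of "G 0" r "r / 2"])
      show "G 0 holomorphic_on ball 0 r" using holG2 r by simp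
    qed (use r t0 in \<open>auto simp: S_def\<close>)
    moreover have "t0 \<in> ball 0 r" "t0 \<noteq> 0" using t0(1) r by (auto simp: S_def)
    ultimately show False using strict[of 0 t0] F00 r by force
  next
    assume "\<exists>\<epsilon>>0. \<epsilon> < r \<and> (\<forall>t. 0 < cmod t \<and> cmod t \<le> \<epsilon> \<longrightarrow> F 0 t \<noteq> 0)"
    then obtain \<rho> where \<rho>: "0 < \<rho>" "\<rho> < r" "\<And>t. 0 < cmod t \<Longrightarrow> cmod t \<le> \<rho> \<Longrightarrow> F 0 t \<noteq> 0"
      by blast
    have "\<exists>\<delta>>0. \<delta> \<le> r \<and> (\<forall>s t. cmod s < \<delta> \<longrightarrow> cmod t = \<rho> \<longrightarrow> F s t \<noteq> 0)"
    proof -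
      define W where "W = (ball 0 r \<times> ball 0 r) \<inter> (\<lambda>(s, t). F s t) -` (- {0})"
      have "open W"
        unfolding W_def by (rule continuous_open_preimage[OF contF]) (auto intro: open_Times)
      have "{0} \<times> sphere 0 \<rho> \<subseteq> W"
        using \<rho> r by (auto simp: W_def)
      from Elementary_Topology.tube_lemma[OF compact_sphere \<open>open W\<close> this]
      obtain X0 where X0: "open X0" "0 \<in> X0" "X0 \<times> sphere 0 \<rho> \<subseteq> W" by blast
      then obtain d where d: "d > 0" "ball 0 d \<subseteq> X0" using openE by blast
      have "F s t \<noteq> 0" if "cmod s < min d r" "cmod t = \<rho>" for s t
      proof -
        have "s \<in> X0" using that d(2) by (simp add: subset_iff)
        then have "(s, t) \<in> W" using X0(3) that(2) by (simp add: subset_iff)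
        then show ?thesis by (simp add: W_def)
      qed
      then show ?thesis using d r by (intro exI[of _ "min d r"]) auto
    qed
    then obtain \<delta> where \<delta>: "0 < \<delta>" "\<delta> \<le> r" "\<And>s t. cmod s < \<delta> \<Longrightarrow> cmod t = \<rho> \<Longrightarrow> F s t \<noteq> 0"
      by blast
    have sub: "ball 0 \<delta> \<subseteq> ball (0::complex) r" using \<delta> by auto
    define C where "C = sphere (0::complex) (\<delta> / 2) \<times> cball (0::complex) \<rho>"
    define Y where "Y = {p \<in> C. F (fst p) (snd p) = 0}"
    have Csub: "C \<subseteq> ball 0 r \<times> ball 0 r" using \<delta> \<rho> by (auto simp: C_def)
    have "compact C" unfolding C_def by (intro compact_Times compact_sphere compact_cball)
    moreover have "closed Y"
    proof -
      have "continuous_on C (\<lambda>p. F (fst p) (snd p))"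
        using continuous_on_subset[OF contF Csub] by (simp add: case_prod_unfold)
      from continuous_closed_preimage[OF this compact_imp_closed[OF \<open>compact C\<close>], of "{0}"]
      show ?thesis by (simp add: Y_def vimage_def Int_def)
    qed
    ultimately have "compact (C \<inter> Y)" by (rule compact_Int_closed)
    moreover have "C \<inter> Y = Y" by (auto simp: Y_def)
    ultimately have "compact Y" by simp
    have "\<exists>\<eta>>0. \<forall>p\<in>Y. Re (G (fst p) (snd p)) \<le> Re (G 0 0) - \<eta>"
    proof (cases "Y = {}")
      case True
      then show ?thesis by (auto intro: exI[of _ 1])
    next
      case False
      have "continuous_on Y (\<lambda>p. G (fst p) (snd p))"
      proof -
        have "Y \<subseteq> ball 0 r \<times> ball 0 r" using Csub unfolding Y_def by blast
        from continuous_on_subset[OF contG this] show ?thesis by (simp add: case_prod_unfold)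
      qed
      then have "continuous_on Y (\<lambda>p. Re (G (fst p) (snd p)))"
        by (intro continuous_intros)
      from continuous_attains_sup[OF \<open>compact Y\<close> False this]
      obtain q where q: "q \<in> Y" "\<And>p. p \<in> Y \<Longrightarrow> Re (G (fst p) (snd p)) \<le> Re (G (fst q) (snd q))"
        by blast
      have "Re (G (fst q) (snd q)) < Re (G 0 0)"
      proof (rule strict)
        show "(fst q, snd q) \<noteq> (0, 0)" using q(1) \<delta> by (auto simp: Y_def C_def)
      qed (use q(1) Csub in \<open>auto simp: Y_def\<close>)
      then show ?thesis using q(2)
        by (intro exI[of _ "Re (G 0 0) - Re (G (fst q) (snd q))"]) auto
    qed
    then obtain \<eta> where \<eta>: "\<eta> > 0" "\<And>p. p \<in> Y \<Longrightarrow> Re (G (fst p) (snd p)) \<le> Re (G 0 0) - \<eta>"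
      by blast
    (* the shift by eta makes the weight nonpositive over the circle and positive at the centre *)
    define H where "H = (\<lambda>s t. G s t - G 0 0 + \<eta>)"
    define B where "B = (\<lambda>s. \<Sum>t | t \<in> ball 0 \<rho> \<and> F s t = 0. H s t * zorder (F s) t)"
    have holB: "B holomorphic_on ball 0 \<delta>"
      unfolding B_def
    proof (rule weighted_zero_sum_holomorphic[OF \<rho>(1,2)])
      have sub2: "ball 0 \<delta> \<times> ball 0 r \<subseteq> ball (0::complex) r \<times> ball (0::complex) r" using sub by blast
      show "continuous_on (ball 0 \<delta> \<times> ball 0 r) (\<lambda>(s, t). F s t)"
        by (rule continuous_on_subset[OF contF sub2])
      show "continuous_on (ball 0 \<delta> \<times> ball 0 r) (\<lambda>(s, t). H s t)"
        using continuous_on_subset[OF contG sub2]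
        unfolding H_def case_prod_unfold by (intro continuous_intros)
      show "(\<lambda>s. F s t) holomorphic_on ball 0 \<delta>" if "t \<in> ball 0 r" for t
        using holF1[OF that] sub by (rule holomorphic_on_subset)
      show "(\<lambda>s. H s t) holomorphic_on ball 0 \<delta>" if "t \<in> ball 0 r" for t
        unfolding H_def by (intro holomorphic_intros holomorphic_on_subset[OF holG1[OF that] sub])
      show "F s holomorphic_on ball 0 r" "H s holomorphic_on ball 0 r" if "s \<in> ball 0 \<delta>" for s
        using that sub unfolding H_def by (auto intro!: holomorphic_intros holF2 holG2)
    qed (use \<delta>(3) in auto)
    have ord: "zorder (F s) t > 0" if "cmod s < \<delta>" "t \<in> ball 0 \<rho>" "F s t = 0" for s t
    proof -
      have "of_real \<rho> \<in> ball (0::complex) r" "F s (of_real \<rho>) \<noteq> 0"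
        using \<rho> \<delta>(3)[OF that(1)] by auto
      then have "\<exists>w\<in>ball 0 r. F s w \<noteq> 0" by blast
      moreover have "F s holomorphic_on ball 0 r" "t \<in> ball 0 r"
        using holF2 that \<delta> \<rho> by auto
      ultimately show ?thesis
        using zorder_exist_zero[of "F s" "ball 0 r" t] that(3) by simp
    qed
    have "Re (B 0) \<le> 0"
    proof (rule Re_le_at_centre[OF holB, of "\<delta> / 2"])
      fix s :: complex assume s: "cmod s = \<delta> / 2"
      show "Re (B s) \<le> 0"
        unfolding B_def Re_sum
      proof (rule sum_nonpos)
        fix t assume t: "t \<in> {t. t \<in> ball 0 \<rho> \<and> F s t = 0}"
        then have "(s, t) \<in> Y" using s by (auto simp: Y_def C_def)
        then have "Re (H s t) \<le> 0" using \<eta>(2)[of "(s, t)"] by (simp add: H_def)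
        moreover have "zorder (F s) t > 0" using ord[of s t] t s \<delta> by auto
        ultimately show "Re (H s t * of_int (zorder (F s) t)) \<le> 0"
          by (simp add: mult_nonpos_nonneg)
      qed
    qed (use \<delta> in auto)
    moreover have "B 0 = \<eta> * zorder (F 0) 0"
    proof -
      have "t = 0" if "t \<in> ball 0 \<rho>" "F 0 t = 0" for t
        using \<rho>(3)[of t] that by force
      then have "{t. t \<in> ball 0 \<rho> \<and> F 0 t = 0} = {0}"
        using zero \<rho> by auto
      then show ?thesis by (simp add: B_def H_def)
    qed
    moreover have "zorder (F 0) 0 > 0" using ord[of 0 0] \<delta> \<rho> zero by simp
    ultimately show False using \<eta> by (simp add: mult_le_0_iff)
  qed
qed

section \<open>Holomorphic functions of several variables\<close>

text \<open>The pointwise form of \<^const>\<open>cholomorphic_on\<close>, which suits closure properties better.\<close>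

definition cdiff_at :: "(complex^'m \<Rightarrow> complex) \<Rightarrow> complex^'m \<Rightarrow> bool" where
  "cdiff_at F x \<longleftrightarrow> (\<exists>D. (F has_derivative D) (at x) \<and> (\<forall>c v. D (c *s v) = c * D v))"

lemma cholomorphic_on_iff: "cholomorphic_on F S \<longleftrightarrow> open S \<and> (\<forall>x\<in>S. cdiff_at F x)"
  by (auto simp: cholomorphic_on_def cdiff_at_def)

lemma cdiff_at_const [simp]: "cdiff_at (\<lambda>x. c) x"
  unfolding cdiff_at_def by (rule exI[of _ "\<lambda>_. 0"]) (auto intro: derivative_eq_intros)

lemma cdiff_at_component [simp]: "cdiff_at (\<lambda>x. x $ i) x"
  unfolding cdiff_at_def
  by (rule exI[of _ "\<lambda>v. v $ i"]) (auto intro: bounded_linear_imp_has_derivative bounded_linear_vec_nth)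

lemma cdiff_at_add: "cdiff_at F x \<Longrightarrow> cdiff_at G x \<Longrightarrow> cdiff_at (\<lambda>x. F x + G x) x"
  unfolding cdiff_at_def
proof safe
  fix D D' assume "(F has_derivative D) (at x)" "(G has_derivative D') (at x)"
    "\<forall>c v. D (c *s v) = c * D v" "\<forall>c v. D' (c *s v) = c * D' v"
  then show "\<exists>D. ((\<lambda>x. F x + G x) has_derivative D) (at x) \<and> (\<forall>c v. D (c *s v) = c * D v)"
    by (intro exI[of _ "\<lambda>h. D h + D' h"]) (auto intro!: derivative_eq_intros simp: algebra_simps)
qed

lemma cdiff_at_mult: "cdiff_at F x \<Longrightarrow> cdiff_at G x \<Longrightarrow> cdiff_at (\<lambda>x. F x * G x) x"
  unfolding cdiff_at_def
proof safe
  fix D D' assume "(F has_derivative D) (at x)" "(G has_derivative D') (at x)"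
    "\<forall>c v. D (c *s v) = c * D v" "\<forall>c v. D' (c *s v) = c * D' v"
  then show "\<exists>D. ((\<lambda>x. F x * G x) has_derivative D) (at x) \<and> (\<forall>c v. D (c *s v) = c * D v)"
    by (intro exI[of _ "\<lambda>h. F x * D' h + D h * G x"]) (auto intro!: derivative_eq_intros simp: algebra_simps)
qed

lemma cdiff_at_inverse: "cdiff_at F x \<Longrightarrow> F x \<noteq> 0 \<Longrightarrow> cdiff_at (\<lambda>x. inverse (F x)) x"
  unfolding cdiff_at_def
proof safe
  fix D assume "(F has_derivative D) (at x)" "\<forall>c v. D (c *s v) = c * D v" "F x \<noteq> 0"
  then show "\<exists>D. ((\<lambda>x. inverse (F x)) has_derivative D) (at x) \<and> (\<forall>c v. D (c *s v) = c * D v)"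
    by (intro exI[of _ "\<lambda>h. - (inverse (F x) * D h * inverse (F x))"])
      (auto intro!: derivative_eq_intros simp: algebra_simps)
qed

lemma cdiff_at_transform:
  assumes "cdiff_at F x" "open S" "x \<in> S" "\<And>y. y \<in> S \<Longrightarrow> F y = G y"
  shows "cdiff_at G x"
  using assms has_derivative_transform_within_open[of F _ x UNIV S G]
  unfolding cdiff_at_def by blast

lemma bounded_linear_axis: "bounded_linear (axis i :: complex \<Rightarrow> complex^'m)"
proof -
  have "linear (axis i :: complex \<Rightarrow> complex^'m)"
    by (rule linearI) (simp_all add: vec_eq_iff axis_def)
  then show ?thesis by (simp add: linear_conv_bounded_linear)
qed

lemma cdiff_at_compose:
  fixes \<psi> :: "complex^'m \<Rightarrow> complex^'k"
  assumes F: "cdiff_at F (\<psi> x)" and \<psi>: "\<And>i. cdiff_at (\<lambda>y. \<psi> y $ i) x"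
  shows "cdiff_at (\<lambda>y. F (\<psi> y)) x"
proof -
  obtain D where D: "(F has_derivative D) (at (\<psi> x))" "\<And>c v. D (c *s v) = c * D v"
    using F unfolding cdiff_at_def by blast
  from \<psi> have "\<forall>i. \<exists>D. ((\<lambda>y. \<psi> y $ i) has_derivative D) (at x) \<and> (\<forall>c v. D (c *s v) = c * D v)"
    unfolding cdiff_at_def by blast
  then obtain L where L: "\<And>i. ((\<lambda>y. \<psi> y $ i) has_derivative L i) (at x)" "\<And>i c v. L i (c *s v) = c * L i v"
    by metis
  have "((\<lambda>y. axis i (\<psi> y $ i) :: complex^'k) has_derivative (\<lambda>h. axis i (L i h))) (at x)" for i
    by (rule bounded_linear.has_derivative[OF bounded_linear_axis L(1)])
  then have "((\<lambda>y. \<Sum>i\<in>UNIV. axis i (\<psi> y $ i)) has_derivative (\<lambda>h. \<Sum>i\<in>UNIV. axis i (L i h))) (at x)"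
    by (rule has_derivative_sum)
  moreover have e: "(\<Sum>i\<in>UNIV. axis i (f i)) = (\<chi> i. f i)" for f :: "'k \<Rightarrow> complex"
    by (simp add: vec_eq_iff sum_component) (simp add: axis_def)
  ultimately have "(\<psi> has_derivative (\<lambda>h. \<chi> i. L i h)) (at x)" by simp
  from has_derivative_compose[OF this D(1)]
  have "((\<lambda>y. F (\<psi> y)) has_derivative (\<lambda>h. D (\<chi> i. L i h))) (at x)" .
  moreover have "D (\<chi> i. L i (c *s v)) = c * D (\<chi> i. L i v)" for c v
  proof -
    have "(\<chi> i. L i (c *s v)) = c *s (\<chi> i. L i v)" by (simp add: vec_eq_iff L)
    then show ?thesis by (simp add: D)
  qed
  ultimately show ?thesis unfolding cdiff_at_def by blast
qed

lemma cdiff_at_axis: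
  assumes "cdiff_at F (p + axis i t)"
  shows "(\<lambda>t. F (p + axis i t)) field_differentiable (at t)"
proof -
  obtain D where D: "(F has_derivative D) (at (p + axis i t))" "\<And>c v. D (c *s v) = c * D v"
    using assms unfolding cdiff_at_def by blast
  have "((\<lambda>t. p + axis i t) has_derivative (\<lambda>h. 0 + axis i h)) (at t)"
    by (rule has_derivative_add[OF has_derivative_const bounded_linear_imp_has_derivative[OF bounded_linear_axis]])
  then have "((\<lambda>t. p + axis i t) has_derivative (\<lambda>h. axis i h)) (at t)" by simp
  from has_derivative_compose[OF this D(1)]
  have "((\<lambda>t. F (p + axis i t)) has_derivative (\<lambda>h. D (axis i h))) (at t)" .
  moreover have "(\<lambda>h. D (axis i h)) = (*) (D (axis i 1))"
  proof
    fix h :: complex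
    have "axis i h = h *s axis i 1" by (simp add: vec_eq_iff axis_def)
    then have "D (axis i h) = h * D (axis i 1)" by (simp only: D)
    then show "D (axis i h) = D (axis i 1) * h" by (simp only: mult.commute)
  qed
  ultimately show ?thesis
    unfolding field_differentiable_def has_field_derivative_def by metis
qed

lemma cdiff_at_imp_continuous: "cdiff_at F x \<Longrightarrow> isCont F x"
  unfolding cdiff_at_def using has_derivative_continuous by blast

lemma cholomorphic_on_imp_continuous_on: "cholomorphic_on F S \<Longrightarrow> continuous_on S F"
  unfolding cholomorphic_on_iff by (auto intro!: continuous_at_imp_continuous_on cdiff_at_imp_continuous)

lemma norm_axis_eq: "norm (axis i t :: complex^'m) = cmod t"
  by (simp add: norm_eq_sqrt_inner inner_axis_axis)

section \<open>Charts and holomorphic functions on complex surfaces\<close>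

lemma top_chart_inj: "top_chart T V \<phi> \<Longrightarrow> inj_on \<phi> V"
  and top_chart_openin: "top_chart T V \<phi> \<Longrightarrow> openin T V"
  unfolding top_chart_def
  by (auto dest!: homeomorphic_imp_injective_map openin_subset simp: Int_absorb1)

lemma top_chart_subset: "top_chart T V \<phi> \<Longrightarrow> V \<subseteq> topspace T"
  by (simp add: openin_subset top_chart_openin)

lemma top_chart_open_image:
  assumes "top_chart T V \<phi>" "openin T W"
  shows "open (\<phi> ` (V \<inter> W))"
proof -
  have "openin (top_of_set (\<phi> ` V)) (\<phi> ` (V \<inter> W))"
    using assms homeomorphic_imp_open_map unfolding top_chart_def open_map_def
    by (metis openin_subtopology_Int2)
  then show ?thesis using assms unfolding top_chart_def by (metis openin_open_trans)
qed

lemma top_chart_open_preimage: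
  assumes "top_chart T V \<phi>" "open B"
  shows "openin T {x \<in> V. \<phi> x \<in> B}"
proof -
  have "continuous_map (subtopology T V) (top_of_set (\<phi> ` V)) \<phi>"
    using assms homeomorphic_imp_continuous_map unfolding top_chart_def by blast
  then have "continuous_map (subtopology T V) euclidean \<phi>"
    using continuous_map_into_fulltopology by blast
  then have "openin (subtopology T V) {x \<in> topspace (subtopology T V). \<phi> x \<in> B}"
    using assms(2) by (simp add: continuous_map_def)
  moreover have "topspace (subtopology T V) = V"
    using top_chart_subset[OF assms(1)] by auto
  ultimately show ?thesis
    using openin_trans_full top_chart_openin[OF assms(1)] by metis
qed

lemma top_chart_restrict:
  assumes "top_chart T V \<phi>" "openin T V'" "V' \<subseteq> V"
  shows "top_chart T V' \<phi>"
  unfolding top_chart_def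
proof (intro conjI)
  show "open (\<phi> ` V')"
    using top_chart_open_image[OF assms(1,2)] assms(3) by (simp add: Int_absorb1)
  have "homeomorphic_map (subtopology (subtopology T V) V') (subtopology (top_of_set (\<phi> ` V)) (\<phi> ` V')) \<phi>"
  proof (rule homeomorphic_map_subtopologies_alt)
    show "homeomorphic_map (subtopology T V) (top_of_set (\<phi> ` V)) \<phi>"
      using assms(1) by (simp add: top_chart_def)
    show "\<phi> x \<in> \<phi> ` V' \<longleftrightarrow> x \<in> V'" if "x \<in> topspace (subtopology T V)" for x
      using that top_chart_inj[OF assms(1)] assms(3) by (auto dest: inj_onD)
  qed
  then show "homeomorphic_map (subtopology T V') (top_of_set (\<phi> ` V')) \<phi>"
    using assms(3) by (simp add: subtopology_subtopology Int_absorb1 image_mono)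
qed fact

lemma inv_into_restrict:
  assumes "inj_on \<phi> V" "V' \<subseteq> V" "y \<in> \<phi> ` V'"
  shows "inv_into V' \<phi> y = inv_into V \<phi> y"
  using assms by (auto simp: inj_on_subset inv_into_f_f subset_iff)

lemma cholomorphic_on_cong:
  assumes "cholomorphic_on F S" "\<And>y. y \<in> S \<Longrightarrow> F y = G y"
  shows "cholomorphic_on G S"
  using assms cdiff_at_transform unfolding cholomorphic_on_iff by blast

lemma cholomorphic_on_subset:
  "cholomorphic_on F S \<Longrightarrow> open S' \<Longrightarrow> S' \<subseteq> S \<Longrightarrow> cholomorphic_on F S'"
  unfolding cholomorphic_on_iff by blast

lemma chart_restrict:
  assumes chart: "chart X V \<phi>" and surf: "complex_surface X" and V': "openin (Top X) V'" "V' \<subseteq> V"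
  shows "chart X V' \<phi>"
proof -
  have top: "top_chart (Top X) V \<phi>" using chart by (simp add: chart_def)
  have "transition_hol V' \<phi> W \<psi> \<and> transition_hol W \<psi> V' \<phi>" if W: "(W, \<psi>) \<in> Atlas X" for W \<psi>
  proof
    have topW: "top_chart (Top X) W \<psi>" using surf W unfolding complex_surface_def by blast
    have t: "transition_hol V \<phi> W \<psi>" "transition_hol W \<psi> V \<phi>"
      using chart W unfolding chart_def by blast+
    show "transition_hol V' \<phi> W \<psi>" unfolding transition_hol_def
    proof
      fix i
      have "cholomorphic_on (\<lambda>y. \<psi> (inv_into V \<phi> y) $ i) (\<phi> ` (V' \<inter> W))"
      proof (rule cholomorphic_on_subset)
        show "cholomorphic_on (\<lambda>y. \<psi> (inv_into V \<phi> y) $ i) (\<phi> ` (V \<inter> W))"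
          using t(1) by (simp add: transition_hol_def)
        show "open (\<phi> ` (V' \<inter> W))"
          by (rule top_chart_open_image[OF top_chart_restrict[OF top V'] top_chart_openin[OF topW]])
        show "\<phi> ` (V' \<inter> W) \<subseteq> \<phi> ` (V \<inter> W)" using V'(2) by blast
      qed
      then show "cholomorphic_on (\<lambda>y. \<psi> (inv_into V' \<phi> y) $ i) (\<phi> ` (V' \<inter> W))"
      proof (rule cholomorphic_on_cong)
        fix y assume "y \<in> \<phi> ` (V' \<inter> W)"
        then show "\<psi> (inv_into V \<phi> y) $ i = \<psi> (inv_into V' \<phi> y) $ i"
          using inv_into_restrict[OF top_chart_inj[OF top] V'(2), of y] by auto
      qed
    qed
    show "transition_hol W \<psi> V' \<phi>" unfolding transition_hol_def
    proof
      fix i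
      show "cholomorphic_on (\<lambda>y. \<phi> (inv_into W \<psi> y) $ i) (\<psi> ` (W \<inter> V'))"
      proof (rule cholomorphic_on_subset)
        show "cholomorphic_on (\<lambda>y. \<phi> (inv_into W \<psi> y) $ i) (\<psi> ` (W \<inter> V))"
          using t(2) by (simp add: transition_hol_def)
        show "open (\<psi> ` (W \<inter> V'))" by (rule top_chart_open_image[OF topW V'(1)])
        show "\<psi> ` (W \<inter> V') \<subseteq> \<psi> ` (W \<inter> V)" using V'(2) by blast
      qed
    qed
  qed
  then show ?thesis
    using top_chart_restrict[OF top V'] unfolding chart_def by blast
qed

definition swap_coords :: "complex^2 \<Rightarrow> complex^2" where
  "swap_coords v = (\<chi> i. if i = 1 then v $ 2 else v $ 1)"

lemma swap_coords_nth [simp]: "swap_coords v $ 1 = v $ 2" "swap_coords v $ 2 = v $ 1"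
  by (simp_all add: swap_coords_def)

lemma swap_swap_coords [simp]: "swap_coords (swap_coords v) = v"
  by (simp add: vec_eq_iff forall_2)

lemma cdiff_at_swap_coords: "cdiff_at (\<lambda>y. swap_coords y $ i) x"
  by (cases "i = 1") (simp_all add: swap_coords_def)

lemma continuous_swap_coords: "continuous_on S swap_coords"
proof -
  have "continuous_on S (\<lambda>x::complex^2. if i = 1 then x $ 2 else x $ 1)" for i :: 2
    by (cases "i = 1") (simp_all add: continuous_on_component)
  then show ?thesis unfolding swap_coords_def by (rule continuous_on_vec_lambda)
qed

lemma homeomorphic_swap_coords: "homeomorphic_map (top_of_set S) (top_of_set (swap_coords ` S)) swap_coords"
proof -
  have "homeomorphic_maps (top_of_set S) (top_of_set (swap_coords ` S)) swap_coords swap_coords"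
    by (auto simp: homeomorphic_maps_def continuous_swap_coords)
  then show ?thesis by (auto simp: homeomorphic_map_maps)
qed

lemma open_swap_coords:
  assumes "open S" shows "open (swap_coords ` S)"
proof -
  have "open (swap_coords -` S)" using assms open_vimage continuous_swap_coords by blast
  moreover have "swap_coords -` S = swap_coords ` S"
    by (force simp: image_iff intro: swap_swap_coords[symmetric])
  ultimately show ?thesis by simp
qed

text \<open>Exchanging the coordinates turns statements about the first coordinate axis of a chart into
statements about the second one.\<close>

lemma chart_swap:
  assumes chart: "chart X V \<phi>"
  shows "chart X V (\<lambda>x. swap_coords (\<phi> x))"
proof -
  have top: "top_chart (Top X) V \<phi>" using chart by (simp add: chart_def)
  have im: "(\<lambda>x. swap_coords (\<phi> x)) ` A = swap_coords ` \<phi> ` A" for A by auto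
  have inv: "inv_into V (\<lambda>x. swap_coords (\<phi> x)) y = inv_into V \<phi> (swap_coords y)"
    if "y \<in> (\<lambda>x. swap_coords (\<phi> x)) ` V" for y
  proof -
    obtain x where x: "x \<in> V" "y = swap_coords (\<phi> x)" using \<open>y \<in> _\<close> by blast
    have "inj_on (\<lambda>x. swap_coords (\<phi> x)) V"
    proof (rule inj_onI)
      fix a b assume ab: "a \<in> V" "b \<in> V" "swap_coords (\<phi> a) = swap_coords (\<phi> b)"
      from arg_cong[OF ab(3), of swap_coords] have "\<phi> a = \<phi> b" by simp
      then show "a = b" using top_chart_inj[OF top] ab by (simp add: inj_on_def)
    qed
    from inv_into_f_f[OF this x(1)] have "inv_into V (\<lambda>x. swap_coords (\<phi> x)) y = x"
      by (simp add: x(2))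
    moreover have "inv_into V \<phi> (swap_coords y) = x"
      using x top_chart_inj[OF top] by (simp add: inv_into_f_f)
    ultimately show ?thesis by simp
  qed
  have "top_chart (Top X) V (\<lambda>x. swap_coords (\<phi> x))"
    using homeomorphic_map_compose[OF _ homeomorphic_swap_coords, of "subtopology (Top X) V" "\<phi> ` V" \<phi>] top
    unfolding top_chart_def im by (auto simp: o_def intro: open_swap_coords)
  moreover have "transition_hol V (\<lambda>x. swap_coords (\<phi> x)) W \<psi>" "transition_hol W \<psi> V (\<lambda>x. swap_coords (\<phi> x))"
    if W: "(W, \<psi>) \<in> Atlas X" for W \<psi>
  proof -
    have t: "transition_hol V \<phi> W \<psi>" "transition_hol W \<psi> V \<phi>"
      using chart W unfolding chart_def by blast+
    have o: "open (\<phi> ` (V \<inter> W))" using t(1) unfolding transition_hol_def cholomorphic_on_def by blast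
    show "transition_hol V (\<lambda>x. swap_coords (\<phi> x)) W \<psi>"
      unfolding transition_hol_def
    proof
      fix i
      have "cholomorphic_on (\<lambda>y. \<psi> (inv_into V \<phi> (swap_coords y)) $ i) ((\<lambda>x. swap_coords (\<phi> x)) ` (V \<inter> W))"
        unfolding cholomorphic_on_iff im
      proof (intro conjI ballI)
        show "open (swap_coords ` \<phi> ` (V \<inter> W))" using o by (rule open_swap_coords)
        fix y assume "y \<in> swap_coords ` \<phi> ` (V \<inter> W)"
        then have "swap_coords y \<in> \<phi> ` (V \<inter> W)" by auto
        then have "cdiff_at (\<lambda>y. \<psi> (inv_into V \<phi> y) $ i) (swap_coords y)"
          using t(1) unfolding transition_hol_def cholomorphic_on_iff by blast
        then show "cdiff_at (\<lambda>y. \<psi> (inv_into V \<phi> (swap_coords y)) $ i) y"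
          by (rule cdiff_at_compose) (rule cdiff_at_swap_coords)
      qed
      then show "cholomorphic_on (\<lambda>y. \<psi> (inv_into V (\<lambda>x. swap_coords (\<phi> x)) y) $ i) ((\<lambda>x. swap_coords (\<phi> x)) ` (V \<inter> W))"
        by (rule cholomorphic_on_cong) (use inv in auto)
    qed
    show "transition_hol W \<psi> V (\<lambda>x. swap_coords (\<phi> x))"
      unfolding transition_hol_def
    proof
      fix i :: 2
      show "cholomorphic_on (\<lambda>y. swap_coords (\<phi> (inv_into W \<psi> y)) $ i) (\<psi> ` (W \<inter> V))"
        using t(2) unfolding transition_hol_def by (cases "i = 1") (simp_all add: swap_coords_def)
    qed
  qed
  ultimately show ?thesis unfolding chart_def by blast
qed

lemma atlas_top_chart: "complex_surface X \<Longrightarrow> (V, \<phi>) \<in> Atlas X \<Longrightarrow> top_chart (Top X) V \<phi>"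
  unfolding complex_surface_def by blast

lemma atlas_covers:
  assumes "complex_surface X" "p \<in> topspace (Top X)"
  obtains V \<phi> where "(V, \<phi>) \<in> Atlas X" "p \<in> V"
  using assms unfolding complex_surface_def by blast

lemma hol_fun_openin: "hol_fun X W F \<Longrightarrow> openin (Top X) W"
  by (simp add: hol_fun_def)

text \<open>\<^const>\<open>hol_fun\<close> is tested on the charts of the given atlas; the charts of the maximal atlas, such as
those adapted to a curve, serve as well, by composition with a transition map.\<close>

lemma hol_fun_in_chart:
  assumes surf: "complex_surface X" and F: "hol_fun X W F" and chart: "chart X V \<phi>"
  shows "cholomorphic_on (\<lambda>y. F (inv_into V \<phi> y)) (\<phi> ` (V \<inter> W))"
  unfolding cholomorphic_on_iff
proof (intro conjI ballI)
  have top: "top_chart (Top X) V \<phi>" using chart by (simp add: chart_def)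
  note inj = top_chart_inj[OF top]
  show "open (\<phi> ` (V \<inter> W))" by (rule top_chart_open_image[OF top hol_fun_openin[OF F]])
  fix y assume "y \<in> \<phi> ` (V \<inter> W)"
  then obtain x where x: "x \<in> V" "x \<in> W" "y = \<phi> x" by blast
  have "x \<in> topspace (Top X)" using x(1) top_chart_subset[OF top] by blast
  then obtain V' \<psi> where V': "(V', \<psi>) \<in> Atlas X" "x \<in> V'"
    using atlas_covers[OF surf] by blast
  note top' = atlas_top_chart[OF surf V'(1)]
  have xy: "inv_into V \<phi> y = x" using x inj by simp
  have "cholomorphic_on (\<lambda>y. F (inv_into V' \<psi> y)) (\<psi> ` (V' \<inter> W))"
    using F V'(1) unfolding hol_fun_def by blast
  then have "cdiff_at (\<lambda>y. F (inv_into V' \<psi> y)) (\<psi> (inv_into V \<phi> y))"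
    unfolding xy cholomorphic_on_iff using x V' by blast
  moreover have "cdiff_at (\<lambda>y. \<psi> (inv_into V \<phi> y) $ i) y" for i
    using chart V' x unfolding chart_def transition_hol_def cholomorphic_on_iff by blast
  ultimately have "cdiff_at (\<lambda>y. F (inv_into V' \<psi> (\<psi> (inv_into V \<phi> y)))) y"
    by (rule cdiff_at_compose)
  then show "cdiff_at (\<lambda>y. F (inv_into V \<phi> y)) y"
  proof (rule cdiff_at_transform)
    show "open (\<phi> ` (V \<inter> V'))" by (rule top_chart_open_image[OF top top_chart_openin[OF top']])
    show "y \<in> \<phi> ` (V \<inter> V')" using x V' by blast
    fix u assume "u \<in> \<phi> ` (V \<inter> V')"
    then have "inv_into V \<phi> u \<in> V'" using inj by auto
    then show "F (inv_into V' \<psi> (\<psi> (inv_into V \<phi> u))) = F (inv_into V \<phi> u)"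
      using top_chart_inj[OF top'] by simp
  qed
qed

lemma hol_fun_openin_preimage:
  assumes surf: "complex_surface X" and F: "hol_fun X W F" and "open B"
  shows "openin (Top X) {x \<in> W. F x \<in> B}"
proof (subst openin_subopen, clarify)
  fix x assume x: "x \<in> W" "F x \<in> B"
  then obtain V \<phi> where V: "(V, \<phi>) \<in> Atlas X" "x \<in> V"
    using atlas_covers[OF surf] hol_fun_openin[OF F] openin_subset by blast
  note top = atlas_top_chart[OF surf V(1)]
  let ?G = "\<lambda>y. F (inv_into V \<phi> y)"
  have chol: "cholomorphic_on ?G (\<phi> ` (V \<inter> W))"
    using F V unfolding hol_fun_def by blast
  then have "open (\<phi> ` (V \<inter> W) \<inter> ?G -` B)"
    using \<open>open B\<close> by (intro continuous_open_preimage cholomorphic_on_imp_continuous_on)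
      (auto simp: cholomorphic_on_def)
  then have "openin (Top X) {x \<in> V. \<phi> x \<in> \<phi> ` (V \<inter> W) \<inter> ?G -` B}"
    by (rule top_chart_open_preimage[OF top])
  moreover have "x \<in> {x \<in> V. \<phi> x \<in> \<phi> ` (V \<inter> W) \<inter> ?G -` B}"
    using x V top_chart_inj[OF top] by auto
  moreover have "{x \<in> V. \<phi> x \<in> \<phi> ` (V \<inter> W) \<inter> ?G -` B} \<subseteq> {x \<in> W. F x \<in> B}"
  proof clarify
    fix u w assume u: "u \<in> V" "F (inv_into V \<phi> (\<phi> u)) \<in> B" "\<phi> u = \<phi> w" "w \<in> V" "w \<in> W"
    have "u = w" using top_chart_inj[OF top] u(1,3,4) by (simp add: inj_on_eq_iff)
    then show "u \<in> W \<and> F u \<in> B"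
      using u(2,5) inv_into_f_f[OF top_chart_inj[OF top] u(1)] by simp
  qed
  ultimately show "\<exists>T. openin (Top X) T \<and> x \<in> T \<and> T \<subseteq> {x \<in> W. F x \<in> B}" by blast
qed

lemma hol_fun_subset:
  assumes "complex_surface X" "hol_fun X W F" "openin (Top X) W'" "W' \<subseteq> W"
  shows "hol_fun X W' F"
  unfolding hol_fun_def
proof (intro conjI ballI, fact, clarify)
  fix V \<phi> assume V: "(V, \<phi>) \<in> Atlas X"
  show "cholomorphic_on (\<lambda>y. F (inv_into V \<phi> y)) (\<phi> ` (V \<inter> W'))"
  proof (rule cholomorphic_on_subset)
    show "cholomorphic_on (\<lambda>y. F (inv_into V \<phi> y)) (\<phi> ` (V \<inter> W))"
      using assms V unfolding hol_fun_def by blast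
    show "open (\<phi> ` (V \<inter> W'))"
      by (rule top_chart_open_image[OF atlas_top_chart[OF assms(1) V] assms(3)])
  qed (use assms(4) in blast)
qed

lemma hol_funI_local:
  assumes surf: "complex_surface X" and W: "openin (Top X) W"
    and loc: "\<And>p. p \<in> W \<Longrightarrow> \<exists>M G. p \<in> M \<and> hol_fun X M G \<and> (\<forall>x\<in>M \<inter> W. F x = G x)"
  shows "hol_fun X W F"
  unfolding hol_fun_def
proof (intro conjI ballI, fact, clarify)
  fix V \<phi> assume V: "(V, \<phi>) \<in> Atlas X"
  note top = atlas_top_chart[OF surf V]
  show "cholomorphic_on (\<lambda>y. F (inv_into V \<phi> y)) (\<phi> ` (V \<inter> W))"
    unfolding cholomorphic_on_iff
  proof (intro conjI ballI)
    show "open (\<phi> ` (V \<inter> W))" by (rule top_chart_open_image[OF top W])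
    fix y assume "y \<in> \<phi> ` (V \<inter> W)"
    then obtain x where x: "x \<in> V" "x \<in> W" "y = \<phi> x" by blast
    obtain M G where M: "x \<in> M" "hol_fun X M G" "\<forall>x\<in>M \<inter> W. F x = G x" using loc[OF x(2)] by blast
    have "cdiff_at (\<lambda>y. G (inv_into V \<phi> y)) y"
      using M(1,2) V x unfolding hol_fun_def cholomorphic_on_iff by blast
    then show "cdiff_at (\<lambda>y. F (inv_into V \<phi> y)) y"
    proof (rule cdiff_at_transform)
      show "open (\<phi> ` (V \<inter> (M \<inter> W)))"
        by (intro top_chart_open_image[OF top] openin_Int hol_fun_openin[OF M(2)] W)
      show "y \<in> \<phi> ` (V \<inter> (M \<inter> W))" using x M by blast
      fix u assume "u \<in> \<phi> ` (V \<inter> (M \<inter> W))"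
      then have "inv_into V \<phi> u \<in> M \<inter> W" using top_chart_inj[OF top] by auto
      then show "G (inv_into V \<phi> u) = F (inv_into V \<phi> u)" using M(3) by simp
    qed
  qed
qed

lemma hol_fun_const: "complex_surface X \<Longrightarrow> openin (Top X) W \<Longrightarrow> hol_fun X W (\<lambda>x. c)"
  unfolding hol_fun_def cholomorphic_on_iff
  using top_chart_open_image atlas_top_chart by fastforce

lemma hol_fun_add: "hol_fun X W F \<Longrightarrow> hol_fun X W G \<Longrightarrow> hol_fun X W (\<lambda>x. F x + G x)"
  unfolding hol_fun_def cholomorphic_on_iff by (fast intro: cdiff_at_add)

lemma hol_fun_mult: "hol_fun X W F \<Longrightarrow> hol_fun X W G \<Longrightarrow> hol_fun X W (\<lambda>x. F x * G x)"
  unfolding hol_fun_def cholomorphic_on_iff by (fast intro: cdiff_at_mult)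

lemma hol_fun_inverse:
  assumes "complex_surface X" "hol_fun X W F" "\<And>x. x \<in> W \<Longrightarrow> F x \<noteq> 0"
  shows "hol_fun X W (\<lambda>x. inverse (F x))"
  unfolding hol_fun_def cholomorphic_on_iff
proof (intro conjI ballI)
  show "openin (Top X) W" using assms(2) by (rule hol_fun_openin)
  fix q assume q: "q \<in> Atlas X"
  obtain V \<phi> where [simp]: "q = (V, \<phi>)" by (cases q)
  have *: "open (\<phi> ` (V \<inter> W))" "\<And>y. y \<in> \<phi> ` (V \<inter> W) \<Longrightarrow> cdiff_at (\<lambda>y. F (inv_into V \<phi> y)) y"
    using assms(2) q unfolding hol_fun_def cholomorphic_on_iff by auto
  have "inv_into V \<phi> y \<in> W" if "y \<in> \<phi> ` (V \<inter> W)" for y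
    using that top_chart_inj[OF atlas_top_chart[OF assms(1)]] q by auto
  then show "case q of (V, \<phi>) \<Rightarrow> open (\<phi> ` (V \<inter> W)) \<and>
      (\<forall>x\<in>\<phi> ` (V \<inter> W). cdiff_at (\<lambda>x. inverse (F (inv_into V \<phi> x))) x)"
    using * assms(3) by (auto intro!: cdiff_at_inverse)
qed

lemma hol_fun_sum:
  assumes "complex_surface X" "openin (Top X) W" "\<And>i. i \<in> I \<Longrightarrow> hol_fun X W (F i)"
  shows "hol_fun X W (\<lambda>x. \<Sum>i\<in>I. F i x)"
  using assms(3)
  by (induction I rule: infinite_finite_induct) (auto intro: hol_fun_add hol_fun_const assms)

lemma hol_fun_cmult: "complex_surface X \<Longrightarrow> hol_fun X W F \<Longrightarrow> hol_fun X W (\<lambda>x. c * F x)"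
  by (intro hol_fun_mult hol_fun_const) (auto simp: hol_fun_openin)

section \<open>The maximum principle on level curves in a surface\<close>

lemma axis_0: "axis i 0 = (0 :: complex^'m)"
  by (simp only: axis_eq_0_iff)

lemma axis_nth_other: "(axis 1 t :: complex^2) $ 2 = 0" "(axis 2 t :: complex^2) $ 1 = 0"
  by (simp_all add: axis_def)

lemma holomorphic_on_axis:
  assumes "\<And>t. t \<in> S \<Longrightarrow> cdiff_at F (p + axis i t)"
  shows "(\<lambda>t. F (p + axis i t)) holomorphic_on S"
  unfolding holomorphic_on_def
proof
  fix t assume "t \<in> S"
  then show "(\<lambda>t. F (p + axis i t)) field_differentiable at t within S"
    by (rule field_differentiable_at_within[OF cdiff_at_axis[OF assms]])
qed

text \<open>With \<open>W\<close> small, this says that \<open>Re G\<close> has no strict local maximum on the level curve of \<open>F\<close>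
through \<open>p\<close>.\<close>

lemma surface_zero_with_larger_Re:
  assumes surf: "complex_surface X" and F: "hol_fun X W F" and G: "hol_fun X W G" and p: "p \<in> W"
  shows "\<exists>x\<in>W. x \<noteq> p \<and> F x = F p \<and> Re (G p) \<le> Re (G x)"
proof -
  obtain V \<phi> where V: "(V, \<phi>) \<in> Atlas X" "p \<in> V"
    using atlas_covers[OF surf] hol_fun_openin[OF F] p openin_subset by blast
  note top = atlas_top_chart[OF surf V(1)]
  define A where "A = \<phi> ` (V \<inter> W)"
  have "open A" unfolding A_def by (rule top_chart_open_image[OF top hol_fun_openin[OF F]])
  moreover have "\<phi> p \<in> A" using p V by (auto simp: A_def)
  ultimately obtain d where d: "d > 0" "ball (\<phi> p) d \<subseteq> A" using openE by blast
  define r where "r = d / 2"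
  have r: "r > 0" using d by (simp add: r_def)
  define c where "c = (\<lambda>s t. \<phi> p + axis 1 s + axis 2 t :: complex^2)"
  have cA: "c s t \<in> A" if "s \<in> ball 0 r" "t \<in> ball 0 r" for s t
  proof -
    have "norm (axis 1 s + axis 2 t :: complex^2) \<le> cmod s + cmod t"
      by (rule order_trans[OF norm_triangle_ineq]) (simp add: norm_axis_eq)
    also have "\<dots> < d" using that by (simp add: r_def)
    finally have "dist (\<phi> p) (c s t) < d"
      by (simp add: c_def dist_norm algebra_simps norm_minus_commute)
        (metis add.commute minus_add_distrib norm_minus_cancel uminus_add_conv_diff)
    then show ?thesis using d(2) by (simp add: subset_iff)
  qed
  have contc: "continuous_on S (\<lambda>(s, t). c s t)" for S
    unfolding c_def case_prod_unfold
    by (intro continuous_intros linear_continuous_on_compose[OF _ bounded_linear_axis[THEN bounded_linear.linear]])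
  have main: "continuous_on (ball 0 r \<times> ball 0 r) (\<lambda>(s, t). Q (c s t))"
      "\<And>t. t \<in> ball 0 r \<Longrightarrow> (\<lambda>s. Q (c s t)) holomorphic_on ball 0 r"
      "\<And>s. s \<in> ball 0 r \<Longrightarrow> (\<lambda>t. Q (c s t)) holomorphic_on ball 0 r"
    if Q: "cholomorphic_on Q A" for Q
  proof -
    have "(\<lambda>(s, t). c s t) ` (ball 0 r \<times> ball 0 r) \<subseteq> A" using cA by auto
    from continuous_on_compose2[OF cholomorphic_on_imp_continuous_on[OF Q] contc this]
    show "continuous_on (ball 0 r \<times> ball 0 r) (\<lambda>(s, t). Q (c s t))"
      by (simp add: case_prod_unfold)
    have diff: "cdiff_at Q (c s t)" if "s \<in> ball 0 r" "t \<in> ball 0 r" for s t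
      using Q cA[OF that] by (simp add: cholomorphic_on_iff)
    show "(\<lambda>t. Q (c s t)) holomorphic_on ball 0 r" if "s \<in> ball 0 r" for s
      unfolding c_def by (rule holomorphic_on_axis) (use diff[OF that] in \<open>simp add: c_def\<close>)
    have c2: "c s t = (\<phi> p + axis 2 t) + axis 1 s" for s t
      by (simp add: c_def algebra_simps)
    show "(\<lambda>s. Q (c s t)) holomorphic_on ball 0 r" if "t \<in> ball 0 r" for t
      unfolding c2 by (rule holomorphic_on_axis) (use diff[OF _ that] in \<open>simp add: c2\<close>)
  qed
  define inv where "inv = inv_into V \<phi>"
  have F': "cholomorphic_on (\<lambda>y. F (inv y)) A" and G': "cholomorphic_on (\<lambda>y. G (inv y)) A"
    using F G V unfolding hol_fun_def A_def inv_def by blast+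
  have F'': "cholomorphic_on (\<lambda>y. F (inv y) + (- F p)) A"
    using F' cdiff_at_add[OF _ cdiff_at_const] unfolding cholomorphic_on_iff by blast
  have c0: "c 0 0 = \<phi> p" by (simp add: c_def axis_0)
  have inv0: "inv (\<phi> p) = p" using V top_chart_inj[OF top] by (simp add: inv_def)
  have "\<exists>s\<in>ball 0 r. \<exists>t\<in>ball 0 r. (s, t) \<noteq> (0, 0) \<and> F (inv (c s t)) + (- F p) = 0 \<and>
      Re (G (inv (c 0 0))) \<le> Re (G (inv (c s t)))"
    by (rule exists_zero_with_larger_Re[OF r main(1)[OF F''] main(1)[OF G'] main(2)[OF F''] main(3)[OF F'']
          main(2)[OF G'] main(3)[OF G']]) (simp_all add: c0 inv0)
  then obtain s t where st: "s \<in> ball 0 r" "t \<in> ball 0 r" "(s, t) \<noteq> (0, 0)"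
    "F (inv (c s t)) = F p" "Re (G p) \<le> Re (G (inv (c s t)))"
    by (auto simp: c0 inv0)
  obtain x where x: "x \<in> V" "x \<in> W" "c s t = \<phi> x" using cA[OF st(1,2)] by (auto simp: A_def)
  have ix: "inv (c s t) = x" using x top_chart_inj[OF top] by (simp add: inv_def)
  have "c s t \<noteq> \<phi> p"
    using st(3) by (auto simp: c_def vec_eq_iff forall_2 axis_def)
  then have "x \<noteq> p" using x by auto
  then show ?thesis using st x ix by auto
qed

section \<open>Holomorphic discs and branches of a curve with normal crossings\<close>

text \<open>Holomorphy is tested on holomorphic functions of the surface, which makes it usable without
choosing charts. For constant \<open>F\<close> the openness clause expresses continuity.\<close>

definition holo_disc :: "'x csurface \<Rightarrow> (complex \<Rightarrow> 'x) \<Rightarrow> real \<Rightarrow> bool" where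
  "holo_disc X \<gamma> r \<longleftrightarrow> 0 < r \<and> \<gamma> ` ball 0 r \<subseteq> topspace (Top X) \<and>
     (\<forall>W F. hol_fun X W F \<longrightarrow> open {t \<in> ball 0 r. \<gamma> t \<in> W} \<and>
        (\<lambda>t. F (\<gamma> t)) holomorphic_on {t \<in> ball 0 r. \<gamma> t \<in> W})"

lemma holo_disc_open:
  assumes "complex_surface X" "holo_disc X \<gamma> r" "openin (Top X) W"
  shows "open {t \<in> ball 0 r. \<gamma> t \<in> W}"
  using assms(2) hol_fun_const[OF assms(1,3)] unfolding holo_disc_def by blast

lemma holo_disc_continuous:
  assumes "complex_surface X" "holo_disc X \<gamma> r"
  shows "continuous_map (top_of_set (ball 0 r)) (Top X) \<gamma>"
  unfolding continuous_map_def
proof (intro conjI allI impI)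
  show "\<gamma> \<in> topspace (top_of_set (ball 0 r)) \<rightarrow> topspace (Top X)"
    using assms(2) by (auto simp: holo_disc_def)
  fix U assume "openin (Top X) U"
  from holo_disc_open[OF assms this]
  show "openin (top_of_set (ball 0 r)) {x \<in> topspace (top_of_set (ball 0 r)). \<gamma> x \<in> U}"
    by (auto intro: openin_open_eq[THEN iffD2])
qed

lemma holo_disc_connected:
  assumes "complex_surface X" "holo_disc X \<gamma> r" "connected A" "A \<subseteq> ball 0 r"
  shows "connectedin (Top X) (\<gamma> ` A)"
  using connectedin_continuous_map_image[OF holo_disc_continuous[OF assms(1,2)], of A] assms(3,4)
  by (simp add: connectedin_subtopology)

lemma holo_disc_axis:
  assumes surf: "complex_surface X" and chart: "chart X V \<phi>" and p: "p \<in> V" and r: "0 < r" "ball (\<phi> p) r \<subseteq> \<phi> ` V"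
  shows "holo_disc X (\<lambda>t. inv_into V \<phi> (\<phi> p + axis 1 t)) r" (is "holo_disc X ?\<gamma> r")
proof -
  have top: "top_chart (Top X) V \<phi>" using chart by (simp add: chart_def)
  have inV: "\<phi> p + axis 1 t \<in> \<phi> ` V" if "t \<in> ball 0 r" for t
    using that r(2) by (auto simp: subset_iff dist_norm norm_axis_eq)
  have sub: "?\<gamma> ` ball 0 r \<subseteq> V" using inV by (auto simp: inv_into_into)
  have "open {t \<in> ball 0 r. ?\<gamma> t \<in> W}" "(\<lambda>t. F (?\<gamma> t)) holomorphic_on {t \<in> ball 0 r. ?\<gamma> t \<in> W}"
    if F: "hol_fun X W F" for W F
  proof -
    have chol: "cholomorphic_on (\<lambda>y. F (inv_into V \<phi> y)) (\<phi> ` (V \<inter> W))"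
      by (rule hol_fun_in_chart[OF surf F chart])
    have iff: "?\<gamma> t \<in> W \<longleftrightarrow> \<phi> p + axis 1 t \<in> \<phi> ` (V \<inter> W)" if "t \<in> ball 0 r" for t
      using inV[OF that] top_chart_inj[OF top] by (force simp: inj_on_eq_iff)
    have "{t \<in> ball 0 r. ?\<gamma> t \<in> W} = ball 0 r \<inter> (\<lambda>t. \<phi> p + axis 1 t) -` (\<phi> ` (V \<inter> W))"
      using iff by blast
    moreover have "open (ball 0 r \<inter> (\<lambda>t. \<phi> p + axis 1 t) -` (\<phi> ` (V \<inter> W)))"
      using chol by (intro continuous_open_preimage continuous_intros
          linear_continuous_on_compose[OF _ bounded_linear_axis[THEN bounded_linear.linear]])
        (simp_all add: cholomorphic_on_def)
    ultimately show "open {t \<in> ball 0 r. ?\<gamma> t \<in> W}" by simp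
    show "(\<lambda>t. F (?\<gamma> t)) holomorphic_on {t \<in> ball 0 r. ?\<gamma> t \<in> W}"
    proof (rule holomorphic_on_axis[where F = "\<lambda>y. F (inv_into V \<phi> y)"])
      fix t assume "t \<in> {t \<in> ball 0 r. ?\<gamma> t \<in> W}"
      then show "cdiff_at (\<lambda>y. F (inv_into V \<phi> y)) (\<phi> p + axis 1 t)"
        using chol iff unfolding cholomorphic_on_iff by blast
    qed
  qed
  then show ?thesis using r sub top_chart_subset[OF top] unfolding holo_disc_def by blast
qed

text \<open>In an adapted chart the curve is the first coordinate axis.\<close>

lemma curve_disc_at_regular_point:
  assumes surf: "complex_surface X" and p: "p \<in> curve_regular_points X E" and W: "openin (Top X) W" "p \<in> W"
  obtains \<gamma> r U where "holo_disc X \<gamma> r" "\<gamma> 0 = p" "openin (Top X) U" "p \<in> U" "U \<subseteq> W"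
    "E \<inter> U = \<gamma> ` ball 0 r" "E \<inter> U \<subseteq> curve_regular_points X E"
proof -
  obtain V0 \<phi> where V0: "p \<in> V0" "adapted_chart X E V0 \<phi>" "p \<in> E"
    using p unfolding curve_regular_points_def by blast
  have top0: "top_chart (Top X) V0 \<phi>" using V0 by (simp add: adapted_chart_def chart_def)
  define V where "V = V0 \<inter> W"
  have V: "openin (Top X) V" "V \<subseteq> V0" "p \<in> V" "V \<subseteq> W"
    using W V0 top_chart_openin[OF top0] by (auto simp: V_def)
  have chart: "chart X V \<phi>" using chart_restrict[OF _ surf V(1,2)] V0 by (simp add: adapted_chart_def)
  have top: "top_chart (Top X) V \<phi>" using chart by (simp add: chart_def)
  have EV: "E \<inter> V = {x \<in> V. \<phi> x $ 2 = 0}" using V0(2) V(2) unfolding adapted_chart_def by blast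
  have "open (\<phi> ` V)" using top by (simp add: top_chart_def)
  then obtain r where r: "r > 0" "ball (\<phi> p) r \<subseteq> \<phi> ` V" using openE V(3) by (metis imageI)
  define U where "U = {x \<in> V. \<phi> x \<in> ball (\<phi> p) r}"
  define \<gamma> where "\<gamma> = (\<lambda>t. inv_into V \<phi> (\<phi> p + axis 1 t))"
  have p2: "\<phi> p $ 2 = 0" using EV V V0 by blast
  show thesis
  proof
    show "holo_disc X \<gamma> r" unfolding \<gamma>_def by (rule holo_disc_axis[OF surf chart V(3) r])
    show "\<gamma> 0 = p" using top_chart_inj[OF top] V by (simp add: \<gamma>_def axis_0)
    show "openin (Top X) U" unfolding U_def by (rule top_chart_open_preimage[OF top open_ball])
    show "p \<in> U" "U \<subseteq> W" using V r by (auto simp: U_def)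
    show "E \<inter> U = \<gamma> ` ball 0 r"
    proof (intro subset_antisym subsetI)
      fix x assume x: "x \<in> E \<inter> U"
      then have "\<phi> x $ 2 = 0" using EV by (auto simp: U_def)
      then have eq: "\<phi> x = \<phi> p + axis 1 (\<phi> x $ 1 - \<phi> p $ 1)"
        using p2 by (simp add: vec_eq_iff forall_2 axis_def)
      then have "norm (\<phi> x - \<phi> p) = cmod (\<phi> x $ 1 - \<phi> p $ 1)"
        by (metis add_diff_cancel_left' norm_axis_eq)
      then have "\<phi> x $ 1 - \<phi> p $ 1 \<in> ball 0 r"
        using x by (simp add: U_def dist_norm norm_minus_commute)
      moreover have "\<gamma> (\<phi> x $ 1 - \<phi> p $ 1) = x"
        unfolding \<gamma>_def eq[symmetric] using x top_chart_inj[OF top] by (simp add: U_def)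
      ultimately show "x \<in> \<gamma> ` ball 0 r" by (metis imageI)
    next
      fix x assume "x \<in> \<gamma> ` ball 0 r"
      then obtain t where t: "x = \<gamma> t" "t \<in> ball 0 r" by blast
      then have b: "\<phi> p + axis 1 t \<in> ball (\<phi> p) r" by (simp add: dist_norm norm_axis_eq)
      then have m: "\<phi> p + axis 1 t \<in> \<phi> ` V" using r by blast
      have xV: "x \<in> V" unfolding t \<gamma>_def using m by (rule inv_into_into)
      have \<phi>x: "\<phi> x = \<phi> p + axis 1 t" unfolding t \<gamma>_def using m by (rule f_inv_into_f)
      then have "\<phi> x $ 2 = 0" by (simp add: p2 axis_nth_other)
      then have "x \<in> E" using EV xV by blast
      moreover have "x \<in> U" unfolding U_def using xV b \<phi>x by simp
      ultimately show "x \<in> E \<inter> U" by simp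
    qed
    show "E \<inter> U \<subseteq> curve_regular_points X E"
      using chart EV unfolding curve_regular_points_def adapted_chart_def U_def by blast
  qed
qed

text \<open>The last clause says that small punctured discs are relatively open in \<open>E\<close>: away from \<open>p\<close>, the branch
does not meet the rest of \<open>E\<close>.\<close>

definition branch_at :: "'x csurface \<Rightarrow> 'x set \<Rightarrow> 'x \<Rightarrow> (complex \<Rightarrow> 'x) \<Rightarrow> real \<Rightarrow> bool" where
  "branch_at X E p \<gamma> r \<longleftrightarrow> holo_disc X \<gamma> r \<and> \<gamma> 0 = p \<and> \<gamma> ` (ball 0 r - {0}) \<subseteq> curve_regular_points X E \<and>
     (\<forall>r'. 0 < r' \<and> r' \<le> r \<longrightarrow> (\<exists>U. openin (Top X) U \<and> E \<inter> U = \<gamma> ` (ball 0 r' - {0})))"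

text \<open>The hypothesis on \<open>E\<close> holds both at smooth points and at nodes of \<open>E\<close>: it only concerns the chart
outside the second coordinate axis.\<close>

lemma branch_at_axis:
  fixes \<phi> :: "'x \<Rightarrow> complex^2"
  assumes surf: "complex_surface X" and chart: "chart X V \<phi>" and p: "p \<in> V" "\<phi> p = 0"
    and r: "0 < r" "ball 0 r \<subseteq> \<phi> ` V"
    and E: "\<And>x. x \<in> V \<Longrightarrow> \<phi> x $ 1 \<noteq> 0 \<Longrightarrow> x \<in> E \<longleftrightarrow> \<phi> x $ 2 = 0"
  shows "branch_at X E p (\<lambda>t. inv_into V \<phi> (axis 1 t)) r"
proof -
  have top: "top_chart (Top X) V \<phi>" using chart by (simp add: chart_def)
  define \<gamma> where "\<gamma> = (\<lambda>t. inv_into V \<phi> (axis 1 t))"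
  have disc: "holo_disc X \<gamma> r"
    using holo_disc_axis[OF surf chart p(1), of r] r p by (simp add: \<gamma>_def)
  have \<gamma>V: "\<gamma> t \<in> V" "\<phi> (\<gamma> t) = axis 1 t" if "t \<in> ball 0 r" for t
  proof -
    have "axis 1 t \<in> \<phi> ` V" using that r by (auto simp: subset_iff norm_axis_eq)
    then show "\<gamma> t \<in> V" "\<phi> (\<gamma> t) = axis 1 t" by (simp_all add: \<gamma>_def inv_into_into f_inv_into_f)
  qed
  have op: "openin (Top X) {x \<in> V. \<phi> x \<in> ball 0 s \<inter> {y. y $ 1 \<noteq> 0}}" for s
  proof (rule top_chart_open_preimage[OF top])
    have "open {y :: complex^2. y $ 1 \<noteq> 0}"
      by (intro open_Collect_neq continuous_intros)
    then show "open (ball 0 s \<inter> {y :: complex^2. y $ 1 \<noteq> 0})" by blast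
  qed
  have eq: "E \<inter> {x \<in> V. \<phi> x \<in> ball 0 s \<inter> {y. y $ 1 \<noteq> 0}} = \<gamma> ` (ball 0 s - {0})" if "s \<le> r" for s
  proof (intro subset_antisym subsetI)
    fix x assume x: "x \<in> E \<inter> {x \<in> V. \<phi> x \<in> ball 0 s \<inter> {y. y $ 1 \<noteq> 0}}"
    then have "\<phi> x $ 2 = 0" using E by blast
    then have eq: "\<phi> x = axis 1 (\<phi> x $ 1)" by (simp add: vec_eq_iff forall_2 axis_def)
    have "norm (\<phi> x) = cmod (\<phi> x $ 1)" by (subst eq) (rule norm_axis_eq)
    then have "\<phi> x $ 1 \<in> ball 0 s - {0}" using x by simp
    moreover have "\<gamma> (\<phi> x $ 1) = x"
      unfolding \<gamma>_def eq[symmetric] using x top_chart_inj[OF top] by simp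
    ultimately show "x \<in> \<gamma> ` (ball 0 s - {0})" by (metis imageI)
  next
    fix x assume "x \<in> \<gamma> ` (ball 0 s - {0})"
    then obtain t where t: "x = \<gamma> t" "t \<in> ball 0 s" "t \<noteq> 0" by blast
    then have "t \<in> ball 0 r" using that by simp
    from \<gamma>V[OF this] t E[of x]
    show "x \<in> E \<inter> {x \<in> V. \<phi> x \<in> ball 0 s \<inter> {y. y $ 1 \<noteq> 0}}"
      by (simp add: norm_axis_eq axis_nth_other)
  qed
  have "\<gamma> ` (ball 0 r - {0}) \<subseteq> curve_regular_points X E"
  proof
    fix x assume x: "x \<in> \<gamma> ` (ball 0 r - {0})"
    let ?V' = "{x \<in> V. \<phi> x \<in> ball 0 r \<inter> {y. y $ 1 \<noteq> 0}}"
    have "chart X ?V' \<phi>" by (rule chart_restrict[OF chart surf op]) blast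
    moreover have "E \<inter> ?V' = {x \<in> ?V'. \<phi> x $ 2 = 0}" using E by blast
    ultimately have A: "adapted_chart X E ?V' \<phi>" unfolding adapted_chart_def by (rule conjI)
    have "x \<in> E \<inter> ?V'" using x by (simp only: eq[OF order_refl])
    then have "x \<in> E" "x \<in> ?V'" by (simp_all only: Int_iff)
    with A show "x \<in> curve_regular_points X E"
      unfolding curve_regular_points_def by (intro CollectI conjI exI)
  qed
  moreover have "\<gamma> 0 = p"
    using inv_into_f_f[OF top_chart_inj[OF top] p(1)] by (simp add: \<gamma>_def axis_0 p(2))
  moreover have "\<exists>U. openin (Top X) U \<and> E \<inter> U = \<gamma> ` (ball 0 r' - {0})" if "r' \<le> r" for r'
    using op eq[OF that] by (intro exI conjI)
  ultimately show ?thesis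
    unfolding \<gamma>_def[symmetric] branch_at_def using disc by simp
qed

text \<open>At a smooth point of \<open>E\<close> the two branches coincide. The radius \<open>r'\<close>
is free so that both discs can be shrunk until a given function has no zeros on them outside \<open>p\<close>.\<close>

lemma normal_crossings_branches:
  fixes X :: "'x csurface"
  assumes surf: "complex_surface X" and nc: "normal_crossings X E" and p: "p \<in> E"
  obtains r \<gamma>1 \<gamma>2 where "0 < r" "branch_at X E p \<gamma>1 r" "branch_at X E p \<gamma>2 r"
    "\<And>r'. 0 < r' \<Longrightarrow> r' \<le> r \<Longrightarrow>
       \<exists>U. openin (Top X) U \<and> p \<in> U \<and> E \<inter> U = \<gamma>1 ` ball 0 r' \<union> \<gamma>2 ` ball 0 r'"
proof -
  obtain V and \<phi> :: "'x \<Rightarrow> complex^2" where V: "p \<in> V" "chart X V \<phi>" "\<phi> p = 0"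
    and cases: "E \<inter> V = {x \<in> V. \<phi> x $ 2 = 0} \<or> E \<inter> V = {x \<in> V. \<phi> x $ 1 * \<phi> x $ 2 = 0}"
    using nc p unfolding normal_crossings_def by blast
  have top: "top_chart (Top X) V \<phi>" using V by (simp add: chart_def)
  have sV: "chart X V (\<lambda>x. swap_coords (\<phi> x))" by (rule chart_swap[OF V(2)])
  have stop: "top_chart (Top X) V (\<lambda>x. swap_coords (\<phi> x))" using sV by (simp add: chart_def)
  have s0: "swap_coords (\<phi> p) = 0" using V by (simp add: vec_eq_iff forall_2)
  obtain r1 where r1: "r1 > 0" "ball 0 r1 \<subseteq> \<phi> ` V"
    using openE[of "\<phi> ` V" 0] top V unfolding top_chart_def by (metis imageI)
  obtain r2 where r2: "r2 > 0" "ball 0 r2 \<subseteq> (\<lambda>x. swap_coords (\<phi> x)) ` V"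
    using openE[of "(\<lambda>x. swap_coords (\<phi> x)) ` V" 0] stop V s0 unfolding top_chart_def
    by (metis (mono_tags, lifting) imageI)
  define r where "r = min r1 r2"
  have r: "r > 0" "ball 0 r \<subseteq> \<phi> ` V" "ball 0 r \<subseteq> (\<lambda>x. swap_coords (\<phi> x)) ` V"
    using r1 r2 by (auto simp: r_def)
  define \<gamma>1 where "\<gamma>1 = (\<lambda>t. inv_into V \<phi> (axis 1 t))"
  define \<gamma>2 where "\<gamma>2 = (\<lambda>t. inv_into V (\<lambda>x. swap_coords (\<phi> x)) (axis 1 t))"
  have b1: "branch_at X E p \<gamma>1 r"
    unfolding \<gamma>1_def by (rule branch_at_axis[OF surf V(2,1,3) r(1,2)]) (use cases in auto)
  have in1: "x = \<gamma>1 (\<phi> x $ 1)" "norm (\<phi> x) = cmod (\<phi> x $ 1)" if "x \<in> V" "\<phi> x $ 2 = 0" for x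
  proof -
    have eq: "\<phi> x = axis 1 (\<phi> x $ 1)" using that by (simp add: vec_eq_iff forall_2 axis_def)
    show "x = \<gamma>1 (\<phi> x $ 1)"
      unfolding \<gamma>1_def eq[symmetric] using that top_chart_inj[OF top] by simp
    show "norm (\<phi> x) = cmod (\<phi> x $ 1)" by (subst eq) (rule norm_axis_eq)
  qed
  have out1: "\<gamma>1 t \<in> V" "\<phi> (\<gamma>1 t) = axis 1 t" if "t \<in> ball 0 r" for t
  proof -
    have "axis 1 t \<in> \<phi> ` V" using that r by (auto simp: subset_iff norm_axis_eq)
    then show "\<gamma>1 t \<in> V" "\<phi> (\<gamma>1 t) = axis 1 t" by (simp_all add: \<gamma>1_def inv_into_into f_inv_into_f)
  qed
  define U where "U = (\<lambda>r'. {x \<in> V. \<phi> x \<in> ball 0 r'})"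
  have U: "openin (Top X) (U r')" "r' > 0 \<Longrightarrow> p \<in> U r'" for r'
    using top_chart_open_preimage[OF top open_ball[of 0]] V by (simp_all add: U_def)
  from cases show thesis
  proof
    assume EV: "E \<inter> V = {x \<in> V. \<phi> x $ 2 = 0}"
    have "E \<inter> U r' = \<gamma>1 ` ball 0 r' \<union> \<gamma>1 ` ball 0 r'" if "r' \<le> r" for r'
    proof (intro subset_antisym subsetI)
      fix x assume "x \<in> E \<inter> U r'"
      then have x: "x \<in> V" "x \<in> E" "norm (\<phi> x) < r'" by (simp_all add: U_def)
      then have "\<phi> x $ 2 = 0" using EV by blast
      from in1[OF x(1) this] x(3) show "x \<in> \<gamma>1 ` ball 0 r' \<union> \<gamma>1 ` ball 0 r'"
        by (metis UnI1 imageI mem_ball_0)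
    next
      fix x assume "x \<in> \<gamma>1 ` ball 0 r' \<union> \<gamma>1 ` ball 0 r'"
      then obtain t where t: "x = \<gamma>1 t" "t \<in> ball 0 r'" by blast
      then have x: "x \<in> V" "\<phi> x = axis 1 t" using out1[of t] that by auto
      then have "\<phi> x $ 2 = 0" by (simp add: axis_nth_other)
      then have "x \<in> E" using EV x(1) by blast
      then show "x \<in> E \<inter> U r'" using t(2) x by (simp add: U_def norm_axis_eq)
    qed
    note eq = this
    show thesis
    proof (rule that[OF r(1) b1 b1])
      fix r' assume r': "0 < r'" "r' \<le> r"
      show "\<exists>U. openin (Top X) U \<and> p \<in> U \<and> E \<inter> U = \<gamma>1 ` ball 0 r' \<union> \<gamma>1 ` ball 0 r'"
        using U(1) U(2)[OF r'(1)] eq[OF r'(2)] by (intro exI conjI)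
    qed
  next
    assume EV: "E \<inter> V = {x \<in> V. \<phi> x $ 1 * \<phi> x $ 2 = 0}"
    have b2: "branch_at X E p \<gamma>2 r"
      unfolding \<gamma>2_def by (rule branch_at_axis[OF surf sV V(1) s0 r(1,3)]) (use EV in auto)
    have in2: "x = \<gamma>2 (\<phi> x $ 2)" "norm (\<phi> x) = cmod (\<phi> x $ 2)" if "x \<in> V" "\<phi> x $ 1 = 0" for x
    proof -
      have eq: "swap_coords (\<phi> x) = axis 1 (\<phi> x $ 2)" using that by (simp add: vec_eq_iff forall_2 axis_def)
      show "x = \<gamma>2 (\<phi> x $ 2)"
        unfolding \<gamma>2_def eq[symmetric] using inv_into_f_f[OF top_chart_inj[OF stop] that(1)] by simp
      have "\<phi> x = axis 2 (\<phi> x $ 2)" using that by (simp add: vec_eq_iff forall_2 axis_def)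
      then show "norm (\<phi> x) = cmod (\<phi> x $ 2)" by (metis norm_axis_eq)
    qed
    have out2: "\<gamma>2 t \<in> V" "\<phi> (\<gamma>2 t) = axis 2 t" if "t \<in> ball 0 r" for t
    proof -
      have *: "axis 1 t \<in> (\<lambda>x. swap_coords (\<phi> x)) ` V" using that r(3) by (auto simp: subset_iff norm_axis_eq)
      then show "\<gamma>2 t \<in> V" unfolding \<gamma>2_def by (rule inv_into_into)
      have "swap_coords (\<phi> (\<gamma>2 t)) = axis 1 t" using f_inv_into_f[OF *] by (simp add: \<gamma>2_def)
      then have "\<phi> (\<gamma>2 t) = swap_coords (axis 1 t)" by (metis swap_swap_coords)
      then show "\<phi> (\<gamma>2 t) = axis 2 t" by (simp add: vec_eq_iff forall_2 axis_def)
    qed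
    have "E \<inter> U r' = \<gamma>1 ` ball 0 r' \<union> \<gamma>2 ` ball 0 r'" if "r' \<le> r" for r'
    proof (intro subset_antisym subsetI)
      fix x assume "x \<in> E \<inter> U r'"
      then have x: "x \<in> V" "x \<in> E" "norm (\<phi> x) < r'" by (simp_all add: U_def)
      then have "\<phi> x $ 1 * \<phi> x $ 2 = 0" using EV by blast
      then consider "\<phi> x $ 1 = 0" | "\<phi> x $ 2 = 0" by auto
      then show "x \<in> \<gamma>1 ` ball 0 r' \<union> \<gamma>2 ` ball 0 r'"
      proof cases
        case 1
        from in2[OF x(1) this] x(3) show ?thesis by (metis UnI2 imageI mem_ball_0)
      next
        case 2
        from in1[OF x(1) this] x(3) show ?thesis by (metis UnI1 imageI mem_ball_0)
      qed
    next
      fix x assume "x \<in> \<gamma>1 ` ball 0 r' \<union> \<gamma>2 ` ball 0 r'"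
      then obtain t where t: "x = \<gamma>1 t \<or> x = \<gamma>2 t" "t \<in> ball 0 r'" by blast
      then have x: "x \<in> V" "\<phi> x = axis 1 t \<or> \<phi> x = axis 2 t" using out1[of t] out2[of t] that by auto
      then have "\<phi> x $ 1 * \<phi> x $ 2 = 0" by (auto simp: axis_nth_other)
      then have "x \<in> E" using EV x(1) by blast
      moreover have "norm (\<phi> x) < r'" using x(2) t(2) by (auto simp: norm_axis_eq)
      ultimately show "x \<in> E \<inter> U r'" using x(1) by (simp add: U_def)
    qed
    note eq = this
    show thesis
    proof (rule that[OF r(1) b1 b2])
      fix r' assume r': "0 < r'" "r' \<le> r"
      show "\<exists>U. openin (Top X) U \<and> p \<in> U \<and> E \<inter> U = \<gamma>1 ` ball 0 r' \<union> \<gamma>2 ` ball 0 r'"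
        using U(1) U(2)[OF r'(1)] eq[OF r'(2)] by (intro exI conjI)
    qed
  qed
qed

section \<open>Affine coordinates on the projective line\<close>

lemma hom_point_cases:
  obtains a b where "(a, b) \<noteq> (0, 0)" "w = hom_point a b"
proof -
  obtain a b where ab: "(a, b) \<noteq> (0, 0)" "line_of w = range (\<lambda>c. (c * a, c * b))"
    using line_of[of w] by blast
  have "w = hom_point a b"
    unfolding hom_point_def ab(2)[symmetric] by (simp add: line_of_inverse)
  with ab(1) show thesis by (rule that)
qed

text \<open>The Moebius transformation that sends \<open>(e1 : e2)\<close> to \<open>0\<close> and the antipodal point to infinity. At the
antipodal point the division by zero gives the value \<open>0\<close>, so this point has to be kept away.\<close>

definition cp1_coord :: "complex \<Rightarrow> complex \<Rightarrow> cp1 \<Rightarrow> complex" where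
  "cp1_coord e1 e2 w = (SOME c. \<exists>a b. (a, b) \<noteq> (0, 0) \<and> w = hom_point a b \<and>
     c = (e2 * a - e1 * b) / (cnj e1 * a + cnj e2 * b))"

lemma cp1_coord_hom_point:
  assumes ab: "(a, b) \<noteq> (0, 0)"
  shows "cp1_coord e1 e2 (hom_point a b) = (e2 * a - e1 * b) / (cnj e1 * a + cnj e2 * b)"
  unfolding cp1_coord_def
proof (rule some_equality)
  show "\<exists>a' b'. (a', b') \<noteq> (0, 0) \<and> hom_point a b = hom_point a' b' \<and>
      (e2 * a - e1 * b) / (cnj e1 * a + cnj e2 * b) = (e2 * a' - e1 * b') / (cnj e1 * a' + cnj e2 * b')"
    using ab by blast
  fix c assume "\<exists>a' b'. (a', b') \<noteq> (0, 0) \<and> hom_point a b = hom_point a' b' \<and>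
      c = (e2 * a' - e1 * b') / (cnj e1 * a' + cnj e2 * b')"
  then obtain a' b' where ab': "(a', b') \<noteq> (0, 0)" "a * b' = b * a'"
    and c: "c = (e2 * a' - e1 * b') / (cnj e1 * a' + cnj e2 * b')"
    using hom_point_eq_iff[OF ab] by blast
  obtain t where t: "a' = t * a" "b' = t * b"
  proof (cases "a = 0")
    case True
    with ab ab' have "b \<noteq> 0" "a' = 0" by auto
    with True show thesis by (intro that[of "b' / b"]) auto
  next
    case False
    with ab' show thesis by (intro that[of "a' / a"]) (auto simp: field_simps)
  qed
  then have "t \<noteq> 0" using ab' by auto
  have "c = (t * (e2 * a - e1 * b)) / (t * (cnj e1 * a + cnj e2 * b))"
    unfolding c t by (simp add: algebra_simps)
  then show "c = (e2 * a - e1 * b) / (cnj e1 * a + cnj e2 * b)"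
    using \<open>t \<noteq> 0\<close> by (simp only: mult_divide_mult_cancel_left_if if_False)
qed

lemma openin_hol_to_cp1_neq:
  assumes surf: "complex_surface X" and H: "hol_to_cp1 X N H"
  shows "openin (Top X) {x \<in> N. H x \<noteq> e}"
proof (subst openin_subopen, clarify)
  fix x assume x: "x \<in> N" "H x \<noteq> e"
  obtain e1 e2 where e: "(e1, e2) \<noteq> (0, 0)" "e = hom_point e1 e2" by (rule hom_point_cases)
  obtain M a b where M: "x \<in> M" "M \<subseteq> N" "hol_fun X M a" "hol_fun X M b"
    and ab: "\<And>y. y \<in> M \<Longrightarrow> (a y, b y) \<noteq> (0, 0)" "\<And>y. y \<in> M \<Longrightarrow> H y = hom_point (a y) (b y)"
    using H x unfolding hol_to_cp1_def by metis
  have iff: "H y = e \<longleftrightarrow> e2 * a y + (- e1) * b y = 0" if "y \<in> M" for y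
    using hom_point_eq_iff[OF ab(1)[OF that] e(1)] ab(2)[OF that] e(2)
    by (simp add: mult.commute)
  have "hol_fun X M (\<lambda>y. e2 * a y + (- e1) * b y)"
    by (intro hol_fun_add hol_fun_cmult surf M)
  then have "openin (Top X) {y \<in> M. e2 * a y + (- e1) * b y \<in> - {0}}"
    by (rule hol_fun_openin_preimage[OF surf _ open_Compl[OF closed_singleton]])
  moreover have "{y \<in> M. e2 * a y + (- e1) * b y \<in> - {0}} = {y \<in> M. H y \<noteq> e}"
    using iff by auto
  ultimately have "openin (Top X) {y \<in> M. H y \<noteq> e}" by (simp only:)
  then show "\<exists>T. openin (Top X) T \<and> x \<in> T \<and> T \<subseteq> {x \<in> N. H x \<noteq> e}"
    using x M by (intro exI[of _ "{y \<in> M. H y \<noteq> e}"]) auto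
qed

text \<open>On the open set where \<open>H\<close> avoids the antipode of \<open>e\<close>, the morphism \<open>H\<close> is replaced by a holomorphic
function with the same fibres which vanishes exactly where \<open>H = e\<close>.\<close>

lemma hol_to_cp1_coordinate:
  assumes surf: "complex_surface X" and H: "hol_to_cp1 X N H"
  obtains W \<kappa> where "hol_fun X W \<kappa>" "W \<subseteq> N" "\<And>x. x \<in> N \<Longrightarrow> H x = e \<Longrightarrow> x \<in> W"
    "\<And>x. x \<in> W \<Longrightarrow> \<kappa> x = 0 \<longleftrightarrow> H x = e"
    "\<And>x y. x \<in> W \<Longrightarrow> y \<in> W \<Longrightarrow> \<kappa> x = \<kappa> y \<longleftrightarrow> H x = H y"
proof -
  obtain e1 e2 where e: "(e1, e2) \<noteq> (0, 0)" "e = hom_point e1 e2" by (rule hom_point_cases)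
  define n where "n = e1 * cnj e1 + e2 * cnj e2"
  have n: "n \<noteq> 0"
  proof
    assume "n = 0"
    then have "complex_of_real ((cmod e1)\<^sup>2 + (cmod e2)\<^sup>2) = 0"
      unfolding n_def by (simp add: complex_norm_square[symmetric])
    then have "(cmod e1)\<^sup>2 + (cmod e2)\<^sup>2 = 0" using of_real_eq_0_iff by blast
    then show False using e(1) by (simp add: sum_power2_eq_zero_iff)
  qed
  define e' where "e' = hom_point (- cnj e2) (cnj e1)"
  have e'0: "(- cnj e2, cnj e1) \<noteq> (0, 0)" using e(1) by auto
  have eq_e': "hom_point a b = e' \<longleftrightarrow> cnj e1 * a + cnj e2 * b = 0" if "(a, b) \<noteq> (0, 0)" for a b
    using hom_point_eq_iff[OF that e'0] unfolding e'_def by (auto simp: algebra_simps add_eq_0_iff)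
  define W where "W = {x \<in> N. H x \<noteq> e'}"
  define \<kappa> where "\<kappa> = (\<lambda>x. cp1_coord e1 e2 (H x))"
  have W: "openin (Top X) W" unfolding W_def by (rule openin_hol_to_cp1_neq[OF surf H])
  have rep: "\<exists>a b. (a, b) \<noteq> (0, 0) \<and> H x = hom_point a b \<and> cnj e1 * a + cnj e2 * b \<noteq> 0 \<and>
      \<kappa> x = (e2 * a - e1 * b) / (cnj e1 * a + cnj e2 * b)" if "x \<in> W" for x
  proof -
    obtain a b where ab: "(a, b) \<noteq> (0, 0)" "H x = hom_point a b" by (rule hom_point_cases)
    then show ?thesis using that eq_e' cp1_coord_hom_point[OF ab(1)] by (auto simp: W_def \<kappa>_def)
  qed
  have inj: "\<kappa> x = \<kappa> y \<longleftrightarrow> H x = H y" if xy: "x \<in> W" "y \<in> W" for x y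
  proof
    assume eq: "\<kappa> x = \<kappa> y"
    obtain a b where ab: "(a, b) \<noteq> (0, 0)" "H x = hom_point a b" "cnj e1 * a + cnj e2 * b \<noteq> 0"
      "\<kappa> x = (e2 * a - e1 * b) / (cnj e1 * a + cnj e2 * b)" using rep[OF xy(1)] by blast
    obtain c d where cd: "(c, d) \<noteq> (0, 0)" "H y = hom_point c d" "cnj e1 * c + cnj e2 * d \<noteq> 0"
      "\<kappa> y = (e2 * c - e1 * d) / (cnj e1 * c + cnj e2 * d)" using rep[OF xy(2)] by blast
    have "(e2 * a - e1 * b) * (cnj e1 * c + cnj e2 * d) = (e2 * c - e1 * d) * (cnj e1 * a + cnj e2 * b)"
      using eq ab(3,4) cd(3,4) by (simp add: frac_eq_eq)
    then have "n * (a * d - b * c) = 0" unfolding n_def by (simp add: algebra_simps)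
    then have "a * d = b * c" using n by simp
    then show "H x = H y" using hom_point_eq_iff[OF ab(1) cd(1)] ab(2) cd(2) by simp
  qed (simp add: \<kappa>_def)
  have zero: "\<kappa> x = 0 \<longleftrightarrow> H x = e" if x: "x \<in> W" for x
  proof -
    obtain a b where ab: "(a, b) \<noteq> (0, 0)" "H x = hom_point a b" "cnj e1 * a + cnj e2 * b \<noteq> 0"
      "\<kappa> x = (e2 * a - e1 * b) / (cnj e1 * a + cnj e2 * b)" using rep[OF x] by blast
    then have "\<kappa> x = 0 \<longleftrightarrow> e2 * a - e1 * b = 0" by simp
    also have "\<dots> \<longleftrightarrow> a * e2 = b * e1" by (simp add: mult.commute)
    also have "\<dots> \<longleftrightarrow> H x = e" using hom_point_eq_iff[OF ab(1) e(1)] ab(2) e(2) by simp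
    finally show ?thesis .
  qed
  have hol: "hol_fun X W \<kappa>"
  proof (rule hol_funI_local[OF surf W])
    fix p assume p: "p \<in> W"
    then have "p \<in> N" by (simp add: W_def)
    then obtain M a b where M: "p \<in> M" "M \<subseteq> N" "hol_fun X M a" "hol_fun X M b"
      and ab: "\<And>y. y \<in> M \<Longrightarrow> (a y, b y) \<noteq> (0, 0)" "\<And>y. y \<in> M \<Longrightarrow> H y = hom_point (a y) (b y)"
      using H unfolding hol_to_cp1_def by metis
    have MW: "openin (Top X) (M \<inter> W)" using hol_fun_openin[OF M(3)] W by blast
    have hab: "hol_fun X (M \<inter> W) a" "hol_fun X (M \<inter> W) b"
      using hol_fun_subset[OF surf M(3) MW] hol_fun_subset[OF surf M(4) MW] by simp_all
    have "hol_fun X (M \<inter> W) (\<lambda>x. (e2 * a x + (- e1) * b x) * inverse (cnj e1 * a x + cnj e2 * b x))"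
    proof (intro hol_fun_mult hol_fun_add hol_fun_inverse hol_fun_const surf hab MW)
      fix x assume "x \<in> M \<inter> W"
      then show "cnj e1 * a x + cnj e2 * b x \<noteq> 0"
        using eq_e'[OF ab(1)] ab(2) by (auto simp: W_def)
    qed
    moreover have "\<kappa> x = (e2 * a x + (- e1) * b x) * inverse (cnj e1 * a x + cnj e2 * b x)" if "x \<in> M" for x
      using cp1_coord_hom_point[OF ab(1)[OF that]] ab(2)[OF that] by (simp add: \<kappa>_def divide_inverse)
    ultimately show "\<exists>M G. p \<in> M \<and> hol_fun X M G \<and> (\<forall>x\<in>M \<inter> W. \<kappa> x = G x)"
      using p M(1) by blast
  qed
  have "x \<in> W" if "x \<in> N" "H x = e" for x
  proof -
    have "e \<noteq> e'" using eq_e'[OF e(1)] e(2) n by (simp add: n_def mult.commute)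
    then show ?thesis using that by (simp add: W_def)
  qed
  then show thesis using that[OF hol _ _ zero inj] by (simp add: W_def)
qed

section \<open>Strata of a curve with normal crossings\<close>

text \<open>The components of the regular locus of \<open>E\<close>, called strata, are easier to handle than their closures,
the irreducible components of \<open>E\<close>: different strata are disjoint and each is relatively open in \<open>E\<close>.\<close>

locale fibred_crossing_curve =
  fixes X :: "'x csurface" and E N :: "'x set" and H :: "'x \<Rightarrow> cp1"
  assumes surf: "complex_surface X"
    and nc: "normal_crossings X E"
    and closed_E: "closedin (Top X) E"
    and E_subset_N: "E \<subseteq> N"
    and hol_H: "hol_to_cp1 X N H"
begin

abbreviation "R \<equiv> curve_regular_points X E"
abbreviation "strata \<equiv> connected_components_of (subtopology (Top X) R)"
abbreviation closure_in_X ("cl") where "cl A \<equiv> Top X closure_of A"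

lemma E_subset_top: "E \<subseteq> topspace (Top X)"
  using closed_E by (rule closedin_subset)

lemma R_subset_E: "R \<subseteq> E"
  unfolding curve_regular_points_def by blast

lemma openin_N: "openin (Top X) N"
  using hol_H by (simp add: hol_to_cp1_def)

lemma stratum_subset_R: "K \<in> strata \<Longrightarrow> K \<subseteq> R"
  using connected_components_of_subset by fastforce

lemma stratum_connectedin: "K \<in> strata \<Longrightarrow> connectedin (Top X) K"
  using connectedin_connected_components_of connectedin_subtopology by blast

lemma exists_stratum: "x \<in> R \<Longrightarrow> \<exists>K\<in>strata. x \<in> K"
proof -
  assume x: "x \<in> R"
  then have "x \<in> topspace (subtopology (Top X) R)"
    using R_subset_E E_subset_top by auto
  then have "x \<in> \<Union> strata" by (simp only: Union_connected_components_of)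
  then show ?thesis by blast
qed

lemma stratum_absorbs_connected:
  assumes "K \<in> strata" "connectedin (Top X) C" "C \<subseteq> R" "C \<inter> K \<noteq> {}"
  shows "C \<subseteq> K"
  using connected_components_of_maximal[OF assms(1), of C] assms(2-)
  by (auto simp: connectedin_subtopology disjnt_def)

text \<open>A disc of \<open>E\<close> around a point of the stratum is connected and consists of regular points, so it stays
in the stratum.\<close>

lemma stratum_relatively_open:
  assumes K: "K \<in> strata"
  obtains U where "openin (Top X) U" "K = E \<inter> U"
proof -
  have "\<exists>U. openin (Top X) U \<and> x \<in> U \<and> E \<inter> U \<subseteq> K" if x: "x \<in> K" for x
  proof -
    have "x \<in> R" using x K stratum_subset_R by blast
    moreover from this have "x \<in> topspace (Top X)" using R_subset_E E_subset_top by blast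
    ultimately obtain \<gamma> r U where U: "holo_disc X \<gamma> r" "\<gamma> 0 = x" "openin (Top X) U" "x \<in> U"
      "E \<inter> U = \<gamma> ` ball 0 r" "E \<inter> U \<subseteq> R"
      using curve_disc_at_regular_point[OF surf, of x E "topspace (Top X)"] by (metis openin_topspace)
    have "connectedin (Top X) (E \<inter> U)"
      unfolding U(5) by (rule holo_disc_connected[OF surf U(1)]) auto
    moreover have "x \<in> E \<inter> U" using \<open>x \<in> R\<close> R_subset_E U(4) by blast
    ultimately have "E \<inter> U \<subseteq> K"
      using stratum_absorbs_connected[OF K] U(6) x by blast
    then show ?thesis using U by blast
  qed
  then obtain U where U: "\<And>x. x \<in> K \<Longrightarrow> openin (Top X) (U x) \<and> x \<in> U x \<and> E \<inter> U x \<subseteq> K"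
    by metis
  show thesis
  proof (rule that)
    show "openin (Top X) (\<Union>x\<in>K. U x)" using U by blast
    show "K = E \<inter> (\<Union>x\<in>K. U x)"
      using U K stratum_subset_R R_subset_E by blast
  qed
qed

text \<open>A regular point belongs to the closure of its own stratum only, because this stratum is a
neighbourhood of the point in \<open>E\<close>.\<close>

lemma strata_eq_if_meets_closure:
  assumes K: "K \<in> strata" and K': "K' \<in> strata" and meet: "x \<in> K" "x \<in> cl K'"
  shows "K = K'"
proof -
  obtain U where U: "openin (Top X) U" "K = E \<inter> U" by (rule stratum_relatively_open[OF K])
  then obtain y where "y \<in> K'" "y \<in> U" using meet by (auto simp: in_closure_of)
  moreover from this have "y \<in> E" using K' stratum_subset_R R_subset_E by blast
  ultimately have "K \<inter> K' \<noteq> {}" using U by blast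
  then show ?thesis using connected_components_of_overlap[OF K K'] by blast
qed

lemma stratum_subset_closure: "K \<in> strata \<Longrightarrow> K \<subseteq> cl K"
  by (meson closure_of_subset connectedin_subset_topspace stratum_connectedin)

lemma closure_stratum_subset: "K \<in> strata \<Longrightarrow> cl K \<subseteq> E"
  using closure_of_minimal[OF _ closed_E] stratum_subset_R R_subset_E by blast

lemma closure_stratum_connectedin: "K \<in> strata \<Longrightarrow> connectedin (Top X) (cl K)"
  by (rule connectedin_closure_of[OF stratum_connectedin])

lemma branch_in_stratum:
  assumes b: "branch_at X E p \<gamma> r"
  obtains K where "K \<in> strata" "\<gamma> ` (ball 0 r - {0}) \<subseteq> K" "p \<in> cl K"
proof -
  have disc: "holo_disc X \<gamma> r" and p: "\<gamma> 0 = p" and reg: "\<gamma> ` (ball 0 r - {0}) \<subseteq> R"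
    using b by (simp_all add: branch_at_def)
  have r: "r > 0" using disc by (simp add: holo_disc_def)
  have conn: "connectedin (Top X) (\<gamma> ` (ball 0 r - {0}))"
    by (rule holo_disc_connected[OF surf disc]) (auto intro!: connected_punctured_ball)
  have mem: "of_real (r / 2) \<in> ball (0::complex) r - {0}" using r by auto
  then obtain K where K: "K \<in> strata" "\<gamma> (of_real (r / 2)) \<in> K"
    using exists_stratum reg by blast
  have sub: "\<gamma> ` (ball 0 r - {0}) \<subseteq> K"
    by (rule stratum_absorbs_connected[OF K(1) conn reg]) (use mem K(2) in blast)
  have "p \<in> cl K"
    unfolding in_closure_of
  proof (intro conjI allI impI)
    have "0 \<in> ball (0::complex) r" using r by simp
    then show "p \<in> topspace (Top X)" using disc p unfolding holo_disc_def by blast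
    fix U assume U: "p \<in> U \<and> openin (Top X) U"
    have "open {t \<in> ball 0 r. \<gamma> t \<in> U}" using holo_disc_open[OF surf disc] U by blast
    moreover have "0 \<in> {t \<in> ball 0 r. \<gamma> t \<in> U}" using U p r by simp
    ultimately obtain d where d: "d > 0" "ball 0 d \<subseteq> {t \<in> ball 0 r. \<gamma> t \<in> U}" using openE by blast
    have "complex_of_real (d / 2) \<in> ball 0 d" "complex_of_real (d / 2) \<noteq> 0" using d(1) by auto
    then have "of_real (d / 2) \<in> {t \<in> ball 0 r. \<gamma> t \<in> U}" "complex_of_real (d / 2) \<noteq> 0" using d(2) by blast+
    then have "\<gamma> (of_real (d / 2)) \<in> K \<and> \<gamma> (of_real (d / 2)) \<in> U" using sub by blast
    then show "\<exists>y. y \<in> K \<and> y \<in> U" by blast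
  qed
  then show thesis using that K(1) sub by blast
qed

text \<open>The strata \<open>K1\<close> and \<open>K2\<close> contain the two branches at \<open>p\<close>; they may be equal.\<close>

lemma strata_at_point:
  assumes p: "p \<in> E"
  obtains K1 K2 U where "K1 \<in> strata" "K2 \<in> strata" "p \<in> cl K1" "p \<in> cl K2"
    "openin (Top X) U" "p \<in> U" "E \<inter> U \<subseteq> K1 \<union> K2 \<union> {p}"
proof -
  obtain r \<gamma>1 \<gamma>2 where r: "0 < r" and b: "branch_at X E p \<gamma>1 r" "branch_at X E p \<gamma>2 r"
    and cover: "\<And>r'. 0 < r' \<Longrightarrow> r' \<le> r \<Longrightarrow>
       \<exists>U. openin (Top X) U \<and> p \<in> U \<and> E \<inter> U = \<gamma>1 ` ball 0 r' \<union> \<gamma>2 ` ball 0 r'"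
    by (rule normal_crossings_branches[OF surf nc p]) blast
  obtain K1 where K1: "K1 \<in> strata" "\<gamma>1 ` (ball 0 r - {0}) \<subseteq> K1" "p \<in> cl K1"
    by (rule branch_in_stratum[OF b(1)])
  obtain K2 where K2: "K2 \<in> strata" "\<gamma>2 ` (ball 0 r - {0}) \<subseteq> K2" "p \<in> cl K2"
    by (rule branch_in_stratum[OF b(2)])
  obtain U where U: "openin (Top X) U" "p \<in> U" "E \<inter> U = \<gamma>1 ` ball 0 r \<union> \<gamma>2 ` ball 0 r"
    using cover[OF r order_refl] by blast
  have "\<gamma>1 0 = p" "\<gamma>2 0 = p" using b by (simp_all add: branch_at_def)
  then have "\<gamma>1 ` ball 0 r \<subseteq> K1 \<union> {p}" "\<gamma>2 ` ball 0 r \<subseteq> K2 \<union> {p}" using K1(2) K2(2) by blast+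
  then have "E \<inter> U \<subseteq> K1 \<union> K2 \<union> {p}" unfolding U(3) by blast
  then show thesis by (rule that[OF K1(1) K2(1) K1(3) K2(3) U(1,2)])
qed

text \<open>Near \<open>p\<close> the curve consists of two branches and \<open>p\<close>, so a stratum whose closure contains \<open>p\<close> either
contains one of the branches or contains \<open>p\<close>; in the latter case it is the only one.\<close>

lemma at_most_two_strata:
  assumes K: "K1 \<in> strata" "K2 \<in> strata" "K3 \<in> strata" and p: "p \<in> cl K1" "p \<in> cl K2" "p \<in> cl K3"
  shows "K1 = K2 \<or> K1 = K3 \<or> K2 = K3"
proof (rule ccontr)
  assume neq: "\<not> ?thesis"
  have "p \<in> E" using closure_stratum_subset K(1) p(1) by blast
  then obtain L1 L2 U where L: "L1 \<in> strata" "L2 \<in> strata" "p \<in> cl L1" "p \<in> cl L2"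
    "openin (Top X) U" "p \<in> U" "E \<inter> U \<subseteq> L1 \<union> L2 \<union> {p}" by (rule strata_at_point)
  have "K = L1 \<or> K = L2" if K': "K \<in> {K1, K2, K3}" for K
  proof -
    have Ks: "K \<in> strata" "p \<in> cl K" using K' K p by auto
    then obtain y where y: "y \<in> K" "y \<in> U" using L(5,6) by (auto simp: in_closure_of)
    then have "y \<in> E" using Ks(1) stratum_subset_R R_subset_E by blast
    then consider "y \<in> L1" | "y \<in> L2" | "y = p" using y L(7) by blast
    then show ?thesis
    proof cases
      case 3
      then have "K = K1" "K = K2"
        using strata_eq_if_meets_closure[OF Ks(1) _ y(1)] K p by blast+
      then show ?thesis using neq by blast
    qed (use connected_components_of_overlap[OF Ks(1) L(1)] connected_components_of_overlap[OF Ks(1) L(2)] y(1) in blast)+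
  qed
  then show False using neq by blast
qed

section \<open>Fibres of a morphism to the projective line along the curve\<close>

lemma H_eq_on_closure:
  assumes eq: "\<And>x. x \<in> A \<Longrightarrow> H x = e" and x: "x \<in> cl A" "x \<in> N"
  shows "H x = e"
proof (rule ccontr)
  assume "H x \<noteq> e"
  then have "x \<in> {x \<in> N. H x \<noteq> e}" using x by blast
  moreover have "\<forall>T. x \<in> T \<and> openin (Top X) T \<longrightarrow> (\<exists>y. y \<in> A \<and> y \<in> T)"
    using x by (simp add: in_closure_of)
  ultimately obtain y where "y \<in> A" "y \<in> {x \<in> N. H x \<noteq> e}"
    using openin_hol_to_cp1_neq[OF surf hol_H, of e] by metis
  then show False using eq by blast
qed

text \<open>The set \<open>S\<close> of points near which \<open>H = e\<close> is open in the stratum. It is also closed: in a disc of \<open>E\<close> that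
meets \<open>S\<close>, the identity theorem in one variable gives \<open>H = e\<close> throughout.\<close>

lemma identity_on_stratum:
  assumes K: "K \<in> strata" and U: "openin (Top X) U" "q \<in> K" "q \<in> U" "\<And>x. x \<in> K \<Longrightarrow> x \<in> U \<Longrightarrow> H x = e"
    and x: "x \<in> cl K"
  shows "H x = e"
proof -
  define S where "S = {x \<in> K. \<exists>U. openin (Top X) U \<and> x \<in> U \<and> (\<forall>y\<in>K \<inter> U. H y = e)}"
  define T where "T = \<Union>{U. openin (Top X) U \<and> (\<forall>y\<in>K \<inter> U. H y = e)}"
  have T: "openin (Top X) T" "S = K \<inter> T" unfolding T_def S_def by blast+
  have "\<exists>M. openin (Top X) M \<and> r \<in> M \<and> M \<inter> S = {}" if r: "r \<in> K" "r \<notin> S" for r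
  proof (cases "H r = e")
    case False
    have "r \<in> N" using r(1) K stratum_subset_R R_subset_E E_subset_N by blast
    moreover have "H y = e" if "y \<in> S" for y using that by (auto simp: S_def)
    ultimately show ?thesis using False openin_hol_to_cp1_neq[OF surf hol_H, of e] by blast
  next
    case True
    obtain W \<kappa> where W: "hol_fun X W \<kappa>" "W \<subseteq> N" "\<And>x. x \<in> N \<Longrightarrow> H x = e \<Longrightarrow> x \<in> W"
      "\<And>x. x \<in> W \<Longrightarrow> \<kappa> x = 0 \<longleftrightarrow> H x = e"
      by (rule hol_to_cp1_coordinate[OF surf hol_H, of e]) blast
    have rR: "r \<in> R" using r(1) K stratum_subset_R by blast
    have "r \<in> W" using W(3)[OF _ True] rR R_subset_E E_subset_N by blast
    then obtain \<gamma> d M where M: "holo_disc X \<gamma> d" "\<gamma> 0 = r" "openin (Top X) M" "r \<in> M" "M \<subseteq> W"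
      "E \<inter> M = \<gamma> ` ball 0 d" "E \<inter> M \<subseteq> R"
      using curve_disc_at_regular_point[OF surf rR hol_fun_openin[OF W(1)]] by metis
    have d: "d > 0" using M(1) by (simp add: holo_disc_def)
    have "connectedin (Top X) (E \<inter> M)"
      unfolding M(6) by (rule holo_disc_connected[OF surf M(1)]) auto
    then have EMK: "E \<inter> M \<subseteq> K"
      by (rule stratum_absorbs_connected[OF K _ M(7)]) (use r(1) rR R_subset_E M(4) in blast)
    have "{t \<in> ball 0 d. \<gamma> t \<in> W} = ball 0 d" using M(5,6) by blast
    then have hol: "(\<lambda>t. \<kappa> (\<gamma> t)) holomorphic_on ball 0 d"
      using M(1) W(1) unfolding holo_disc_def by metis
    have "M \<inter> S = {}"
    proof (rule ccontr)
      assume "M \<inter> S \<noteq> {}"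
      then obtain s where s: "s \<in> M" "s \<in> S" by blast
      then have "s \<in> K" by (simp add: S_def)
      then have "s \<in> E \<inter> M" using s K stratum_subset_R R_subset_E by blast
      then obtain t0 where t0: "t0 \<in> ball 0 d" "s = \<gamma> t0" unfolding M(6) by blast
      obtain U' where U': "openin (Top X) U'" "s \<in> U'" "\<forall>y\<in>K \<inter> U'. H y = e"
        using s(2) by (auto simp: S_def)
      define B where "B = {t \<in> ball 0 d. \<gamma> t \<in> U'}"
      have B: "open B" "B \<subseteq> ball 0 d" "B \<noteq> {}"
        using holo_disc_open[OF surf M(1) U'(1)] t0 U'(2) by (auto simp: B_def)
      have mem: "\<gamma> t \<in> E \<inter> M" if "t \<in> ball 0 d" for t unfolding M(6) using that by blast
      have zB: "\<kappa> (\<gamma> t) = 0" if "t \<in> B" for t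
      proof -
        have "\<gamma> t \<in> E \<inter> M" using mem that B(2) by blast
        then have "\<gamma> t \<in> K" "\<gamma> t \<in> W" using EMK M(5) by blast+
        moreover have "\<gamma> t \<in> U'" using that by (simp add: B_def)
        ultimately show ?thesis using W(4) U'(3) by blast
      qed
      have z: "\<kappa> (\<gamma> t) = 0" if "t \<in> ball 0 d" for t
        by (rule analytic_continuation_open[where f = "\<lambda>t. \<kappa> (\<gamma> t)" and g = "\<lambda>_. 0", OF B(1) _ B(3) _ B(2) hol])
          (use zB that in auto)
      have "H y = e" if "y \<in> E \<inter> M" for y
      proof -
        obtain t where "t \<in> ball 0 d" "y = \<gamma> t" using \<open>y \<in> E \<inter> M\<close> unfolding M(6) by blast
        then show ?thesis using z W(4) that M(5) by blast
      qed
      then have "r \<in> S" using r(1) M(3,4) K stratum_subset_R R_subset_E unfolding S_def by blast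
      then show False using r(2) by blast
    qed
    then show ?thesis using M(3,4) by blast
  qed
  then obtain M where M: "\<And>r. r \<in> K - S \<Longrightarrow> openin (Top X) (M r) \<and> r \<in> M r \<and> M r \<inter> S = {}"
    by (metis DiffE)
  define T' where "T' = (\<Union>r\<in>K - S. M r)"
  have T': "openin (Top X) T'" "K - S = K \<inter> T'" using M unfolding T'_def by blast+
  have "q \<in> S" using U unfolding S_def by blast
  have "K \<subseteq> S"
  proof (rule ccontr)
    assume "\<not> K \<subseteq> S"
    then have "T' \<inter> K \<noteq> {}" "T \<inter> K \<noteq> {}" "T \<inter> T' \<inter> K = {}" "K \<subseteq> T \<union> T'"
      using T T' \<open>q \<in> S\<close> by blast+
    then show False
      using stratum_connectedin[OF K] T(1) T'(1) unfolding connectedin by blast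
  qed
  then have all: "H y = e" if "y \<in> K" for y using that unfolding S_def by blast
  have "x \<in> N" using x closure_stratum_subset[OF K] E_subset_N by blast
  with all x show ?thesis by (rule H_eq_on_closure)
qed

abbreviation "fibre_off e \<equiv> {x \<in> N - E. H x = e}"
abbreviation "ND \<equiv> nondicritical_part X E H"

text \<open>Near \<open>p\<close> the fibre of \<open>H\<close> over \<open>e\<close> lies in \<open>E\<close>. If \<open>H\<close> were constant on neither branch of \<open>E\<close> at \<open>p\<close>, then
\<open>p\<close> would be an isolated point of this fibre, which contradicts the maximum principle for level
curves. So \<open>H = e\<close> on some branch, and the identity theorem extends this to its stratum.\<close>

lemma stratum_in_fibre:
  assumes p: "p \<in> E" "H p = e" and off: "p \<notin> cl (fibre_off e)"
  obtains K where "K \<in> strata" "p \<in> cl K" "\<And>x. x \<in> cl K \<Longrightarrow> H x = e"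
proof -
  obtain W \<kappa> where W: "hol_fun X W \<kappa>" "W \<subseteq> N" "\<And>x. x \<in> N \<Longrightarrow> H x = e \<Longrightarrow> x \<in> W"
      "\<And>x. x \<in> W \<Longrightarrow> \<kappa> x = 0 \<longleftrightarrow> H x = e"
    by (rule hol_to_cp1_coordinate[OF surf hol_H, of e]) blast
  have pW: "p \<in> W" using W(3) p E_subset_N by blast
  have "p \<in> topspace (Top X)" using p(1) E_subset_top by blast
  then obtain U0 where U0: "openin (Top X) U0" "p \<in> U0" "\<not> (\<exists>y. y \<in> fibre_off e \<and> y \<in> U0)"
    using off unfolding in_closure_of by blast
  obtain r \<gamma>1 \<gamma>2 where r: "0 < r" and b: "branch_at X E p \<gamma>1 r" "branch_at X E p \<gamma>2 r"
    and cover: "\<And>r'. 0 < r' \<Longrightarrow> r' \<le> r \<Longrightarrow>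
       \<exists>U. openin (Top X) U \<and> p \<in> U \<and> E \<inter> U = \<gamma>1 ` ball 0 r' \<union> \<gamma>2 ` ball 0 r'"
    by (rule normal_crossings_branches[OF surf nc p(1)]) blast
  have alt: "(\<exists>K\<in>strata. p \<in> cl K \<and> (\<forall>x\<in>cl K. H x = e)) \<or>
      (\<exists>\<epsilon>>0. \<epsilon> \<le> r \<and> (\<forall>t. 0 < cmod t \<and> cmod t < \<epsilon> \<longrightarrow> \<kappa> (\<gamma> t) \<noteq> 0))"
    if b: "branch_at X E p \<gamma> r" for \<gamma>
  proof -
    have disc: "holo_disc X \<gamma> r" and \<gamma>0: "\<gamma> 0 = p"
      using b by (simp_all add: branch_at_def)
    have op: "open {t \<in> ball 0 r. \<gamma> t \<in> W}" and hol: "(\<lambda>t. \<kappa> (\<gamma> t)) holomorphic_on {t \<in> ball 0 r. \<gamma> t \<in> W}"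
      using disc W(1) unfolding holo_disc_def by blast+
    have "0 \<in> {t \<in> ball 0 r. \<gamma> t \<in> W}" using r \<gamma>0 pW by simp
    then obtain d where d: "d > 0" "ball 0 d \<subseteq> {t \<in> ball 0 r. \<gamma> t \<in> W}" using op openE by blast
    define s where "s = min d r"
    have s: "s > 0" "s \<le> r" "ball 0 s \<subseteq> {t \<in> ball 0 r. \<gamma> t \<in> W}"
      using d r by (auto simp: s_def)
    from holomorphic_zero_dichotomy[OF holomorphic_on_subset[OF hol s(3)] s(1)]
    show ?thesis
    proof
      assume z: "\<forall>t\<in>ball 0 s. \<kappa> (\<gamma> t) = 0"
      obtain U where U: "openin (Top X) U" "E \<inter> U = \<gamma> ` (ball 0 s - {0})"
        using b s(1,2) unfolding branch_at_def by blast
      obtain K where K: "K \<in> strata" "\<gamma> ` (ball 0 r - {0}) \<subseteq> K" "p \<in> cl K"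
        by (rule branch_in_stratum[OF b])
      have mem: "of_real (s / 2) \<in> ball (0::complex) s - {0}" using s(1) by auto
      then have "of_real (s / 2) \<in> ball (0::complex) r - {0}" using s(2) by auto
      then have q: "\<gamma> (of_real (s / 2)) \<in> K" using K(2) by blast
      have "\<gamma> (of_real (s / 2)) \<in> E \<inter> U" unfolding U(2) using mem by (rule imageI)
      then have qU: "\<gamma> (of_real (s / 2)) \<in> U" by simp
      have Heq: "H x = e" if "x \<in> K" "x \<in> U" for x
      proof -
        have "x \<in> E \<inter> U" using that K(1) stratum_subset_R R_subset_E by blast
        then obtain t where t: "t \<in> ball 0 s" "x = \<gamma> t" unfolding U(2) by blast
        then have "x \<in> W" using s(3) by blast
        then show ?thesis using z t W(4) by blast
      qed
      have "\<forall>x\<in>cl K. H x = e"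
        using identity_on_stratum[OF K(1) U(1) q qU Heq] by blast
      then show ?thesis using K(1,3) by blast
    next
      assume "\<exists>\<epsilon>>0. \<epsilon> < s \<and> (\<forall>t. 0 < cmod t \<and> cmod t \<le> \<epsilon> \<longrightarrow> \<kappa> (\<gamma> t) \<noteq> 0)"
      then show ?thesis using s(2) by (metis less_eq_real_def order.strict_trans1)
    qed
  qed
  have "\<exists>K\<in>strata. p \<in> cl K \<and> (\<forall>x\<in>cl K. H x = e)"
  proof (rule ccontr)
    assume neg: "\<not> ?thesis"
    obtain e1 where e1: "e1 > 0" "e1 \<le> r" "\<And>t. 0 < cmod t \<Longrightarrow> cmod t < e1 \<Longrightarrow> \<kappa> (\<gamma>1 t) \<noteq> 0"
      using alt[OF b(1)] neg by blast
    obtain e2 where e2: "e2 > 0" "e2 \<le> r" "\<And>t. 0 < cmod t \<Longrightarrow> cmod t < e2 \<Longrightarrow> \<kappa> (\<gamma>2 t) \<noteq> 0"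
      using alt[OF b(2)] neg by blast
    have "0 < min e1 e2" "min e1 e2 \<le> r" using e1(1,2) e2(1,2) by simp_all
    from cover[OF this] obtain U where U: "openin (Top X) U" "p \<in> U"
      "E \<inter> U = \<gamma>1 ` ball 0 (min e1 e2) \<union> \<gamma>2 ` ball 0 (min e1 e2)"
      by blast
    define W' where "W' = W \<inter> (U \<inter> U0)"
    have W': "openin (Top X) W'" "p \<in> W'" "W' \<subseteq> W"
      using hol_fun_openin[OF W(1)] U U0 pW by (auto simp: W'_def)
    obtain x where x: "x \<in> W'" "x \<noteq> p" "\<kappa> x = \<kappa> p"
      (* the maximum principle for a constant function: p is not isolated on its level curve *)
      using surface_zero_with_larger_Re[OF surf hol_fun_subset[OF surf W(1) W'(1,3)] hol_fun_const[OF surf W'(1), of 0] W'(2)]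
      by blast
    have "\<kappa> p = 0" using W(4)[OF pW] p(2) by simp
    then have k0: "\<kappa> x = 0" using x(3) by simp
    have xW: "x \<in> W" "x \<in> U" "x \<in> U0" using x(1) by (simp_all add: W'_def)
    have "H x = e" using W(4)[OF xW(1)] k0 by simp
    then have "x \<in> E" using U0(3) xW W(2) by blast
    then have "x \<in> \<gamma>1 ` ball 0 (min e1 e2) \<union> \<gamma>2 ` ball 0 (min e1 e2)" using xW(2) U(3) by blast
    then obtain t where t: "cmod t < e1" "cmod t < e2" "x = \<gamma>1 t \<or> x = \<gamma>2 t" by auto
    have "t \<noteq> 0" using t(3) x(2) b by (auto simp: branch_at_def)
    then show False using e1(3)[of t] e2(3)[of t] t k0 by auto
  qed
  then show thesis using that by blast
qed

section \<open>The non-dicritical part\<close>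

lemma irreducible_components_iff: "C \<in> irreducible_components X E \<longleftrightarrow> (\<exists>K\<in>strata. C = cl K)"
  by (auto simp: irreducible_components_def)

text \<open>The complement of the dicritical components in \<open>E\<close> contains the non-dicritical strata, and it
contains a node only if neither component through the node is dicritical. Only two strata come close
to a given point, so taking closures commutes with the union over the strata.\<close>

lemma nondicritical_part_iff:
  "p \<in> ND \<longleftrightarrow> (\<exists>K\<in>strata. p \<in> cl K \<and> H constant_on cl K)"
proof
  assume p: "p \<in> ND"
  have "ND \<subseteq> E"
    unfolding nondicritical_part_def by (rule closure_of_minimal[OF _ closed_E]) blast
  then have "p \<in> E" using p by blast
  then obtain K1 K2 U where K: "K1 \<in> strata" "K2 \<in> strata" "p \<in> cl K1" "p \<in> cl K2"
    "openin (Top X) U" "p \<in> U" "E \<inter> U \<subseteq> K1 \<union> K2 \<union> {p}" by (rule strata_at_point)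
  obtain q where q: "q \<in> E - \<Union>(dicritical_components X E H)" "q \<in> U"
    using p K(5,6) unfolding nondicritical_part_def in_closure_of by blast
  have flat: "H constant_on cl L" if "L \<in> strata" "q \<in> cl L" for L
    using q(1) that irreducible_components_iff unfolding dicritical_components_def by blast
  have "q \<in> K1 \<union> K2 \<union> {p}" using q K(7) by blast
  then have "q \<in> cl K1 \<or> q \<in> cl K2"
    using stratum_subset_closure[OF K(1)] stratum_subset_closure[OF K(2)] K(3) by blast
  then show "\<exists>K\<in>strata. p \<in> cl K \<and> H constant_on cl K"
    using flat[OF K(1)] flat[OF K(2)] K by blast
next
  assume "\<exists>K\<in>strata. p \<in> cl K \<and> H constant_on cl K"
  then obtain K where K: "K \<in> strata" "p \<in> cl K" "H constant_on cl K" by blast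
  have "K \<subseteq> E - \<Union>(dicritical_components X E H)"
  proof
    fix x assume x: "x \<in> K"
    have "x \<notin> C" if C: "C \<in> dicritical_components X E H" for C
    proof
      assume "x \<in> C"
      obtain K' where K': "K' \<in> strata" "C = cl K'" "\<not> H constant_on C"
        using C irreducible_components_iff unfolding dicritical_components_def by blast
      then have "K = K'" using strata_eq_if_meets_closure[OF K(1) K'(1) x] \<open>x \<in> C\<close> by blast
      then show False using K' K(3) by blast
    qed
    then show "x \<in> E - \<Union>(dicritical_components X E H)"
      using x K(1) stratum_subset_R R_subset_E by blast
  qed
  then show "p \<in> ND"
    using K(2) closure_of_mono unfolding nondicritical_part_def by blast
qed

lemma ND_subset_E: "ND \<subseteq> E"
  using nondicritical_part_iff closure_stratum_subset by blast

lemma closedin_ND: "closedin (Top X) ND"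
  unfolding nondicritical_part_def by (rule closedin_closure_of)

text \<open>The closure of a single non-dicritical stratum joins \<open>q\<close> to \<open>p\<close> when \<open>q\<close> is close to \<open>p\<close>.\<close>

lemma ND_locally_connected_constant:
  assumes p: "p \<in> ND"
  obtains U where "openin (Top X) U" "p \<in> U"
    "\<And>q. q \<in> ND \<Longrightarrow> q \<in> U \<Longrightarrow> \<exists>C. connectedin (Top X) C \<and> C \<subseteq> ND \<and> p \<in> C \<and> q \<in> C \<and> H q = H p"
proof -
  obtain K1 K2 U where K: "K1 \<in> strata" "K2 \<in> strata" "p \<in> cl K1" "p \<in> cl K2"
    "openin (Top X) U" "p \<in> U" "E \<inter> U \<subseteq> K1 \<union> K2 \<union> {p}"
    using strata_at_point p ND_subset_E by (metis subsetD)
  have "\<exists>C. connectedin (Top X) C \<and> C \<subseteq> ND \<and> p \<in> C \<and> q \<in> C \<and> H q = H p" if q: "q \<in> ND" "q \<in> U" for q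
  proof -
    have "\<exists>K\<in>strata. q \<in> cl K \<and> p \<in> cl K \<and> H constant_on cl K"
    proof (cases "q = p")
      case True
      then show ?thesis using nondicritical_part_iff p by blast
    next
      case False
      then obtain L where L: "L \<in> strata" "p \<in> cl L" "q \<in> L"
        using q K ND_subset_E by blast
      obtain K' where K': "K' \<in> strata" "q \<in> cl K'" "H constant_on cl K'"
        using q(1) nondicritical_part_iff by blast
      have "L = K'" by (rule strata_eq_if_meets_closure[OF L(1) K'(1) L(3) K'(2)])
      then show ?thesis using L(2) K' by blast
    qed
    then obtain K where K: "K \<in> strata" "q \<in> cl K" "p \<in> cl K" "H constant_on cl K" by blast
    have "cl K \<subseteq> ND" using K nondicritical_part_iff by blast
    moreover have "H q = H p" using K(2-4) unfolding constant_on_def by metis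
    ultimately show ?thesis using closure_stratum_connectedin[OF K(1)] K(2,3) by blast
  qed
  then show thesis using that[OF K(5,6)] by blast
qed

lemma ND_component_relatively_open:
  assumes \<Delta>: "\<Delta> \<in> connected_components_of (subtopology (Top X) ND)"
  obtains U where "openin (Top X) U" "\<Delta> = ND \<inter> U"
proof -
  have sub: "\<Delta> \<subseteq> ND" using connected_components_of_subset[OF \<Delta>] by simp
  have "\<exists>U. openin (Top X) U \<and> p \<in> U \<and> ND \<inter> U \<subseteq> \<Delta>" if p: "p \<in> \<Delta>" for p
  proof -
    have "p \<in> ND" using sub p by blast
    then obtain U where U: "openin (Top X) U" "p \<in> U"
      "\<And>q. q \<in> ND \<Longrightarrow> q \<in> U \<Longrightarrow> \<exists>C. connectedin (Top X) C \<and> C \<subseteq> ND \<and> p \<in> C \<and> q \<in> C \<and> H q = H p"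
      by (rule ND_locally_connected_constant) blast
    have "q \<in> \<Delta>" if q: "q \<in> ND" "q \<in> U" for q
    proof -
      obtain C where C: "connectedin (Top X) C" "C \<subseteq> ND" "p \<in> C" "q \<in> C" using U(3)[OF q] by blast
      then have "C \<subseteq> \<Delta>"
        using connected_components_of_maximal[OF \<Delta>, of C] p
        by (auto simp: connectedin_subtopology disjnt_def)
      then show ?thesis using C by blast
    qed
    then show ?thesis using U by blast
  qed
  then obtain U where U: "\<And>p. p \<in> \<Delta> \<Longrightarrow> openin (Top X) (U p) \<and> p \<in> U p \<and> ND \<inter> U p \<subseteq> \<Delta>"
    by metis
  show thesis
    by (rule that[of "\<Union>p\<in>\<Delta>. U p"]) (use U sub in blast)+
qed

lemma H_constant_on_ND_component:
  assumes \<Delta>: "\<Delta> \<in> connected_components_of (subtopology (Top X) ND)" and pq: "p \<in> \<Delta>" "q \<in> \<Delta>"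
  shows "H p = H q"
proof (rule ccontr)
  assume neq: "H p \<noteq> H q"
  have sub: "\<Delta> \<subseteq> ND" using connected_components_of_subset[OF \<Delta>] by simp
  have conn: "connectedin (Top X) \<Delta>"
    using connectedin_connected_components_of[OF \<Delta>] by (simp add: connectedin_subtopology)
  have "\<exists>U. openin (Top X) U \<and> x \<in> U \<and> (\<forall>y\<in>\<Delta> \<inter> U. H y = H x)" if x: "x \<in> \<Delta>" for x
  proof -
    have "x \<in> ND" using sub x by blast
    then obtain U where "openin (Top X) U" "x \<in> U"
      "\<And>q. q \<in> ND \<Longrightarrow> q \<in> U \<Longrightarrow> \<exists>C. connectedin (Top X) C \<and> C \<subseteq> ND \<and> x \<in> C \<and> q \<in> C \<and> H q = H x"
      by (rule ND_locally_connected_constant) blast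
    moreover from this(3) have "\<forall>y\<in>\<Delta> \<inter> U. H y = H x" using sub by blast
    ultimately show ?thesis by blast
  qed
  then obtain U where U: "\<And>x. x \<in> \<Delta> \<Longrightarrow> openin (Top X) (U x)" "\<And>x. x \<in> \<Delta> \<Longrightarrow> x \<in> U x"
    and HU: "\<And>x y. x \<in> \<Delta> \<Longrightarrow> y \<in> \<Delta> \<Longrightarrow> y \<in> U x \<Longrightarrow> H y = H x"
    by (metis IntI)
  define A where "A = (\<Union>x\<in>{x \<in> \<Delta>. H x = H p}. U x)"
  define B where "B = (\<Union>x\<in>{x \<in> \<Delta>. H x \<noteq> H p}. U x)"
  have "openin (Top X) A" "openin (Top X) B"
    unfolding A_def B_def using U(1) by (auto intro!: openin_Union)
  moreover have "\<Delta> \<subseteq> A \<union> B" unfolding A_def B_def using U(2) by blast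
  moreover have "A \<inter> B \<inter> \<Delta> = {}"
  proof -
    have "H y = H p" if "y \<in> A" "y \<in> \<Delta>" for y using that HU unfolding A_def by auto
    moreover have "H y \<noteq> H p" if "y \<in> B" "y \<in> \<Delta>" for y using that HU unfolding B_def by auto
    ultimately show ?thesis by blast
  qed
  moreover have "p \<in> A" unfolding A_def using U(2)[OF pq(1)] pq(1) by blast
  then have "A \<inter> \<Delta> \<noteq> {}" using pq(1) by blast
  moreover have "q \<in> B" unfolding B_def using U(2)[OF pq(2)] pq(2) neq by auto
  then have "B \<inter> \<Delta> \<noteq> {}" using pq(2) by blast
  ultimately show False using conn unfolding connectedin by blast
qed

end

section \<open>Compact neighbourhoods\<close>

lemma hol_fun_continuous_map:
  assumes "complex_surface X" "hol_fun X (topspace (Top X)) F"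
  shows "continuous_map (Top X) euclidean F"
  using hol_fun_openin_preimage[OF assms] by (simp add: continuous_map_def)

text \<open>Closed balls in charts.\<close>

lemma compact_neighbourhood:
  assumes surf: "complex_surface X" and P: "openin (Top X) P" "p \<in> P"
  obtains U C where "openin (Top X) U" "compactin (Top X) C" "p \<in> U" "U \<subseteq> C" "C \<subseteq> P"
proof -
  have "p \<in> topspace (Top X)" using P openin_subset by blast
  then obtain V \<phi> where V: "(V, \<phi>) \<in> Atlas X" "p \<in> V" by (rule atlas_covers[OF surf])
  note top = atlas_top_chart[OF surf V(1)]
  have "open (\<phi> ` (V \<inter> P))" by (rule top_chart_open_image[OF top P(1)])
  moreover have "\<phi> p \<in> \<phi> ` (V \<inter> P)" using V P by blast
  ultimately obtain d where d: "d > 0" "cball (\<phi> p) d \<subseteq> \<phi> ` (V \<inter> P)"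
    using open_contains_cball by blast
  obtain g where g: "homeomorphic_maps (subtopology (Top X) V) (top_of_set (\<phi> ` V)) \<phi> g"
    using top unfolding top_chart_def homeomorphic_map_maps by blast
  have topV: "topspace (subtopology (Top X) V) = V"
    using top_chart_subset[OF top] by auto
  have g\<phi>: "g (\<phi> x) = x" if "x \<in> V" for x
    using g that unfolding homeomorphic_maps_def topV by blast
  have "compactin (top_of_set (\<phi> ` V)) (cball (\<phi> p) d)"
    using d(2) by (auto simp: compactin_subtopology)
  moreover have "continuous_map (top_of_set (\<phi> ` V)) (subtopology (Top X) V) g"
    using g by (simp add: homeomorphic_maps_def)
  ultimately have "compactin (subtopology (Top X) V) (g ` cball (\<phi> p) d)"
    by (rule image_compactin)
  then have comp: "compactin (Top X) (g ` cball (\<phi> p) d)"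
    by (simp add: compactin_subtopology)
  show thesis
  proof
    show "openin (Top X) {x \<in> V. \<phi> x \<in> ball (\<phi> p) d}"
      by (rule top_chart_open_preimage[OF top open_ball])
    show "compactin (Top X) (g ` cball (\<phi> p) d)" by (rule comp)
    show "p \<in> {x \<in> V. \<phi> x \<in> ball (\<phi> p) d}" using V d by simp
    show "{x \<in> V. \<phi> x \<in> ball (\<phi> p) d} \<subseteq> g ` cball (\<phi> p) d"
    proof
      fix x assume x: "x \<in> {x \<in> V. \<phi> x \<in> ball (\<phi> p) d}"
      then have "\<phi> x \<in> cball (\<phi> p) d" by simp
      then have "g (\<phi> x) \<in> g ` cball (\<phi> p) d" by (rule imageI)
      then show "x \<in> g ` cball (\<phi> p) d" using g\<phi> x by simp
    qed
    show "g ` cball (\<phi> p) d \<subseteq> P"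
    proof
      fix y assume "y \<in> g ` cball (\<phi> p) d"
      then obtain x where "x \<in> V" "x \<in> P" "y = g (\<phi> x)" using d(2) by blast
      then show "y \<in> P" using g\<phi> by simp
    qed
  qed
qed

lemma compact_neighbourhood_of_compact:
  assumes surf: "complex_surface X" and P: "openin (Top X) P" and D: "compactin (Top X) D" "D \<subseteq> P"
  obtains U C where "openin (Top X) U" "compactin (Top X) C" "D \<subseteq> U" "U \<subseteq> C" "C \<subseteq> P"
proof -
  have "\<exists>U C. openin (Top X) U \<and> compactin (Top X) C \<and> p \<in> U \<and> U \<subseteq> C \<and> C \<subseteq> P" if "p \<in> D" for p
    using compact_neighbourhood[OF surf P, of p] that D(2) by (metis subsetD)
  then obtain U C where UC: "\<And>p. p \<in> D \<Longrightarrow> openin (Top X) (U p) \<and> compactin (Top X) (C p) \<and> p \<in> U p \<and> U p \<subseteq> C p \<and> C p \<subseteq> P"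
    by metis
  have "\<exists>\<F>. finite \<F> \<and> \<F> \<subseteq> U ` D \<and> D \<subseteq> \<Union>\<F>"
    by (rule compactinD[OF D(1)]) (use UC in blast)+
  then obtain F where F: "finite F" "F \<subseteq> D" "D \<subseteq> \<Union>(U ` F)"
    by (metis finite_subset_image)
  show thesis
  proof
    show "openin (Top X) (\<Union>(U ` F))" using UC F(2) by blast
    show "compactin (Top X) (\<Union>(C ` F))"
      by (rule compactin_Union) (use UC F(1,2) in blast)+
    show "D \<subseteq> \<Union>(U ` F)" by (rule F(3))
    show "\<Union>(U ` F) \<subseteq> \<Union>(C ` F)" "\<Union>(C ` F) \<subseteq> P" using UC F(2) by blast+
  qed
qed

lemma normal_crossings_empty_interior:
  fixes X :: "'x csurface"
  assumes surf: "complex_surface X" and nc: "normal_crossings X E" and P: "openin (Top X) P" "p \<in> P"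
  shows "\<not> P \<subseteq> E"
proof
  assume PE: "P \<subseteq> E"
  then have "p \<in> E" using P by blast
  then obtain V and \<phi> :: "'x \<Rightarrow> complex^2" where V: "p \<in> V" "chart X V \<phi>" "\<phi> p = 0"
    and cases: "E \<inter> V = {x \<in> V. \<phi> x $ 2 = 0} \<or> E \<inter> V = {x \<in> V. \<phi> x $ 1 * \<phi> x $ 2 = 0}"
    using nc unfolding normal_crossings_def by blast
  have top: "top_chart (Top X) V \<phi>" using V by (simp add: chart_def)
  have "open (\<phi> ` (V \<inter> P))" by (rule top_chart_open_image[OF top P(1)])
  moreover have "0 \<in> \<phi> ` (V \<inter> P)" using V P by (metis IntI imageI)
  ultimately obtain d where d: "d > 0" "ball 0 d \<subseteq> \<phi> ` (V \<inter> P)" using openE by blast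
  define a :: complex where "a = of_real (d / 3)"
  have "norm (axis 1 a + axis 2 a :: complex^2) \<le> cmod a + cmod a"
    by (rule order_trans[OF norm_triangle_ineq]) (simp add: norm_axis_eq)
  also have "\<dots> < d" using d(1) by (simp add: a_def)
  finally have "axis 1 a + axis 2 a \<in> \<phi> ` (V \<inter> P)" using d(2) by (simp add: subset_iff)
  then obtain x where x: "x \<in> V" "x \<in> P" "\<phi> x = axis 1 a + axis 2 a" by auto
  have "\<phi> x $ 1 = a" "\<phi> x $ 2 = a" by (simp_all add: x(3) axis_nth_other)
  moreover have "a \<noteq> 0" using d(1) by (simp add: a_def)
  moreover have "x \<in> E" using x(2) PE by blast
  then have "\<phi> x $ 2 = 0 \<or> \<phi> x $ 1 * \<phi> x $ 2 = 0" using cases x(1) by blast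
  ultimately show False by auto
qed

section \<open>Special zones of a resolved pencil\<close>

text \<open>A resolution, seen from the surface: \<open>\<rho>\<close> contracts the compact curve \<open>E\<close> to \<open>z\<close> and is injective
elsewhere.\<close>

locale resolved_pencil = fibred_crossing_curve X E N H
  for X :: "'x csurface" and E N :: "'x set" and H :: "'x \<Rightarrow> cp1" +
  fixes \<rho> :: "'x \<Rightarrow> complex^'n" and z :: "complex^'n"
  assumes compact_E: "compactin (Top X) E"
    and hol_\<rho>: "\<And>i. hol_fun X (topspace (Top X)) (\<lambda>x. \<rho> x $ i)"
    and E_eq: "E = {x \<in> topspace (Top X). \<rho> x = z}"
    and inj_\<rho>: "inj_on \<rho> (topspace (Top X) - E)"
begin

lemma continuous_\<rho>: "continuous_map (Top X) euclidean \<rho>"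
proof -
  have "continuous_map (Top X) euclidean (\<lambda>x. axis i (\<rho> x $ i) :: complex^'n)" for i
  proof -
    have "continuous_map euclidean euclidean (axis i :: complex \<Rightarrow> complex^'n)"
      using linear_continuous_on[OF bounded_linear_axis, of UNIV i] by simp
    from continuous_map_compose[OF hol_fun_continuous_map[OF surf hol_\<rho>] this]
    show ?thesis by (simp add: o_def)
  qed
  then have "continuous_map (Top X) euclidean (\<lambda>x. \<Sum>i\<in>UNIV. axis i (\<rho> x $ i) :: complex^'n)"
    by (intro continuous_map_sum) simp_all
  moreover have "(\<Sum>i\<in>UNIV. axis i (v $ i)) = v" for v :: "complex^'n"
    by (simp add: vec_eq_iff sum_component) (simp add: axis_def)
  ultimately show ?thesis by simp
qed

text \<open>If the closure misses \<open>\<Delta>\<close>, then \<open>{H = e}\<close> agrees with the compact set \<open>\<Delta>\<close> near \<open>\<Delta>\<close>, so a nearby level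
set \<open>F\<close> of the coordinate \<open>\<kappa>\<close> is compact and the distance of \<open>\<rho> x\<close> from \<open>z\<close> attains its maximum on it.
Outside \<open>E\<close> the maximum is a strict local maximum for a suitable linear form in \<open>\<rho>\<close>, by injectivity
of \<open>\<rho>\<close>, against the maximum principle. If the maximum is zero, then \<open>F\<close> lies in \<open>E\<close>, which puts the chosen
point on the non-dicritical part and hence into \<open>\<Delta>\<close>, where \<open>\<kappa> = 0\<close>.\<close>

lemma ND_component_meets_fibre_off:
  assumes \<Delta>: "\<Delta> \<in> connected_components_of (subtopology (Top X) ND)"
    and He: "\<And>x. x \<in> \<Delta> \<Longrightarrow> H x = e"
  shows "cl (fibre_off e) \<inter> \<Delta> \<noteq> {}"
proof
  assume miss: "cl (fibre_off e) \<inter> \<Delta> = {}"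
  have \<Delta>ND: "\<Delta> \<subseteq> ND" using connected_components_of_subset[OF \<Delta>] by simp
  then have \<Delta>E: "\<Delta> \<subseteq> E" using ND_subset_E by blast
  have "closedin (Top X) \<Delta>"
    using closedin_connected_components_of[OF \<Delta>] closedin_ND by (rule closedin_trans_full)
  then have \<Delta>comp: "compactin (Top X) \<Delta>" using closed_compactin[OF compact_E \<Delta>E] by blast
  obtain p where p: "p \<in> \<Delta>" using nonempty_connected_components_of[OF \<Delta>] by blast
  obtain W \<kappa> where W: "hol_fun X W \<kappa>" "W \<subseteq> N" "\<And>x. x \<in> N \<Longrightarrow> H x = e \<Longrightarrow> x \<in> W"
      "\<And>x. x \<in> W \<Longrightarrow> \<kappa> x = 0 \<longleftrightarrow> H x = e"
      "\<And>x y. x \<in> W \<Longrightarrow> y \<in> W \<Longrightarrow> \<kappa> x = \<kappa> y \<longleftrightarrow> H x = H y"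
    by (rule hol_to_cp1_coordinate[OF surf hol_H, of e]) blast
  obtain U where U: "openin (Top X) U" "\<Delta> = ND \<inter> U" by (rule ND_component_relatively_open[OF \<Delta>])
  define P where "P = (U \<inter> W) \<inter> (topspace (Top X) - cl (fibre_off e))"
  have P: "openin (Top X) P" "P \<subseteq> W" "P \<subseteq> U"
    unfolding P_def using U(1) hol_fun_openin[OF W(1)]
    by (intro openin_Int openin_diff openin_topspace closedin_closure_of) blast+
  have \<Delta>P: "\<Delta> \<subseteq> P"
    using U(2) miss W(3)[OF _ He] \<Delta>E E_subset_N E_subset_top unfolding P_def by blast
  have zeros: "x \<in> \<Delta>" if x: "x \<in> P" "\<kappa> x = 0" for x
  proof -
    have Hx: "H x = e" and xN: "x \<in> N" using x P(2) W(2,4) by blast+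
    have off: "x \<in> topspace (Top X)" "x \<notin> cl (fibre_off e)" using x(1) by (simp_all add: P_def)
    have "x \<in> E"
    proof (rule ccontr)
      assume "x \<notin> E"
      then have "x \<in> fibre_off e" using Hx xN by blast
      then have "x \<in> cl (fibre_off e)" using off(1) by (auto simp: in_closure_of)
      then show False using off(2) by blast
    qed
    then obtain K where "K \<in> strata" "x \<in> cl K" "\<And>y. y \<in> cl K \<Longrightarrow> H y = e"
      using stratum_in_fibre[OF _ Hx off(2)] by metis
    then have "x \<in> ND" using nondicritical_part_iff unfolding constant_on_def by blast
    then show ?thesis using U(2) P(3) x(1) by blast
  qed
  obtain O1 C where C: "openin (Top X) O1" "compactin (Top X) C" "\<Delta> \<subseteq> O1" "O1 \<subseteq> C" "C \<subseteq> P"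
    by (rule compact_neighbourhood_of_compact[OF surf P(1) \<Delta>comp \<Delta>P])
  have Haus: "Hausdorff_space (Top X)" using surf by (simp add: complex_surface_def)
  have closedC: "closedin (Top X) C" by (rule compactin_imp_closedin[OF Haus C(2)])
  obtain \<epsilon> where \<epsilon>: "\<epsilon> > 0" "\<And>x. x \<in> C - O1 \<Longrightarrow> \<epsilon> \<le> cmod (\<kappa> x)"
  proof -
    (* a positive lower bound on a compact set, by covering it with the sets of points at which
       the modulus exceeds a reciprocal integer *)
    have Q: "compactin (Top X) (C - O1)"
      by (rule closed_compactin[OF C(2)]) (use closedC C(1) in \<open>auto intro: closedin_diff\<close>)
    define G where "G = (\<lambda>n::nat. {x \<in> W. \<kappa> x \<in> {w. inverse (real (Suc n)) < cmod w}})"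
    have "\<exists>\<F>. finite \<F> \<and> \<F> \<subseteq> range G \<and> C - O1 \<subseteq> \<Union>\<F>"
    proof (rule compactinD[OF Q])
      show "openin (Top X) A" if "A \<in> range G" for A
      proof -
        obtain n where "A = G n" using \<open>A \<in> range G\<close> by blast
        moreover have "open {w. inverse (real (Suc n)) < cmod w}"
          by (intro open_Collect_less continuous_intros)
        ultimately show ?thesis
          unfolding G_def by (simp only: hol_fun_openin_preimage[OF surf W(1)])
      qed
      show "C - O1 \<subseteq> \<Union>(range G)"
      proof
        fix x assume x: "x \<in> C - O1"
        then have "x \<in> P" "x \<notin> \<Delta>" using C(3,5) by blast+
        then have "\<kappa> x \<noteq> 0" using zeros by blast
        then obtain n where "inverse (real (Suc n)) < cmod (\<kappa> x)"
          using reals_Archimedean[of "cmod (\<kappa> x)"] by auto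
        then have "x \<in> G n" using \<open>x \<in> P\<close> P(2) unfolding G_def by blast
        then show "x \<in> \<Union>(range G)" by blast
      qed
    qed
    then obtain I where I: "finite I" "C - O1 \<subseteq> \<Union>(G ` I)" by (metis finite_subset_image)
    define m where "m = Max (insert 0 I)"
    show thesis
    proof (rule that[of "inverse (real (Suc m))"])
      show "inverse (real (Suc m)) > 0" by simp
      fix x assume "x \<in> C - O1"
      then obtain n where n: "n \<in> I" "inverse (real (Suc n)) < cmod (\<kappa> x)" using I(2) by (auto simp: G_def)
      have "n \<le> m" unfolding m_def by (rule Max_ge) (use I n in auto)
      then have "inverse (real (Suc m)) \<le> inverse (real (Suc n))" by (simp add: le_imp_inverse_le)
      also have "\<dots> \<le> cmod (\<kappa> x)" using n(2) by (rule less_imp_le)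
      finally show "inverse (real (Suc m)) \<le> cmod (\<kappa> x)" .
    qed
  qed
  obtain x1 where x1: "x1 \<in> O1" "\<kappa> x1 \<noteq> 0" "cmod (\<kappa> x1) < \<epsilon>"
  proof -
    define B where "B = O1 \<inter> {x \<in> W. \<kappa> x \<in> ball 0 \<epsilon>}"
    have "openin (Top X) B"
      unfolding B_def using C(1) hol_fun_openin_preimage[OF surf W(1) open_ball] by blast
    moreover have "p \<in> B"
    proof -
      have "p \<in> W" using p \<Delta>P P(2) by blast
      moreover from this have "\<kappa> p = 0" using W(4) He[OF p] by simp
      ultimately show ?thesis using p C(3) \<epsilon>(1) by (auto simp: B_def)
    qed
    ultimately have "\<not> B \<subseteq> E" by (rule normal_crossings_empty_interior[OF surf nc])
    then obtain x where x: "x \<in> B" "x \<notin> E" by blast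
    have "\<kappa> x \<noteq> 0"
      using zeros[of x] x \<Delta>E C(4,5) by (auto simp: B_def)
    then show thesis using that[of x] x(1) by (simp add: B_def)
  qed
  define F where "F = {x \<in> C. \<kappa> x = \<kappa> x1}"
  have FO1: "F \<subseteq> O1" using \<epsilon>(2) x1(3) unfolding F_def by force
  have x1F: "x1 \<in> F" using x1 C(4) by (auto simp: F_def)
  have "compactin (Top X) F"
  proof (rule closed_compactin[OF C(2)])
    have "openin (Top X) {x \<in> W. \<kappa> x \<in> - {\<kappa> x1}}"
      by (rule hol_fun_openin_preimage[OF surf W(1)]) blast
    then have "closedin (Top X) (C - {x \<in> W. \<kappa> x \<in> - {\<kappa> x1}})"
      using closedC by (rule closedin_diff[rotated])
    moreover have "C - {x \<in> W. \<kappa> x \<in> - {\<kappa> x1}} = F"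
      using C(5) P(2) by (auto simp: F_def)
    ultimately show "closedin (Top X) F" by simp
  qed (auto simp: F_def)
  moreover have "continuous_map (Top X) euclidean (\<lambda>x. norm (\<rho> x - z))"
    by (intro continuous_map_norm continuous_map_diff continuous_\<rho>) simp
  ultimately have "compactin euclidean ((\<lambda>x. norm (\<rho> x - z)) ` F)" by (rule image_compactin)
  then have "compact ((\<lambda>x. norm (\<rho> x - z)) ` F)" by simp
  then obtain x0 where x0: "x0 \<in> F" "\<And>x. x \<in> F \<Longrightarrow> norm (\<rho> x - z) \<le> norm (\<rho> x0 - z)"
    using compact_attains_sup[of "(\<lambda>x. norm (\<rho> x - z)) ` F"] x1F by blast
  have x0O: "x0 \<in> O1" "x0 \<in> P" "\<kappa> x0 = \<kappa> x1" using x0(1) FO1 C(4,5) by (auto simp: F_def)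
  have inF: "x \<in> F" if "x \<in> O1" "\<kappa> x = \<kappa> x0" for x using that C(4) x0O(3) by (auto simp: F_def)
  show False
  proof (cases "x0 \<in> E")
    case True
    then have "norm (\<rho> x0 - z) = 0" using E_eq by simp
    then have FE: "F \<subseteq> E"
      using x0(2) E_eq closedin_subset[OF closedC] by (force simp: F_def)
    have "x0 \<notin> cl (fibre_off (H x0))"
    proof
      assume "x0 \<in> cl (fibre_off (H x0))"
      then obtain y where y: "y \<in> fibre_off (H x0)" "y \<in> O1"
        using x0O(1) C(1) unfolding in_closure_of by blast
      have "y \<in> W" "x0 \<in> W" using y(2) C(4,5) x0O(2) P(2) by blast+
      then have "\<kappa> y = \<kappa> x0" using W(5) y(1) by blast
      then have "y \<in> E" using inF y(2) FE by blast
      then show False using y(1) by blast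
    qed
    then obtain K where "K \<in> strata" "x0 \<in> cl K" "\<And>x. x \<in> cl K \<Longrightarrow> H x = H x0"
      using stratum_in_fibre[OF True refl] by metis
    then have "x0 \<in> ND" using nondicritical_part_iff unfolding constant_on_def by blast
    then have "x0 \<in> \<Delta>" using U(2) P(3) x0O(2) by blast
    then have "\<kappa> x0 = 0" using He W(4) P(2) x0O(2) by blast
    then show False using x1(2) x0O(3) by simp
  next
    case False
    (* the real part of v is the real inner product with w, so x0 maximises it on F *)
    define w where "w = \<rho> x0 - z"
    define v where "v = (\<lambda>x. \<Sum>i\<in>UNIV. cnj (w $ i) * (\<rho> x $ i + - z $ i))"
    have Rev: "Re (v x) = (\<rho> x - z) \<bullet> w" for x
      unfolding v_def inner_vec_def inner_complex_def by (simp add: algebra_simps)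
    define Q where "Q = O1 \<inter> (topspace (Top X) - E)"
    have Q: "openin (Top X) Q" "Q \<subseteq> W" "Q \<subseteq> topspace (Top X)"
      using C(1,4,5) P(2) closed_E by (auto simp: Q_def)
    have "hol_fun X Q v"
      unfolding v_def
      by (intro hol_fun_sum hol_fun_mult hol_fun_add hol_fun_const surf Q(1)
          hol_fun_subset[OF surf hol_\<rho> Q(1,3)])
    moreover have "x0 \<in> Q" using x0O(1) False openin_subset[OF C(1)] by (auto simp: Q_def)
    ultimately obtain x where x: "x \<in> Q" "x \<noteq> x0" "\<kappa> x = \<kappa> x0" "Re (v x0) \<le> Re (v x)"
      using surface_zero_with_larger_Re[OF surf hol_fun_subset[OF surf W(1) Q(1,2)]] by blast
    have "x \<in> F" using inF x(1,3) by (simp add: Q_def)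
    then have "norm (\<rho> x - z) \<le> norm w" using x0(2) by (simp add: w_def)
    then have "(\<rho> x - z) \<bullet> (\<rho> x - z) \<le> w \<bullet> w"
      by (simp add: dot_square_norm power_mono)
    moreover have "w \<bullet> w \<le> (\<rho> x - z) \<bullet> w" using x(4) unfolding Rev by (simp add: w_def)
    ultimately have "((\<rho> x - z) - w) \<bullet> ((\<rho> x - z) - w) \<le> 0"
      by (simp add: inner_diff_left inner_diff_right inner_commute)
    then have "(\<rho> x - z) - w = 0" by (metis inner_eq_zero_iff inner_ge_zero order_antisym)
    then have "\<rho> x = \<rho> x0" by (simp add: w_def)
    then have "x = x0" using inj_\<rho> x(1) \<open>x0 \<in> Q\<close> by (auto simp: Q_def dest: inj_onD)
    then show False using x(2) by simp
  qed
qed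

lemma dicritical_component_iff:
  "C \<in> dicritical_components X E H \<longleftrightarrow> (\<exists>K\<in>strata. C = cl K \<and> \<not> H constant_on cl K)"
  by (auto simp: dicritical_components_def irreducible_components_iff)

lemma special_zone_subset: "\<Delta> \<in> special_zones X E H \<Longrightarrow> \<Delta> \<subseteq> E"
proof -
  have dic: "C \<subseteq> E" if "C \<in> dicritical_components X E H" for C
    using that closure_stratum_subset unfolding dicritical_component_iff by blast
  assume "\<Delta> \<in> special_zones X E H"
  then consider "\<Delta> \<in> connected_components_of (subtopology (Top X) ND)"
    | p C where "\<Delta> = {p}" "C \<in> dicritical_components X E H" "critical_on_curve X C H p"
    | p C where "\<Delta> = {p}" "C \<in> dicritical_components X E H" "p \<in> C"
    unfolding special_zones_def by blast
  then show ?thesis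
  proof cases
    case 1
    then show ?thesis using connected_components_of_subset[OF 1] ND_subset_E by auto
  next
    case 2
    then show ?thesis using dic unfolding critical_on_curve_def by blast
  next
    case 3
    then show ?thesis using dic by blast
  qed
qed

lemma H_constant_on_special_zone:
  assumes "\<Delta> \<in> special_zones X E H" "p \<in> \<Delta>" "q \<in> \<Delta>"
  shows "H p = H q"
  using assms H_constant_on_ND_component unfolding special_zones_def by blast

text \<open>A zone that the closure misses consists of points in closures of non-dicritical strata. This excludes the critical
points outside the non-dicritical part, and also the intersections of two dicritical components, where
a third stratum would have to pass.\<close>

lemma special_zone_meets_fibre_off:
  assumes \<Delta>: "\<Delta> \<in> special_zones X E H" and He: "H ` \<Delta> = {e}"
  shows "cl (fibre_off e) \<inter> \<Delta> \<noteq> {}"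
proof
  assume miss: "cl (fibre_off e) \<inter> \<Delta> = {}"
  have stratum: "\<exists>K\<in>strata. p \<in> cl K \<and> H constant_on cl K" if "p \<in> \<Delta>" for p
  proof -
    have "p \<in> E" "H p = e" "p \<notin> cl (fibre_off e)"
      using that special_zone_subset[OF \<Delta>] He miss by blast+
    then obtain K where "K \<in> strata" "p \<in> cl K" "\<And>x. x \<in> cl K \<Longrightarrow> H x = e"
      by (rule stratum_in_fibre) blast
    then show ?thesis unfolding constant_on_def by blast
  qed
  consider "\<Delta> \<in> connected_components_of (subtopology (Top X) ND)"
    | p where "\<Delta> = {p}" "p \<notin> ND"
    | p C D where "\<Delta> = {p}" "C \<in> dicritical_components X E H" "D \<in> dicritical_components X E H"
        "C \<noteq> D" "p \<in> C" "p \<in> D"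
    using \<Delta> unfolding special_zones_def by blast
  then show False
  proof cases
    case 1
    then show False using ND_component_meets_fibre_off[OF 1, of e] He miss by blast
  next
    case 2
    then show False using stratum[of p] nondicritical_part_iff by blast
  next
    case 3
    obtain K1 where K1: "K1 \<in> strata" "C = cl K1" "\<not> H constant_on cl K1"
      using 3(2) unfolding dicritical_component_iff by blast
    obtain K2 where K2: "K2 \<in> strata" "D = cl K2" "\<not> H constant_on cl K2"
      using 3(3) unfolding dicritical_component_iff by blast
    obtain K3 where K3: "K3 \<in> strata" "p \<in> cl K3" "H constant_on cl K3"
      using stratum[of p] 3(1) by blast
    have "K1 = K2 \<or> K1 = K3 \<or> K2 = K3"
      using at_most_two_strata[OF K1(1) K2(1) K3(1), of p] 3(5,6) K1(2) K2(2) K3(2) by blast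
    then show False using K1 K2 K3 3(4) by blast
  qed
qed

end

theorem theorem2:
  fixes Z :: "(complex^'n) set" and z :: "complex^'n"
    and f g :: "complex^'n \<Rightarrow> complex"
    and X :: "'x csurface" and \<rho> :: "'x \<Rightarrow> complex^'n"
    and hhat :: "'x \<Rightarrow> cp1" and \<Delta> :: "'x set" and e :: cp1
  assumes "normal_surface_germ Z z"
    and "finite_morphism_germ Z z f g"
    and "minimal_good_pencil_resolution Z z f g X \<rho>"
    and "pencil_extension z f g X \<rho> hhat"
    and "\<Delta> \<in> special_zones X (exceptional_divisor z X \<rho>) hhat"
  shows "strict_transform z X \<rho> (pencil_fibre Z f g e) \<inter> \<Delta> \<noteq> {} \<longleftrightarrow>
    e \<in> special_values X (exceptional_divisor z X \<rho>) hhat \<and> hhat ` \<Delta> = {e}"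
proof -
  define E where "E = exceptional_divisor z X \<rho>"
  have good: "good_resolution Z z X \<rho>"
    using assms(3) by (simp add: minimal_good_pencil_resolution_def good_pencil_resolution_def)
  then have res: "resolution Z z X \<rho>" and nc: "normal_crossings X E"
    by (simp_all add: good_resolution_def E_def)
  then have surf: "complex_surface X" by (simp add: resolution_def)
  obtain U where U: "z \<in> U" "\<rho> ` topspace (Top X) = Z \<inter> U"
      "proper_map (Top X) (top_of_set (Z \<inter> U)) \<rho>"
      "\<And>i. hol_fun X (topspace (Top X)) (\<lambda>x. \<rho> x $ i)"
      "bij_betw \<rho> (topspace (Top X) - E) (Z \<inter> U - {z})"
    using res unfolding resolution_def E_def by blast
  have "z \<in> Z" using assms(1) by (simp add: normal_surface_germ_def analytic_germ_def)
  have E_eq: "E = {x \<in> topspace (Top X). \<rho> x = z}" by (simp add: E_def exceptional_divisor_def)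
  have compE: "compactin (Top X) E"
    using U(1,3) \<open>z \<in> Z\<close> unfolding E_eq proper_map_def by simp
  obtain N where N: "E \<subseteq> N" "hol_to_cp1 X N hhat"
    and ext: "\<And>x. x \<in> N - E \<Longrightarrow> (f (\<rho> x), g (\<rho> x)) \<noteq> (0, 0) \<and> hhat x = hom_point (f (\<rho> x)) (g (\<rho> x))"
    using assms(4) unfolding pencil_extension_def E_def by blast
  have Haus: "Hausdorff_space (Top X)" using surf by (simp add: complex_surface_def)
  interpret resolved_pencil X E N hhat \<rho> z
  proof
    show "closedin (Top X) E" by (rule compactin_imp_closedin[OF Haus compE])
    show "inj_on \<rho> (topspace (Top X) - E)" using U(5) by (rule bij_betw_imp_inj_on)
  qed (use surf nc N compE U(4) E_eq in auto)
  have \<Delta>: "\<Delta> \<in> special_zones X E hhat" using assms(5) by (simp add: E_def)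
  have \<Delta>E: "\<Delta> \<subseteq> E" by (rule special_zone_subset[OF \<Delta>])
  define S where "S = {x \<in> topspace (Top X). \<rho> x \<in> pencil_fibre Z f g e - {z}}"
  have S_iff: "x \<in> S \<longleftrightarrow> x \<in> fibre_off e" if x: "x \<in> N" for x
  proof -
    have xX: "x \<in> topspace (Top X)" using x openin_subset[OF openin_N] by blast
    then have \<rho>x: "\<rho> x \<in> Z" using U(2) by blast
    show ?thesis
    proof (cases "x \<in> E")
      case True
      then show ?thesis by (simp add: S_def E_eq)
    next
      case False
      then have nz: "(f (\<rho> x), g (\<rho> x)) \<noteq> (0, 0)" and Hx: "hhat x = hom_point (f (\<rho> x)) (g (\<rho> x))"
        using ext x by blast+
      have "\<rho> x \<in> pencil_fibre Z f g e \<longleftrightarrow>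
          (\<exists>w1 w2. (w1, w2) \<noteq> (0, 0) \<and> e = hom_point w1 w2 \<and> w2 * f (\<rho> x) - w1 * g (\<rho> x) = 0)"
        using \<rho>x by (simp add: pencil_fibre_def)
      also have "\<dots> \<longleftrightarrow> (\<exists>w1 w2. (w1, w2) \<noteq> (0, 0) \<and> e = hom_point w1 w2 \<and> hhat x = hom_point w1 w2)"
      proof -
        have "w2 * f (\<rho> x) - w1 * g (\<rho> x) = 0 \<longleftrightarrow> hhat x = hom_point w1 w2" if "(w1, w2) \<noteq> (0, 0)" for w1 w2
          unfolding Hx hom_point_eq_iff[OF nz that] by (simp add: mult.commute)
        then show ?thesis by metis
      qed
      also have "\<dots> \<longleftrightarrow> hhat x = e" using hom_point_cases[of e] by metis
      finally show ?thesis using False x xX by (auto simp: S_def E_eq)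
    qed
  qed
  have cl_iff: "x \<in> Top X closure_of S \<longleftrightarrow> x \<in> Top X closure_of (fibre_off e)" if x: "x \<in> E" for x
  proof -
    have eq: "N \<inter> S = N \<inter> fibre_off e" using S_iff by blast
    have "N \<inter> Top X closure_of S = N \<inter> Top X closure_of (N \<inter> S)"
      by (rule openin_Int_closure_of_eq[OF openin_N])
    also have "\<dots> = N \<inter> Top X closure_of (N \<inter> fibre_off e)" by (simp only: eq)
    also have "\<dots> = N \<inter> Top X closure_of (fibre_off e)"
      by (rule sym, rule openin_Int_closure_of_eq[OF openin_N])
    finally show ?thesis using x N(1) by blast
  qed
  have meets: "strict_transform z X \<rho> (pencil_fibre Z f g e) \<inter> \<Delta> \<noteq> {} \<longleftrightarrow>
      Top X closure_of (fibre_off e) \<inter> \<Delta> \<noteq> {}"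
    unfolding strict_transform_def S_def[symmetric] using cl_iff \<Delta>E by blast
  show ?thesis
    unfolding meets E_def[symmetric]
  proof
    assume "Top X closure_of (fibre_off e) \<inter> \<Delta> \<noteq> {}"
    then obtain p where p: "p \<in> Top X closure_of (fibre_off e)" "p \<in> \<Delta>" by blast
    have "p \<in> N" using p(2) \<Delta>E N(1) by blast
    have "hhat p = e" by (rule H_eq_on_closure[OF _ p(1) \<open>p \<in> N\<close>]) blast
    then have "hhat q = e" if "q \<in> \<Delta>" for q
      using H_constant_on_special_zone[OF \<Delta> p(2) that] by simp
    then have "hhat ` \<Delta> = {e}" using p(2) by blast
    then show "e \<in> special_values X E hhat \<and> hhat ` \<Delta> = {e}"
      using \<Delta> unfolding special_values_def by blast
  next
    assume "e \<in> special_values X E hhat \<and> hhat ` \<Delta> = {e}"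
    then show "Top X closure_of (fibre_off e) \<inter> \<Delta> \<noteq> {}"
      using special_zone_meets_fibre_off[OF \<Delta>] by blast
  qed
qed

end
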